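(* For every $i\ge1$ and $m\ge3$, the following families are in bijection: (1) $i$-enriched $m$-bipartite trees such that the unique node-child of the root node is its rightmost child; (2) the family $\mathcal Q_i$ of admissible marked $m$-regular bipartite maps with multiplicities adding up to less than $i$. The bijection can be chosen such that the number of black nodes in the first family corresponds to the number of black vertices in the second family. The counting series of both families is $q_i(g)$, with $g$ conjugate to the number of black nodes (resp. black vertices).
   Context: Maps. A map is a cellular embedding of a connected graph (multiple edges allowed) in a closed oriented surface of arbitrary genus, up to orientation-preserving homeomorphism. An $m$-regular bipartite map is a map whose vertices all have degree $m$ and are colored black or white so that adjacent vertices have different colors. It is rooted if a corner at a white vertex $v_0$ (the root vertex) is marked. A marked map is a rooted map where some edges are marked and given a fixed orientation. An orientation of all its edges is compatible if it agrees with the fixed orientation of the marked edges; a compatible orientation is root-accessible if from each vertex there is an oriented path to the root vertex avoiding the marked edges. A 1-orientation is an orientation in which each white vertex has outdegree $m-1$ and each black vertex has outdegree $1$. A marked $m$-regular bipartite map is admissible if it admits a compatible root-accessible 1-orientation in which the unique ingoing edge at $v_0$ is the one preceding the root corner in clockwise order around $v_0$. A marked map with multiplicities is a marked map where each marked edge carries a multiplicity which is a positive integer; in $\mathcal Q_i$ the sum of all multiplicities is required to be strictly less than $i$. Trees. Trees are plane trees; vertices of degree 1 are leaves, the others are nodes. A rooted tree is a plane tree with a marked leaf (the root leaf); the node adjacent to it, if any, is the root node. Children of a node are ordered from left to right following the clockwise walk around the tree (outer face on the left) starting at the root leaf. A blossoming tree is a rooted tree whose leaves are of two kinds, opening and closing,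 with as many opening as closing leaves, the root leaf being opening. An $m$-bipartite tree is a blossoming tree that is either nodeless (a single edge joining two leaves), or has its nodes colored black or white with no edge joining two nodes of the same color, all nodes of degree $m$, the root node white, all opening (resp. closing) leaves adjacent to white (resp. black) nodes, and every white node having exactly one child that is a black node, its other $m-2$ children being opening leaves. The trees in family (1) have a root node, hence are not nodeless. For $i\ge1$, read the non-root leaves in the clockwise walk and draw the path starting at height $i$ with an up-step for each opening leaf and a down-step for each closing leaf; a closing leaf has $i$-height $h$ if its down-step goes from $h$ to $h-1$; the tree is $i$-balanced if all closing leaves have $i$-height at least $1$. An $i$-enriched $m$-bipartite tree is an $i$-balanced $m$-bipartite tree where each closing leaf of $i$-height $h$ carries an integer in $\{0,\dots,h-1\}$. Series. The formal power series $r_i(g),q_i(g)$, $i\ge1$, are uniquely determined by $$r_i(g)=i+\sum_{a=0}^{m-2}q_{i-a}(g),\qquad q_i(g)=g\prod_{a=0}^{m-2}r_{i+a}(g),\qquad i\ge 1,$$ with the convention $q_j(g)=0$ for $j\le0$. *)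

theory Defs
  imports
    "HOL-Combinatorics.Permutations"
    "HOL-Combinatorics.Orbits"
    "HOL-Computational_Algebra.Formal_Power_Series"
begin

section \<open>Maps\<close>

text \<open>
  A cellular embedding of a connected graph in a closed oriented surface, up to
  orientation-preserving homeomorphism, is encoded by its rotation system.  A dart is an edge
  together with one of its two ends; \<open>rot\<close> sends a dart to the next dart in clockwise order around
  the same vertex, and \<open>opp\<close> sends it to the other dart of the same edge.  The vertices are the
  cycles of \<open>rot\<close>, the faces are the cycles of the composite of \<open>rot\<close> and \<open>opp\<close>, and no condition
  on the genus is imposed.  Darts are natural numbers, which loses nothing because the dart set is
  finite and maps are considered up to relabelling.  The one-vertex map without edges is excluded;
  it is never regular of positive degree.
\<close>

record cmap =
  darts :: "nat set"
  rot :: "nat \<Rightarrow> nat"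
  opp :: "nat \<Rightarrow> nat"

definition vertex_at :: "('b) cmap_scheme \<Rightarrow> nat \<Rightarrow> nat set" where
  "vertex_at M d = orbit (rot M) d"

definition vertices :: "('b) cmap_scheme \<Rightarrow> nat set set" where
  "vertices M = vertex_at M ` darts M"

definition adjacency :: "('b) cmap_scheme \<Rightarrow> (nat set \<times> nat set) set" where
  "adjacency M = {(vertex_at M d, vertex_at M (opp M d)) | d. d \<in> darts M}"

definition is_map :: "('b) cmap_scheme \<Rightarrow> bool" where
  "is_map M \<longleftrightarrow>
     finite (darts M) \<and> darts M \<noteq> {} \<and>
     rot M permutes darts M \<and> opp M permutes darts M \<and>
     (\<forall>d\<in>darts M. opp M d \<noteq> d \<and> opp M (opp M d) = d) \<and>
     (\<forall>u\<in>vertices M. \<forall>v\<in>vertices M. (u, v) \<in> (adjacency M)\<^sup>*)"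

text \<open>
  \<open>white\<close> is the set of white vertices.  The root corner lies between the darts \<open>root_dart\<close> and
  \<open>rot root_dart\<close>, so \<open>root_dart\<close> is the dart preceding the root corner in clockwise order around
  the root vertex.  A dart \<open>d\<close> in \<open>marks\<close> means that its edge is marked, with the fixed orientation
  leaving the vertex of \<open>d\<close>; hence each marked edge has exactly one dart in \<open>marks\<close>, and \<open>emult\<close>
  on \<open>marks\<close> gives the multiplicities of the marked edges (its other values are irrelevant).
\<close>

record marked_map = cmap +
  white :: "nat set set"
  root_dart :: nat
  marks :: "nat set"
  emult :: "nat \<Rightarrow> nat"

definition black :: "marked_map \<Rightarrow> nat set set" where
  "black M = vertices M - white M"

definition regular_bipartite :: "nat \<Rightarrow> marked_map \<Rightarrow> bool" where
  "regular_bipartite m M \<longleftrightarrow>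
     is_map M \<and> (\<forall>v\<in>vertices M. card v = m) \<and> white M \<subseteq> vertices M \<and>
     (\<forall>d\<in>darts M. vertex_at M d \<in> white M \<longleftrightarrow> vertex_at M (opp M d) \<notin> white M)"

definition root_vertex :: "marked_map \<Rightarrow> nat set" where
  "root_vertex M = vertex_at M (root_dart M)"

definition rooted :: "marked_map \<Rightarrow> bool" where
  "rooted M \<longleftrightarrow> root_dart M \<in> darts M \<and> root_vertex M \<in> white M"

definition marked :: "marked_map \<Rightarrow> bool" where
  "marked M \<longleftrightarrow> marks M \<subseteq> darts M \<and> (\<forall>d\<in>marks M. opp M d \<notin> marks M)"

text \<open>An orientation of all edges is given by its set of outgoing darts.\<close>

definition orientation :: "marked_map \<Rightarrow> nat set \<Rightarrow> bool" where
  "orientation M X \<longleftrightarrow> X \<subseteq> darts M \<and> (\<forall>d\<in>darts M. d \<in> X \<longleftrightarrow> opp M d \<notin> X)"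

definition outgoing :: "nat set \<Rightarrow> nat set \<Rightarrow> nat set" where
  "outgoing X v = v \<inter> X"

definition ingoing :: "nat set \<Rightarrow> nat set \<Rightarrow> nat set" where
  "ingoing X v = v - X"

definition compatible :: "marked_map \<Rightarrow> nat set \<Rightarrow> bool" where
  "compatible M X \<longleftrightarrow> marks M \<subseteq> X"

definition unmarked_steps :: "marked_map \<Rightarrow> nat set \<Rightarrow> (nat set \<times> nat set) set" where
  "unmarked_steps M X =
     {(vertex_at M d, vertex_at M (opp M d)) | d. d \<in> X \<and> d \<notin> marks M \<and> opp M d \<notin> marks M}"

definition root_accessible :: "marked_map \<Rightarrow> nat set \<Rightarrow> bool" where
  "root_accessible M X \<longleftrightarrow> (\<forall>v\<in>vertices M. (v, root_vertex M) \<in> (unmarked_steps M X)\<^sup>*)"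

definition one_orientation :: "nat \<Rightarrow> marked_map \<Rightarrow> nat set \<Rightarrow> bool" where
  "one_orientation m M X \<longleftrightarrow>
     orientation M X \<and>
     (\<forall>v\<in>white M. card (outgoing X v) = m - 1) \<and>
     (\<forall>v\<in>black M. card (outgoing X v) = 1)"

definition admissible :: "nat \<Rightarrow> marked_map \<Rightarrow> bool" where
  "admissible m M \<longleftrightarrow>
     (\<exists>X. one_orientation m M X \<and> compatible M X \<and> root_accessible M X \<and>
          ingoing X (root_vertex M) = {root_dart M})"

definition labelled_Q :: "nat \<Rightarrow> nat \<Rightarrow> marked_map set" where
  "labelled_Q m i =
     {M. regular_bipartite m M \<and> rooted M \<and> marked M \<and> admissible m M \<and>
         (\<forall>d\<in>marks M. emult M d \<ge> 1) \<and> (\<Sum>d\<in>marks M. emult M d) < i}"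

definition map_iso :: "(nat \<Rightarrow> nat) \<Rightarrow> marked_map \<Rightarrow> marked_map \<Rightarrow> bool" where
  "map_iso f M N \<longleftrightarrow>
     bij_betw f (darts M) (darts N) \<and>
     (\<forall>d\<in>darts M. f (rot M d) = rot N (f d)) \<and>
     (\<forall>d\<in>darts M. f (opp M d) = opp N (f d)) \<and>
     white N = (\<lambda>v. f ` v) ` white M \<and>
     root_dart N = f (root_dart M) \<and>
     marks N = f ` marks M \<and>
     (\<forall>d\<in>marks M. emult N (f d) = emult M d)"

definition iso_rel :: "nat \<Rightarrow> nat \<Rightarrow> (marked_map \<times> marked_map) set" where
  "iso_rel m i = {(M, N). M \<in> labelled_Q m i \<and> N \<in> labelled_Q m i \<and> (\<exists>f. map_iso f M N)}"

definition Q_family :: "nat \<Rightarrow> nat \<Rightarrow> marked_map set set" where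
  "Q_family m i = labelled_Q m i // iso_rel m i"

definition black_vertices :: "marked_map set \<Rightarrow> nat" where
  "black_vertices C = the_elem ((\<lambda>M. card (black M)) ` C)"

lemma map_iso_refl: "map_iso id M M"
  by (simp add: map_iso_def)

lemma labelled_Q_sub:
  assumes "M \<in> labelled_Q m i"
  shows "marks M \<subseteq> darts M" "root_dart M \<in> darts M" "\<And>v. v \<in> white M \<Longrightarrow> v \<subseteq> darts M"
    "\<And>d. d \<in> darts M \<Longrightarrow> rot M d \<in> darts M" "\<And>d. d \<in> darts M \<Longrightarrow> opp M d \<in> darts M"
    "\<And>v. v \<in> vertices M \<Longrightarrow> v \<subseteq> darts M"
proof -
  have rot: "rot M permutes darts M" and opp: "opp M permutes darts M"
    and w: "white M \<subseteq> vertices M"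
    using assms by (auto simp: labelled_Q_def regular_bipartite_def is_map_def)
  show "marks M \<subseteq> darts M" "root_dart M \<in> darts M"
    using assms by (auto simp: labelled_Q_def marked_def rooted_def)
  show "rot M d \<in> darts M" "opp M d \<in> darts M" if "d \<in> darts M" for d
    using that rot opp by (auto simp: permutes_in_image)
  show v: "v \<subseteq> darts M" if "v \<in> vertices M" for v
    using that permutes_orbit_subset[OF rot] by (auto simp: vertices_def vertex_at_def)
  show "v \<subseteq> darts M" if "v \<in> white M" for v
    using that w v by blast
qed

lemma map_iso_sym:
  assumes M: "M \<in> labelled_Q m i" and iso: "map_iso f M N"
  shows "map_iso (inv_into (darts M) f) N M"
proof -
  let ?g = "inv_into (darts M) f"
  note sub = labelled_Q_sub[OF M]
  have bij: "bij_betw f (darts M) (darts N)"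
    using iso by (simp add: map_iso_def)
  have inj: "inj_on f (darts M)" using bij by (rule bij_betw_imp_inj_on)
  have gf: "?g (f d) = d" if "d \<in> darts M" for d
    using inj that by simp
  have im: "?g ` f ` S = S" if "S \<subseteq> darts M" for S
    using inj that by (rule inv_into_image_cancel)
  have N: "darts N = f ` darts M" using bij by (simp add: bij_betw_def)
  have wh: "(\<lambda>v. ?g ` v) ` (\<lambda>v. f ` v) ` white M = white M"
    unfolding image_image[of _ "\<lambda>v. f ` v"] using sub(3) im by simp
  have r: "\<And>d. d \<in> darts M \<Longrightarrow> rot N (f d) = f (rot M d)"
    and o: "\<And>d. d \<in> darts M \<Longrightarrow> opp N (f d) = f (opp M d)"
    using iso by (auto simp: map_iso_def)
  show ?thesis
    unfolding map_iso_def
  proof (intro conjI)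
    show "bij_betw ?g (darts N) (darts M)" using bij by (rule bij_betw_inv_into)
    show "\<forall>d\<in>darts N. ?g (rot N d) = rot M (?g d)"
      using sub(4) by (auto simp: N r gf)
    show "\<forall>d\<in>darts N. ?g (opp N d) = opp M (?g d)"
      using sub(5) by (auto simp: N o gf)
    show "white M = (\<lambda>v. ?g ` v) ` white N"
      using iso wh by (simp add: map_iso_def)
    show "root_dart M = ?g (root_dart N)"
      using iso sub(2) gf by (simp add: map_iso_def)
    show "marks M = ?g ` marks N"
      using iso sub(1) im by (simp add: map_iso_def)
    show "\<forall>d\<in>marks N. emult M (?g d) = emult N d"
      using iso sub(1) gf by (auto simp: map_iso_def)
  qed
qed

lemma map_iso_trans:
  assumes M: "M \<in> labelled_Q m i" and f: "map_iso f M N" and g: "map_iso g N P"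
  shows "map_iso (g \<circ> f) M P"
  unfolding map_iso_def
proof (intro conjI)
  have bij: "bij_betw f (darts M) (darts N)" using f by (simp add: map_iso_def)
  have mem: "f d \<in> darts N" if "d \<in> darts M" for d
    using bij that by (rule bij_betw_apply)
  show "bij_betw (g \<circ> f) (darts M) (darts P)"
    using f g by (auto simp: map_iso_def intro: bij_betw_trans)
  show "\<forall>d\<in>darts M. (g \<circ> f) (rot M d) = rot P ((g \<circ> f) d)"
    using f g mem by (auto simp: map_iso_def)
  show "\<forall>d\<in>darts M. (g \<circ> f) (opp M d) = opp P ((g \<circ> f) d)"
    using f g mem by (auto simp: map_iso_def)
  show "white P = (\<lambda>v. (g \<circ> f) ` v) ` white M"
    using f g by (simp add: map_iso_def image_image image_comp o_def)
  show "root_dart P = (g \<circ> f) (root_dart M)" "marks P = (g \<circ> f) ` marks M"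
    using f g by (simp_all add: map_iso_def image_image)
  show "\<forall>d\<in>marks M. emult P ((g \<circ> f) d) = emult M d"
    using f g by (auto simp: map_iso_def)
qed

lemma equiv_iso_rel: "equiv (labelled_Q m i) (iso_rel m i)"
proof (rule equivI)
  show "iso_rel m i \<subseteq> labelled_Q m i \<times> labelled_Q m i"
    by (auto simp: iso_rel_def)
  show "refl_on (labelled_Q m i) (iso_rel m i)"
    using map_iso_refl by (auto simp: refl_on_def iso_rel_def)
  show "sym (iso_rel m i)"
    unfolding sym_def iso_rel_def by (blast intro: map_iso_sym)
  show "trans (iso_rel m i)"
    unfolding trans_def iso_rel_def by (blast intro: map_iso_trans)
qed

text \<open>The number of black vertices does not depend on the representative.\<close>

lemma map_iso_black:
  assumes M: "M \<in> labelled_Q m i" and iso: "map_iso f M N"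
  shows "card (black N) = card (black M)"
proof -
  note sub = labelled_Q_sub[OF M]
  have inj: "inj_on f (darts M)" and N: "darts N = f ` darts M"
    using iso by (auto simp: map_iso_def bij_betw_def)
  have "(rot M ^^ n) d \<in> darts M \<and> (rot N ^^ n) (f d) = f ((rot M ^^ n) d)"
    if "d \<in> darts M" for d n
    using that iso sub(4) by (induction n) (auto simp: map_iso_def)
  then have "vertex_at N (f d) = f ` vertex_at M d" if "d \<in> darts M" for d
    using that unfolding vertex_at_def orbit_altdef by (force simp: image_iff)
  then have "vertices N = (\<lambda>v. f ` v) ` vertices M"
    unfolding vertices_def N image_image by (intro image_cong) auto
  moreover have "white N = (\<lambda>v. f ` v) ` white M"
    using iso by (simp add: map_iso_def)
  moreover have inj_v: "inj_on (\<lambda>v. f ` v) (vertices M)"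
    using inj_on_image_Pow[OF inj] sub(6) by (auto intro: inj_on_subset)
  moreover have "white M \<subseteq> vertices M"
    using M by (simp add: labelled_Q_def regular_bipartite_def)
  ultimately have "black N = (\<lambda>v. f ` v) ` black M"
    unfolding black_def by (simp add: inj_on_image_set_diff[OF inj_v])
  moreover have "inj_on (\<lambda>v. f ` v) (black M)"
    using inj_v by (rule inj_on_subset) (auto simp: black_def)
  ultimately show ?thesis
    by (simp add: card_image)
qed

lemma black_vertices_class:
  assumes "C \<in> Q_family m i" "M \<in> C"
  shows "black_vertices C = card (black M)"
proof -
  have "(\<lambda>N. card (black N)) ` C = {card (black M)}"
  proof (intro equalityI subsetI)
    fix k assume "k \<in> (\<lambda>N. card (black N)) ` C"
    then obtain N where N: "N \<in> C" "k = card (black N)" by blast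
    have "(M, N) \<in> iso_rel m i"
      using quotient_eq_iff[OF equiv_iso_rel, of C m i C M N] assms N
      by (auto simp: Q_family_def)
    then show "k \<in> {card (black M)}"
      using N map_iso_black by (auto simp: iso_rel_def)
  qed (use assms in auto)
  then show ?thesis
    by (simp add: black_vertices_def)
qed


section \<open>Trees\<close>

text \<open>
  A rooted plane tree consists of the root leaf, which stays implicit, and the tree hanging from it:
  either a single further leaf (the nodeless tree) or the root node with its children listed from
  left to right.  Thus the degree of a node is one more than its number of children, and all
  children lists are nonempty.  Colors are attached to nodes and closing leaves carry a label.
\<close>

datatype color = Black | White

datatype 'a leaf = Opening | Closing 'a

datatype 'a plane_tree = Leaf "'a leaf" | Node color "'a plane_tree list"

text \<open>The non-root leaves in the order of the clockwise walk.\<close>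

primrec walk :: "'a plane_tree \<Rightarrow> 'a leaf list" where
  "walk (Leaf l) = [l]"
| "walk (Node c ts) = concat (map walk ts)"

primrec nodes :: "'a plane_tree \<Rightarrow> (color \<times> 'a plane_tree list) set" where
  "nodes (Leaf l) = {}"
| "nodes (Node c ts) = insert (c, ts) (\<Union> (set (map nodes ts)))"

primrec black_nodes :: "'a plane_tree \<Rightarrow> nat" where
  "black_nodes (Leaf l) = 0"
| "black_nodes (Node c ts) = (if c = Black then 1 else 0) + sum_list (map black_nodes ts)"

definition is_closing :: "'a leaf \<Rightarrow> bool" where
  "is_closing l \<longleftrightarrow> l \<noteq> Opening"

definition is_node :: "'a plane_tree \<Rightarrow> bool" where
  "is_node t \<longleftrightarrow> (\<exists>c ts. t = Node c ts)"

definition is_black_node :: "'a plane_tree \<Rightarrow> bool" where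
  "is_black_node t \<longleftrightarrow> (\<exists>ts. t = Node Black ts)"

text \<open>As many opening as closing leaves, the root leaf being counted as an opening leaf.\<close>

definition blossoming :: "'a plane_tree \<Rightarrow> bool" where
  "blossoming t \<longleftrightarrow>
     Suc (length (filter (\<lambda>l. \<not> is_closing l) (walk t))) = length (filter is_closing (walk t))"

text \<open>
  The condition on the parent edge of the root node, namely that the opening root leaf is adjacent
  to a white node, is contained in the requirement that the root node be white.
\<close>

definition m_bipartite :: "nat \<Rightarrow> 'a plane_tree \<Rightarrow> bool" where
  "m_bipartite m t \<longleftrightarrow>
     blossoming t \<and>
     ((\<exists>l. t = Leaf l) \<or>
      (\<exists>ts. t = Node White ts) \<and>
      (\<forall>(c, ts)\<in>nodes t.
         Suc (length ts) = m \<and>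
         (\<forall>us. Node c us \<notin> set ts) \<and>
         (Leaf Opening \<in> set ts \<longrightarrow> c = White) \<and>
         (\<forall>x. Leaf (Closing x) \<in> set ts \<longrightarrow> c = Black) \<and>
         (c = White \<longrightarrow>
            length (filter is_black_node ts) = 1 \<and>
            (\<forall>u\<in>set ts. is_black_node u \<or> u = Leaf Opening))))"

primrec step :: "'a leaf \<Rightarrow> int" where
  "step Opening = 1"
| "step (Closing x) = -1"

text \<open>Height of the path, started at height \<open>i\<close>, just before its step number \<open>j\<close>.\<close>

definition height_before :: "nat \<Rightarrow> 'a plane_tree \<Rightarrow> nat \<Rightarrow> int" where
  "height_before i t j = int i + (\<Sum>k<j. step (walk t ! k))"

definition balanced :: "nat \<Rightarrow> 'a plane_tree \<Rightarrow> bool" where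
  "balanced i t \<longleftrightarrow>
     (\<forall>j<length (walk t). is_closing (walk t ! j) \<longrightarrow> height_before i t j \<ge> 1)"

definition enriched :: "nat \<Rightarrow> nat \<Rightarrow> int plane_tree \<Rightarrow> bool" where
  "enriched m i t \<longleftrightarrow>
     m_bipartite m t \<and> balanced i t \<and>
     (\<forall>j<length (walk t). \<forall>x. walk t ! j = Closing x \<longrightarrow> x \<in> {0..height_before i t j - 1})"

text \<open>A root node has exactly one node-child, so it suffices that its last child is a node.\<close>

definition T_family :: "nat \<Rightarrow> nat \<Rightarrow> int plane_tree set" where
  "T_family m i = {t. enriched m i t \<and> (\<exists>c ts. t = Node c ts \<and> ts \<noteq> [] \<and> is_node (last ts))}"


section \<open>Series\<close>

definition rq_system :: "nat \<Rightarrow> (int \<Rightarrow> int fps) \<Rightarrow> (int \<Rightarrow> int fps) \<Rightarrow> bool" where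
  "rq_system m r q \<longleftrightarrow>
     (\<forall>j\<le>0. q j = 0) \<and>
     (\<forall>i\<ge>1. r i = of_int i + (\<Sum>a=0..m-2. q (i - int a))) \<and>
     (\<forall>i\<ge>1. q i = fps_X * (\<Prod>a=0..m-2. r (i + int a)))"

text \<open>Finiteness is required because the cardinality of an infinite set is \<open>0\<close>.\<close>

definition has_counting_series :: "'a set \<Rightarrow> ('a \<Rightarrow> nat) \<Rightarrow> int fps \<Rightarrow> bool" where
  "has_counting_series F wt f \<longleftrightarrow>
     (\<forall>n. finite {x\<in>F. wt x = n} \<and> fps_nth f n = int (card {x\<in>F. wt x = n}))"

text \<open>The system has a solution, and it is unique on the indices \<open>i \<ge> 1\<close>.\<close>

definition agree :: "nat \<Rightarrow> int fps \<Rightarrow> int fps \<Rightarrow> bool" where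
  "agree n f g \<longleftrightarrow> (\<forall>k<n. fps_nth f k = fps_nth g k)"

definition rq_step :: "nat \<Rightarrow> (int \<Rightarrow> int fps) \<Rightarrow> int \<Rightarrow> int fps" where
  "rq_step m q i =
     (if i \<le> 0 then 0
      else fps_X * (\<Prod>a=0..m-2. of_int (i + int a) + (\<Sum>b=0..m-2. q (i + int a - int b))))"

lemma agree_refl: "agree n f f"
  and agree_sym: "agree n f g \<Longrightarrow> agree n g f"
  and agree_trans: "agree n f g \<Longrightarrow> agree n g h \<Longrightarrow> agree n f h"
  and agree_mono: "agree n f g \<Longrightarrow> k \<le> n \<Longrightarrow> agree k f g"
  by (auto simp: agree_def)

lemma agree_eqI: "(\<And>n. agree n f g) \<Longrightarrow> f = g"
  by (auto simp: agree_def fps_eq_iff)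

lemma agree_mult: "agree n f g \<Longrightarrow> agree n f' g' \<Longrightarrow> agree n (f * f') (g * g')"
  by (auto simp: agree_def fps_mult_nth intro!: sum.cong)

lemma agree_prod: "finite A \<Longrightarrow> (\<And>a. a \<in> A \<Longrightarrow> agree n (f a) (g a)) \<Longrightarrow> agree n (prod f A) (prod g A)"
  by (induction A rule: finite_induct) (auto intro: agree_mult agree_refl)

lemma agree_X: "agree n f g \<Longrightarrow> agree (Suc n) (fps_X * f) (fps_X * g)"
  by (auto simp: agree_def)

lemma agree_rq_step:
  assumes "\<And>i. agree n (q i) (q' i)"
  shows "agree (Suc n) (rq_step m q i) (rq_step m q' i)"
proof -
  have "agree n (of_int (i + int a) + (\<Sum>b=0..m-2. q (i + int a - int b)))
                (of_int (i + int a) + (\<Sum>b=0..m-2. q' (i + int a - int b)))" for a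
    using assms by (auto simp: agree_def fps_sum_nth intro!: sum.cong)
  then show ?thesis
    unfolding rq_step_def by (auto intro!: agree_X agree_prod agree_refl)
qed

lemma rq_system_iff:
  "rq_system m r q \<longleftrightarrow>
     q = rq_step m q \<and> (\<forall>i\<ge>1. r i = of_int i + (\<Sum>a=0..m-2. q (i - int a)))"
    (is "_ \<longleftrightarrow> _ \<and> ?r")
proof -
  have zero: "rq_step m q i = 0" if "i \<le> 0" for i
    using that by (simp add: rq_step_def)
  have pos: "rq_step m q i = fps_X * (\<Prod>a=0..m-2. r (i + int a))" if ?r "i \<ge> 1" for i
  proof -
    have "(\<Prod>a=0..m-2. of_int (i + int a) + (\<Sum>b=0..m-2. q (i + int a - int b)))
          = (\<Prod>a=0..m-2. r (i + int a))"
      using that by (intro prod.cong) auto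
    then show ?thesis using that(2) by (simp add: rq_step_def)
  qed
  show ?thesis
  proof
    assume sys: "rq_system m r q"
    then have r: ?r unfolding rq_system_def by blast
    have "q i = rq_step m q i" for i
    proof (cases "i \<le> 0")
      case True
      then have "q i = 0" using sys unfolding rq_system_def by blast
      then show ?thesis using zero[OF True] by (simp only:)
    next
      case False
      then have i: "i \<ge> 1" by simp
      then have "q i = fps_X * (\<Prod>a=0..m-2. r (i + int a))"
        using sys unfolding rq_system_def by blast
      then show ?thesis unfolding pos[OF r i] .
    qed
    then show "q = rq_step m q \<and> ?r" using r by blast
  next
    assume *: "q = rq_step m q \<and> ?r"
    then have r: ?r by blast
    have q: "q i = rq_step m q i" for i
      using * by (blast intro: fun_cong)
    show "rq_system m r q"
      unfolding rq_system_def
    proof (intro conjI allI impI)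
      show "q j = 0" if "j \<le> 0" for j
        using q[of j] zero[OF that] by (rule trans)
      show "q j = fps_X * (\<Prod>a=0..m-2. r (j + int a))" if "j \<ge> 1" for j
        using q[of j] pos[OF r that] by (rule trans)
      show "r j = of_int j + (\<Sum>a=0..m-2. q (j - int a))" if "j \<ge> 1" for j
        using r that by blast
    qed
  qed
qed

lemma rq_system_exists: "\<exists>r q. rq_system m r q"
proof -
  define A where "A k = (rq_step m ^^ k) (\<lambda>_. 0)" for k
  have A_Suc: "A (Suc k) = rq_step m (A k)" for k
    by (simp add: A_def)
  have step: "agree k (A k i) (A (Suc k) i)" for k i
  proof (induction k arbitrary: i)
    case 0
    then show ?case by (simp add: agree_def)
  next
    case (Suc k)
    then show ?case
      unfolding A_Suc[of "Suc k"] A_Suc[of k]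
      by (intro agree_rq_step) (simp add: A_Suc)
  qed
  have A: "agree k (A k i) (A l i)" if "k \<le> l" for k l i
    using that
  proof (induction l rule: dec_induct)
    case base
    then show ?case by (rule agree_refl)
  next
    case (step n)
    then show ?case
      using agree_mono[OF \<open>\<And>k i. agree k (A k i) (A (Suc k) i)\<close>] agree_trans by blast
  qed
  define q where "q i = Abs_fps (\<lambda>n. fps_nth (A (Suc n) i) n)" for i
  have q: "agree k (q i) (A k i)" for k i
    unfolding agree_def
  proof (intro allI impI)
    fix n assume "n < k"
    then have "agree (Suc n) (A (Suc n) i) (A k i)" by (intro A) simp
    then show "fps_nth (q i) n = fps_nth (A k i) n" by (simp add: agree_def q_def)
  qed
  have "q i = rq_step m q i" for i
  proof (rule agree_eqI)
    fix n
    have "agree (Suc n) (rq_step m q i) (A (Suc n) i)"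
      unfolding A_Suc by (intro agree_rq_step q)
    then have "agree (Suc n) (q i) (rq_step m q i)"
      using q agree_sym agree_trans by blast
    then show "agree n (q i) (rq_step m q i)"
      by (rule agree_mono) simp
  qed
  then have "q = rq_step m q" ..
  then have "rq_system m (\<lambda>i. of_int i + (\<Sum>a=0..m-2. q (i - int a))) q"
    unfolding rq_system_iff by blast
  then show ?thesis by blast
qed

lemma rq_system_unique:
  assumes "rq_system m r q" "rq_system m r' q'" "i \<ge> 1"
  shows "r i = r' i" "q i = q' i"
proof -
  have q: "q = rq_step m q" and q': "q' = rq_step m q'"
    using assms unfolding rq_system_iff by blast+
  have "agree n (q j) (q' j)" for n j
  proof (induction n arbitrary: j)
    case 0
    then show ?case by (simp add: agree_def)
  next
    case (Suc n)
    then show ?case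
      using agree_rq_step[of n q q' m j] unfolding q[symmetric] q'[symmetric] by blast
  qed
  then have "q j = q' j" for j
    by (intro agree_eqI) auto
  then show "q i = q' i" .
  have "r i = of_int i + (\<Sum>a=0..m-2. q (i - int a))"
    "r' i = of_int i + (\<Sum>a=0..m-2. q' (i - int a))"
    using assms unfolding rq_system_def by blast+
  then show "r i = r' i"
    using \<open>\<And>j. q j = q' j\<close> by (simp only:)
qed

end

theory Submission
  imports Defs "HOL-Combinatorics.Cycles"
begin

text \<open>
  Both families are counted by the same sum over unlabelled trees.  For a fixed tree the labels of
  the closing leaves are counted by the product of the heights, and the decomposition of a tree at
  its black nodes gives the recursion for \<open>q\<close>.

  On the side of maps, cutting the edges outside a spanning tree turns a map into an unlabelled tree
  with a matching of closing leaves to opening leaves.  An admissible map has exactly one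
  spanning tree that avoids the marked edges, has degree 2 at every white vertex other than the root
  (degree 1 at the root), and meets every unmarked cut edge first from its white end when one walks
  around the tree.  Such a tree exists because the one whose walk is lexicographically
  largest, where cutting is preferred at white vertices and crossing at black ones, cannot be
  improved by an exchange at a white vertex.  For uniqueness, compare two such trees at the first dart
  where their walks differ: if one of them crosses there from a white vertex into a
  subtree, this subtree has one more black than white vertex, so in the other tree some black vertex
  of it has its parent outside, by an edge that the first tree must have cut earlier on.

  Thus a map is an unlabelled tree with a matching and multiplicities, where exactly the
  cut edges whose closing leaf precedes the opening leaf are forced to be marked.  With the
  multiplicity of an unmarked edge set to \<open>0\<close>, the number of these data is again the product of the
  heights.
\<close>

section \<open>Matchings of a word\<close>

text \<open>No explicit map between the families is constructed. For each number of black nodes both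
  fibres are finite and of equal size, and a bijection is chosen fibre by fibre; so labels on one
  side and matchings with multiplicities on the other only have to agree in number, one tree shape
  at a time.

  The degree conditions on the spanning tree come from the 1-orientation. Root-accessibility forces
  the only outgoing edge of a black vertex to be unmarked and hence to be its parent edge. A white
  vertex has one ingoing edge, which comes from a black child, and, unless it is the root, one
  parent edge. Conversely the orientation is recovered from the tree, so orientations disappear
  after the translation.

  The bound "less than \<open>i\<close>" meets the starting height \<open>i\<close> as follows: the
  implicit root leaf is an opening letter, a word that includes it starts at height
  \<open>i - 1\<close>, and \<open>i - 1\<close> is also the largest allowed total multiplicity.

  Maps are classes up to relabelling. One dart tree is therefore fixed for each shape, and
  uniqueness of the spanning tree ensures that an isomorphism respects trees and matchings.\<close>

definition matchings :: "'b set \<Rightarrow> 'a set \<Rightarrow> ('b \<times> 'a) set \<Rightarrow> nat \<Rightarrow> (('b \<Rightarrow> 'a) \<times> ('b \<Rightarrow> nat)) set"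
  where "matchings B A F x =
    {(p, u). p \<in> extensional B \<and> bij_betw p B A \<and> u \<in> extensional B \<and> sum u B \<le> x \<and>
             (\<forall>c\<in>B. u c = 0 \<longrightarrow> (c, p c) \<in> F)}"

lemma matchings_cong:
  assumes "\<And>c a. c \<in> B \<Longrightarrow> a \<in> A \<Longrightarrow> (c, a) \<in> F \<longleftrightarrow> (c, a) \<in> G"
  shows "matchings B A F x = matchings B A G x"
  using assms unfolding matchings_def by (auto simp: bij_betw_apply)

lemma finite_matchings:
  assumes "finite A" "finite B"
  shows "finite (matchings B A F x)"
proof (rule finite_subset)
  show "matchings B A F x \<subseteq> (B \<rightarrow>\<^sub>E A) \<times> (B \<rightarrow>\<^sub>E {..x})"
  proof (clarsimp simp: matchings_def, intro conjI)
    fix p :: "'b \<Rightarrow> 'a" and u :: "'b \<Rightarrow> nat"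
    assume p: "p \<in> extensional B" "bij_betw p B A" and u: "u \<in> extensional B" "sum u B \<le> x"
    show "p \<in> B \<rightarrow>\<^sub>E A" using p by (auto simp: PiE_iff bij_betw_apply)
    have "u c \<le> x" if "c \<in> B" for c
      using member_le_sum[of c B u] that u assms by simp
    then show "u \<in> B \<rightarrow>\<^sub>E {..x}" using u by (auto simp: PiE_iff)
  qed
  show "finite ((B \<rightarrow>\<^sub>E A) \<times> (B \<rightarrow>\<^sub>E {..x}))"
    using assms by (intro finite_cartesian_product finite_PiE) auto
qed

text \<open>Enlarging \<open>F\<close> by one pair only adds the matchings that use this pair with
  multiplicity 0. Deleting the pair from them is a bijection onto the matchings of the smaller sets,
  undone by setting \<open>p c = a\<close> and \<open>u c = 0\<close>.\<close>

lemma card_matchings_swap: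
  assumes fin: "finite A" "finite B" and c: "c \<in> B" and a: "a \<in> A" and F: "(c, a) \<notin> F"
  shows "card (matchings B A (insert (c, a) F) x) =
         card (matchings B A F x) + card (matchings (B - {c}) (A - {a}) F x)"
proof -
  let ?N = "{(p, u) \<in> matchings B A (insert (c, a) F) x. p c = a \<and> u c = 0}"
  have split: "matchings B A (insert (c, a) F) x = matchings B A F x \<union> ?N"
    using c by (auto simp: matchings_def)
  have disj: "matchings B A F x \<inter> ?N = {}"
    using c F by (auto simp: matchings_def)
  let ?f = "\<lambda>(p, u). (restrict p (B - {c}), restrict u (B - {c}))"
  let ?g = "\<lambda>(p, u). (p(c := a), u(c := 0))"
  have "bij_betw ?f ?N (matchings (B - {c}) (A - {a}) F x)"
  proof (rule bij_betw_byWitness[where f' = ?g])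
    show "\<forall>z\<in>?N. ?g (?f z) = z"
      using c by (auto simp: matchings_def fun_eq_iff extensional_def)
    show "\<forall>z\<in>matchings (B - {c}) (A - {a}) F x. ?f (?g z) = z"
      by (auto simp: matchings_def fun_eq_iff extensional_def)
    show "?f ` ?N \<subseteq> matchings (B - {c}) (A - {a}) F x"
    proof clarify
      fix p u assume pu: "(p, u) \<in> matchings B A (insert (c, p c) F) x" "u c = 0" "a = p c"
      have bij: "bij_betw p B A" using pu by (simp add: matchings_def)
      have "bij_betw p (B - {c}) (A - {p c})"
        using bij_betw_DiffI[OF bij, of "{c}" "{p c}"] c a pu by (simp add: bij_betw_def)
      then have "bij_betw (restrict p (B - {c})) (B - {c}) (A - {p c})"
        by (subst bij_betw_cong[of _ _ p]) auto
      moreover have "p d \<noteq> p c" if "d \<in> B" "d \<noteq> c" for d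
        using bij that c by (auto simp: bij_betw_def inj_on_def)
      moreover have "sum u (B - {c}) \<le> sum u B"
        using fin by (intro sum_mono2) auto
      ultimately show "(restrict p (B - {c}), restrict u (B - {c})) \<in> matchings (B - {c}) (A - {p c}) F x"
        using pu(1) by (auto simp: matchings_def)
    qed
    show "?g ` matchings (B - {c}) (A - {a}) F x \<subseteq> ?N"
    proof clarify
      fix p u assume pu: "(p, u) \<in> matchings (B - {c}) (A - {a}) F x"
      then have "bij_betw p (B - {c}) (A - {a})" by (simp add: matchings_def)
      then have "bij_betw (p(c := a)) (B - {c}) (A - {a})"
        by (subst bij_betw_cong[of _ _ p]) auto
      then have "bij_betw (p(c := a)) (insert c (B - {c})) (insert a (A - {a}))"
        using notIn_Un_bij_betw[of c "B - {c}" "p(c := a)" "A - {a}"] by simp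
      then have "bij_betw (p(c := a)) B A"
        using c a by (simp add: insert_absorb)
      moreover have "sum (u(c := 0)) B = sum u (B - {c})"
        using fin c by (subst sum.remove[of _ c]) (auto intro: sum.cong)
      ultimately show "(p(c := a), u(c := 0)) \<in> matchings B A (insert (c, a) F) x \<and>
          (p(c := a)) c = a \<and> (u(c := 0)) c = 0"
        using pu c by (auto simp: matchings_def extensional_def)
    qed
  qed
  then have "card ?N = card (matchings (B - {c}) (A - {a}) F x)"
    by (rule bij_betw_same_card)
  moreover have "finite ?N"
    using finite_matchings[OF fin, of "insert (c, a) F" x] by (rule rev_finite_subset) auto
  ultimately show ?thesis
    using card_Un_disjoint[OF finite_matchings[OF fin] _ disj] split by metis
qed

text \<open>Since \<open>c\<close> occurs in no pair of \<open>F\<close>, its multiplicity is at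
  least 1 and can be lowered by 1. The new value may be 0 whatever the partner of \<open>c\<close>
  is, which is why the pairs \<open>{c} \<times> A\<close> appear.\<close>

lemma card_matchings_rotate:
  assumes fin: "finite B" and c: "c \<in> B" and F: "\<And>a. (c, a) \<notin> F"
  shows "card (matchings B A F (Suc x)) = card (matchings B A (F \<union> {c} \<times> A) x)"
proof -
  let ?f = "\<lambda>(p, u :: _ \<Rightarrow> nat). (p, u(c := u c - 1))"
  let ?g = "\<lambda>(p, u :: _ \<Rightarrow> nat). (p, u(c := Suc (u c)))"
  have s: "sum (u(c := k)) B = k + sum u (B - {c})" for u :: "'a \<Rightarrow> nat" and k
    using fin c by (subst sum.remove[of _ c]) (auto intro: sum.cong)
  have s': "sum u B = u c + sum u (B - {c})" for u :: "'a \<Rightarrow> nat"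
    using fin c by (rule sum.remove)
  have pos: "u c > 0" if "(p, u) \<in> matchings B A F (Suc x)" for p u
    using that c F by (auto simp: matchings_def)
  have "bij_betw ?f (matchings B A F (Suc x)) (matchings B A (F \<union> {c} \<times> A) x)"
  proof (rule bij_betw_byWitness[where f' = ?g])
    show "\<forall>z\<in>matchings B A F (Suc x). ?g (?f z) = z"
      using pos by (auto simp: fun_eq_iff)
    show "\<forall>z\<in>matchings B A (F \<union> {c} \<times> A) x. ?f (?g z) = z" by auto
    show "?f ` matchings B A F (Suc x) \<subseteq> matchings B A (F \<union> {c} \<times> A) x"
    proof clarify
      fix p u assume pu: "(p, u) \<in> matchings B A F (Suc x)"
      then have "sum (u(c := u c - 1)) B \<le> x"
        using pos[OF pu] unfolding s by (auto simp: matchings_def s'[of u])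
      then show "(p, u(c := u c - 1)) \<in> matchings B A (F \<union> {c} \<times> A) x"
        using pu c by (auto simp: matchings_def extensional_def bij_betw_apply)
    qed
    show "?g ` matchings B A (F \<union> {c} \<times> A) x \<subseteq> matchings B A F (Suc x)"
    proof clarify
      fix p u assume pu: "(p, u) \<in> matchings B A (F \<union> {c} \<times> A) x"
      then have "sum (u(c := Suc (u c))) B \<le> Suc x"
        unfolding s by (simp add: matchings_def s'[of u])
      then show "(p, u(c := Suc (u c))) \<in> matchings B A F (Suc x)"
        using pu c by (auto simp: matchings_def extensional_def)
    qed
  qed
  then show ?thesis by (rule bij_betw_same_card)
qed

section \<open>Words of opening and closing letters and the product of heights\<close>

definition openings :: "(bool \<times> 'd) list \<Rightarrow> 'd set" where
  "openings w = {d. (True, d) \<in> set w}"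

definition closings :: "(bool \<times> 'd) list \<Rightarrow> 'd set" where
  "closings w = {d. (False, d) \<in> set w}"

text \<open>The pairs are written with the closing letter first, as in \<open>matchings\<close>,
  although the opening letter stands further left in the word.\<close>

fun forward :: "(bool \<times> 'd) list \<Rightarrow> ('d \<times> 'd) set" where
  "forward [] = {}"
| "forward ((b, d) # w) = (if b then closings w \<times> {d} else {}) \<union> forward w"

fun inversions :: "(bool \<times> 'd) list \<Rightarrow> nat" where
  "inversions [] = 0"
| "inversions ((b, d) # w) = (if b then length (filter (\<lambda>z. \<not> fst z) w) else 0) + inversions w"

text \<open>Starting from \<open>h \<ge> 0\<close>, a path becomes negative only through a down-step
  from height 0, so the product vanishes exactly for unbalanced words.\<close>

fun height_prod :: "int \<Rightarrow> bool list \<Rightarrow> int" where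
  "height_prod h [] = 1"
| "height_prod h (b # w) = (if b then height_prod (h + 1) w else h * height_prod (h - 1) w)"

definition net :: "bool list \<Rightarrow> int" where
  "net w = (\<Sum>b\<leftarrow>w. if b then 1 else -1)"

lemma net_simps [simp]: "net [] = 0" "net (b # w) = (if b then 1 else -1) + net w"
  "net (v @ w) = net v + net w"
  by (simp_all add: net_def)

lemma height_prod_append:
  "height_prod h (v @ w) = height_prod h v * height_prod (h + net v) w"
  by (induction h v rule: height_prod.induct) (auto simp: algebra_simps)

lemma openings_simps [simp]: "openings [] = {}"
  "openings ((b, d) # w) = (if b then insert d (openings w) else openings w)"
  "openings (v @ w) = openings v \<union> openings w"
  by (auto simp: openings_def)

lemma closings_simps [simp]: "closings [] = {}"
  "closings ((b, d) # w) = (if b then closings w else insert d (closings w))"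
  "closings (v @ w) = closings v \<union> closings w"
  by (auto simp: closings_def)

lemma finite_openings [simp]: "finite (openings w)"
  by (rule finite_subset[of _ "snd ` set w"]) (force simp: openings_def)+

lemma finite_closings [simp]: "finite (closings w)"
  by (rule finite_subset[of _ "snd ` set w"]) (force simp: closings_def)+

lemma openings_sub: "d \<in> openings w \<Longrightarrow> d \<in> snd ` set w"
  by (force simp: openings_def)

lemma closings_sub: "d \<in> closings w \<Longrightarrow> d \<in> snd ` set w"
  by (force simp: closings_def)

lemma forward_append: "forward (v @ w) = forward v \<union> forward w \<union> closings w \<times> openings v"
  by (induction v rule: forward.induct) auto

lemma forward_sub: "forward w \<subseteq> closings w \<times> openings w"
  by (induction w rule: forward.induct) auto

lemma inversions_swap:
  "inversions (v @ (True, a) # (False, c) # w) = Suc (inversions (v @ (False, c) # (True, a) # w))"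
  by (induction v rule: inversions.induct) auto

text \<open>The letters stand for the darts of the cut edges: closing letters for the black ends,
  opening letters for the white ends. Multiplicity 0 encodes an unmarked edge, which is allowed only
  if the opening letter comes first.\<close>

definition word_matchings :: "(bool \<times> 'd) list \<Rightarrow> nat \<Rightarrow> (('d \<Rightarrow> 'd) \<times> ('d \<Rightarrow> nat)) set" where
  "word_matchings w x = matchings (closings w) (openings w) (forward w) x"

text \<open>
  Both sides satisfy the same two recursions.  Exchanging an adjacent pair \<open>OC\<close> for \<open>CO\<close> loses the
  matchings in which this pair is matched with multiplicity \<open>0\<close>; moving an initial closing
  letter to the end of the word amounts to lowering its multiplicity, and the bound, by \<open>1\<close>.
\<close>

theorem card_word_matchings:
  fixes w :: "(bool \<times> 'd) list"
  assumes "distinct (map snd w)" "net (map fst w) = 0"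
  shows "int (card (word_matchings w x)) = height_prod (int x) (map fst w)"
  using assms
\<comment> \<open>Deleting a pair shortens the word, and exchanging \<open>OC\<close> for
  \<open>CO\<close> lowers the inversions alone. Moving a closing letter to the end may create
  inversions but lowers the bound, so \<open>x\<close> has to come before
  \<open>inversions w\<close>.\<close>
proof (induction "(length w, x, inversions w)" arbitrary: w x
    rule: wf_induct_rule[OF wf_lex_prod[OF wf_less_than wf_lex_prod[OF wf_less_than wf_less_than]]])
  case 1
  note dist = 1(2) and net = 1(3)
  have IH: "int (card (word_matchings v y)) = height_prod (int y) (map fst v)"
    if "length v < length w \<or> length v = length w \<and> (y < x \<or> y = x \<and> inversions v < inversions w)"
      "distinct (map snd v)" "net (map fst v) = 0" for v :: "(bool \<times> 'd) list" and y
    by (rule 1(1)) (use that in auto)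
  show ?case
  proof (cases w)
    case Nil
    then have "word_matchings w x = {(\<lambda>_. undefined, \<lambda>_. undefined)}"
      by (auto simp: word_matchings_def matchings_def bij_betw_def)
    then show ?thesis using Nil by simp
  next
    case (Cons z v)
    obtain b c where z: "z = (b, c)" by (cases z)
    show ?thesis
    proof (cases b)
      case False
      then have w: "w = (False, c) # v" using Cons z by simp
      have c: "c \<notin> snd ` set v" using dist w by simp
      have F: "(c, a) \<notin> forward w" for a
        using forward_sub[of v] closings_sub[of c v] c by (auto simp: w)
      show ?thesis
      proof (cases x)
        case 0
        \<comment> \<open>No opening letter precedes the initial closing letter, so its multiplicity
          would have to be positive. On the other side its factor is the height 0.\<close>
        have "word_matchings w 0 = {}"
          using F by (auto simp: word_matchings_def matchings_def w)
        then show ?thesis by (simp add: 0 w)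
      next
        case (Suc y)
        let ?w = "v @ [(False, c)]"
        have "card (word_matchings w x) = card (matchings (closings w) (openings w) (forward w \<union> {c} \<times> openings w) y)"
          unfolding word_matchings_def Suc by (intro card_matchings_rotate F) (auto simp: w)
        also have "\<dots> = card (word_matchings ?w y)"
          unfolding word_matchings_def by (simp add: w forward_append Un_commute)
        also have "int \<dots> = height_prod (int y) (map fst ?w)"
          by (rule IH) (use dist net in \<open>auto simp: w Suc\<close>)
        \<comment> \<open>The word has net 0, hence \<open>net v = 1\<close>, and the letter moved
          to the end starts its step at height \<open>y + 1 = x\<close>, just as it did at the
          front.\<close>
        also have "\<dots> = height_prod (int x) (map fst w)"
          using net by (simp add: w Suc height_prod_append)
        finally show ?thesis .
      qed
    next
      case True
      have "\<exists>p\<in>set w. \<not> fst p"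
      proof (rule ccontr)
        assume "\<not> (\<exists>p\<in>set w. \<not> fst p)"
        then have "net (map fst w) = int (length w)"
          by (induction w) auto
        then show False using net Cons by simp
      qed
      then obtain us p vs where us: "w = us @ p # vs" "\<not> fst p" "\<forall>y\<in>set us. fst y"
        using split_list_first_prop[of w "\<lambda>p. \<not> fst p"] by auto
      have "us \<noteq> []" using us Cons z True by (cases us) auto
      then obtain ts q where "us = ts @ [q]" by (cases us rule: rev_cases) auto
      then obtain a d where w: "w = ts @ (True, a) # (False, d) # vs"
        using us by (cases p; cases q) auto
      let ?v = "ts @ (False, d) # (True, a) # vs"
      let ?u = "ts @ vs"
      have nd: "a \<notin> snd ` set ?u" "d \<notin> snd ` set ?u" "a \<noteq> d"
        using dist by (auto simp: w)
      have ca: "(d, a) \<notin> forward ?v"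
        using nd by (auto simp: forward_append dest!: subsetD[OF forward_sub] openings_sub closings_sub)
      have "card (word_matchings w x) = card (word_matchings ?v x) +
          card (matchings (closings ?v - {d}) (openings ?v - {a}) (forward ?v) x)"
      proof -
        have "forward w = insert (d, a) (forward ?v)" "closings w = closings ?v" "openings w = openings ?v"
          by (auto simp: w forward_append)
        then show ?thesis
          unfolding word_matchings_def by (simp only:) (rule card_matchings_swap, use ca in auto)
      qed
      also have "matchings (closings ?v - {d}) (openings ?v - {a}) (forward ?v) x = word_matchings ?u x"
      proof -
        have "d \<notin> closings ?u" "a \<notin> openings ?u"
          using nd closings_sub openings_sub by metis+
        then have e: "closings ?v - {d} = closings ?u" "openings ?v - {a} = openings ?u" by auto
        show ?thesis unfolding word_matchings_def e
          by (rule matchings_cong) (use \<open>d \<notin> closings ?u\<close> \<open>a \<notin> openings ?u\<close> in \<open>auto simp: forward_append\<close>)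
      qed
      finally have card: "int (card (word_matchings w x)) =
          int (card (word_matchings ?v x)) + int (card (word_matchings ?u x))" by simp
      have "int (card (word_matchings ?v x)) = height_prod (int x) (map fst ?v)"
        by (rule IH) (use dist net inversions_swap[of ts a d vs] in \<open>auto simp: w\<close>)
      moreover have "int (card (word_matchings ?u x)) = height_prod (int x) (map fst ?u)"
        by (rule IH) (use dist net in \<open>auto simp: w\<close>)
      \<comment> \<open>From height \<open>h\<close> the factors \<open>OC\<close>,
        \<open>CO\<close> and the empty word contribute \<open>h + 1\<close>, \<open>h\<close> and
        1, and they end at the same height.\<close>
      ultimately show ?thesis
        unfolding card by (simp add: w height_prod_append algebra_simps)
    qed
  qed
qed

section \<open>Enriched trees\<close>

lemma has_counting_series_image:
  assumes "has_counting_series F wt f" "inj_on g F" "\<And>x. x \<in> F \<Longrightarrow> wt' (g x) = wt x"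
  shows "has_counting_series (g ` F) wt' f"
proof -
  have "{y \<in> g ` F. wt' y = n} = g ` {x \<in> F. wt x = n}" for n
    using assms(3) by auto
  moreover have "card (g ` {x \<in> F. wt x = n}) = card {x \<in> F. wt x = n}" for n
    by (intro card_image inj_on_subset[OF assms(2)]) auto
  ultimately show ?thesis
    using assms(1) by (simp add: has_counting_series_def)
qed

lemma has_counting_series_image_Suc:
  assumes "has_counting_series F wt f" "inj_on g F" "\<And>x. x \<in> F \<Longrightarrow> wt' (g x) = Suc (wt x)"
  shows "has_counting_series (g ` F) wt' (fps_X * f)"
proof -
  have none: "{y \<in> g ` F. wt' y = 0} = {}" using assms(3) by auto
  have "{y \<in> g ` F. wt' y = Suc n} = g ` {x \<in> F. wt x = n}" for n
    using assms(3) by auto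
  moreover have "card (g ` {x \<in> F. wt x = n}) = card {x \<in> F. wt x = n}" for n
    by (intro card_image inj_on_subset[OF assms(2)]) auto
  ultimately have "finite {y \<in> g ` F. wt' y = n} \<and>
      fps_nth (fps_X * f) n = int (card {y \<in> g ` F. wt' y = n})" for n
    using assms(1) by (cases n) (simp_all only: none has_counting_series_def, simp_all)
  then show ?thesis by (simp add: has_counting_series_def)
qed

lemma has_counting_series_empty: "has_counting_series {} wt 0"
  by (simp add: has_counting_series_def)

lemma has_counting_series_Un:
  assumes "has_counting_series F wt f" "has_counting_series G wt g" "F \<inter> G = {}"
  shows "has_counting_series (F \<union> G) wt (f + g)"
proof -
  have "{x \<in> F \<union> G. wt x = n} = {x \<in> F. wt x = n} \<union> {x \<in> G. wt x = n}" for n by auto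
  moreover have "{x \<in> F. wt x = n} \<inter> {x \<in> G. wt x = n} = {}" for n using assms(3) by auto
  ultimately show ?thesis
    using assms(1,2) by (simp add: has_counting_series_def card_Un_disjoint)
qed

lemma has_counting_series_UN:
  assumes "finite I" "\<And>k. k \<in> I \<Longrightarrow> has_counting_series (F k) wt (f k)"
    "\<And>k l. k \<in> I \<Longrightarrow> l \<in> I \<Longrightarrow> k \<noteq> l \<Longrightarrow> F k \<inter> F l = {}"
  shows "has_counting_series (\<Union>k\<in>I. F k) wt (\<Sum>k\<in>I. f k)"
  using assms
proof (induction I rule: finite_induct)
  case empty
  then show ?case by (simp add: has_counting_series_empty)
next
  case (insert k I)
  have "has_counting_series (F k \<union> (\<Union>k\<in>I. F k)) wt (f k + (\<Sum>k\<in>I. f k))"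
    by (intro has_counting_series_Un insert.IH insert.prems) (use insert in auto)
  then show ?case using insert by simp
qed

lemma has_counting_series_Times:
  assumes "has_counting_series F wt f" "has_counting_series G wt' g"
  shows "has_counting_series (F \<times> G) (\<lambda>(x, y). wt x + wt' y) (f * g)"
proof -
  have eq: "{z \<in> F \<times> G. (\<lambda>(x, y). wt x + wt' y) z = n} =
      (\<Union>k\<in>{0..n}. {x \<in> F. wt x = k} \<times> {y \<in> G. wt' y = n - k})" for n by auto
  have fin: "finite ({x \<in> F. wt x = k} \<times> {y \<in> G. wt' y = l})" for k l
    using assms by (simp add: has_counting_series_def)
  have "card {z \<in> F \<times> G. (\<lambda>(x, y). wt x + wt' y) z = n} =
      (\<Sum>k=0..n. card ({x \<in> F. wt x = k} \<times> {y \<in> G. wt' y = n - k}))" for n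
    unfolding eq by (rule card_UN_disjoint) (use fin in auto)
  moreover have "finite {z \<in> F \<times> G. (\<lambda>(x, y). wt x + wt' y) z = n}" for n
    unfolding eq using fin by blast
  ultimately show ?thesis
    using assms by (simp add: has_counting_series_def fps_mult_nth card_cartesian_product)
qed

lemma has_counting_series_lists:
  assumes "\<And>j. j < k \<Longrightarrow> has_counting_series (F j) wt (f j)"
  shows "has_counting_series {us. length us = k \<and> (\<forall>j<k. us ! j \<in> F j)} (\<lambda>us. sum_list (map wt us))
           (\<Prod>j<k. f j)"
  using assms
proof (induction k)
  case 0
  have "{us \<in> {us. length us = 0 \<and> (\<forall>j<0. us ! j \<in> F j)}. sum_list (map wt us) = n} =
      (if n = 0 then {[]} else {})" for n by auto
  then show ?case by (simp add: has_counting_series_def)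
next
  case (Suc k)
  let ?L = "\<lambda>k. {us. length us = k \<and> (\<forall>j<k. us ! j \<in> F j)}"
  have "?L (Suc k) = (\<lambda>(us, u). us @ [u]) ` (?L k \<times> F k)"
  proof (intro equalityI subsetI)
    fix us assume us: "us \<in> ?L (Suc k)"
    then obtain vs v where "us = vs @ [v]" by (cases us rule: rev_cases) auto
    then show "us \<in> (\<lambda>(us, u). us @ [u]) ` (?L k \<times> F k)"
      using us by (auto simp: nth_append less_Suc_eq intro!: image_eqI[of _ _ "(vs, v)"])
  qed (auto simp: nth_append less_Suc_eq)
  moreover have "inj_on (\<lambda>(us, u). us @ [u]) (?L k \<times> F k)" by (auto simp: inj_on_def)
  moreover have "has_counting_series (?L k \<times> F k) (\<lambda>(us, u). sum_list (map wt us) + wt u) ((\<Prod>j<k. f j) * f k)"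
    by (intro has_counting_series_Times Suc) simp_all
  ultimately show ?case
    by (auto intro!: has_counting_series_image)
qed

text \<open>Balance is built in: a label \<open>x\<close> with \<open>0 \<le> x\<close> and
  \<open>x < h\<close> exists only if \<open>h \<ge> 1\<close>.\<close>

fun labels_ok :: "int \<Rightarrow> int leaf list \<Rightarrow> bool" where
  "labels_ok h [] \<longleftrightarrow> True"
| "labels_ok h (Opening # ls) \<longleftrightarrow> labels_ok (h + 1) ls"
| "labels_ok h (Closing x # ls) \<longleftrightarrow> 0 \<le> x \<and> x < h \<and> labels_ok (h - 1) ls"

definition net_step :: "'a leaf list \<Rightarrow> int" where
  "net_step ls = (\<Sum>l\<leftarrow>ls. step l)"

lemma net_step_simps [simp]: "net_step [] = 0" "net_step (l # ls) = step l + net_step ls"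
  "net_step (ks @ ls) = net_step ks + net_step ls"
  by (simp_all add: net_step_def)

lemma labels_ok_append:
  "labels_ok h (ks @ ls) \<longleftrightarrow> labels_ok h ks \<and> labels_ok (h + net_step ks) ls"
  by (induction h ks rule: labels_ok.induct) (auto simp: algebra_simps)

lemma labels_ok_replicate: "labels_ok h (replicate k Opening)"
  by (induction k arbitrary: h) auto

text \<open>The down-step of the last closing leaf ends at a nonnegative height, and only up-steps
  follow it. This is what rules out trees read from too low a height.\<close>

lemma labels_ok_final_nonneg:
  "labels_ok h ls \<Longrightarrow> h \<ge> 0 \<or> (\<exists>x. Closing x \<in> set ls) \<Longrightarrow> h + net_step ls \<ge> 0"
proof (induction h ls rule: labels_ok.induct)
  case (2 h ls)
  then show ?case by (cases "h \<ge> 0") (auto simp: algebra_simps)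
qed (auto simp: algebra_simps)

lemma labels_ok_iff_nth:
  "labels_ok h ls \<longleftrightarrow>
     (\<forall>j<length ls. \<forall>x. ls ! j = Closing x \<longrightarrow> 0 \<le> x \<and> x < h + (\<Sum>k<j. step (ls ! k)))"
proof (induction h ls rule: labels_ok.induct)
  case (2 h ls)
  then show ?case by (simp add: All_less_Suc2 sum.lessThan_Suc_shift algebra_simps del: sum.lessThan_Suc)
next
  case (3 h x ls)
  then show ?case by (simp add: All_less_Suc2 sum.lessThan_Suc_shift algebra_simps del: sum.lessThan_Suc)
qed simp

lemma enriched_iff: "enriched m i t \<longleftrightarrow> m_bipartite m t \<and> labels_ok (int i) (walk t)"
  unfolding enriched_def labels_ok_iff_nth balanced_def height_before_def is_closing_def
  by (auto, metis leaf.exhaust order.strict_trans1 linorder_not_le zero_le_one int_one_le_iff_zero_less order.trans)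

text \<open>The colour argument is that of the parent. A whole tree is read with parent colour
  \<open>Black\<close>, as if its white root node hung below a black one. In contrast to the
  condition on all nodes in \<open>m_bipartite\<close>, this form supports structural
  recursion.\<close>

fun well_formed :: "nat \<Rightarrow> color \<Rightarrow> 'a plane_tree \<Rightarrow> bool" where
  "well_formed m c (Leaf Opening) \<longleftrightarrow> c = White"
| "well_formed m c (Leaf (Closing x)) \<longleftrightarrow> c = Black"
| "well_formed m c (Node c' ts) \<longleftrightarrow> c' \<noteq> c \<and> Suc (length ts) = m \<and>
     (c' = White \<longrightarrow> length (filter is_node ts) = 1) \<and> (\<forall>t\<in>set ts. well_formed m c' t)"

text \<open>A closing leaf has net -1. A black node has \<open>m - 1\<close> subtrees of net -1
  each, which gives \<open>1 - m\<close>; a white node adds to this the \<open>m - 2\<close> opening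
  leaves and arrives at -1 again.\<close>

lemma net_step_well_formed:
  assumes "well_formed m c t" "is_node t \<or> c = Black" "m \<ge> 2"
  shows "net_step (walk t) = (if c = Black then -1 else 1 - int m)"
  using assms
proof (induction m c t rule: well_formed.induct)
  case (3 m c c' ts)
  have wf: "\<forall>t\<in>set ts. well_formed m c' t" and len: "Suc (length ts) = m" and c: "c' \<noteq> c"
    using 3 by auto
  have cat: "net_step (concat xss) = (\<Sum>xs\<leftarrow>xss. net_step xs)" for xss :: "'a leaf list list"
    by (induction xss) auto
  have cat': "net_step (walk (Node c' ts)) = (\<Sum>t\<leftarrow>ts. net_step (walk t))"
    by (simp add: cat o_def)
  show ?case
  proof (cases c')
    case Black
    then have "(\<Sum>t\<leftarrow>ts. net_step (walk t)) = (\<Sum>t\<leftarrow>ts. -1)"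
      using 3 by (intro arg_cong[of _ _ sum_list] map_cong) auto
    then show ?thesis using Black c len unfolding cat' by (cases c) (auto simp: sum_list_triv)
  next
    case White
    have "(\<Sum>t\<leftarrow>ts. net_step (walk t)) = (\<Sum>t\<leftarrow>ts. if is_node t then 1 - int m else 1)"
    proof (intro arg_cong[of _ _ sum_list] map_cong refl)
      fix t assume t: "t \<in> set ts"
      show "net_step (walk t) = (if is_node t then 1 - int m else 1)"
      proof (cases "is_node t")
        case True
        then show ?thesis using 3 t White by auto
      next
        case False
        then have "t = Leaf Opening"
          using wf[rule_format, OF t] White by (cases t) (auto simp: is_node_def elim: leaf.exhaust, metis leaf.exhaust well_formed.simps(2) color.distinct(1))
        then show ?thesis using False by simp
      qed
    qed
    also have "\<dots> = int (length ts) - int m * int (length (filter is_node ts))"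
      by (induction ts) (auto simp: algebra_simps)
    also have "\<dots> = -1" using 3 White len by auto
    finally show ?thesis unfolding cat' using White c by (cases c) auto
  qed
qed (auto simp: is_node_def)

text \<open>Below a black parent this family gives the series \<open>r\<close> (a closing leaf or a
  white node), below a white parent the series \<open>q\<close> up to a shift of the height (a black
  node). The opening leaf is excluded below a white parent because \<open>white_node\<close>
  accounts for it.\<close>

definition labelled_trees :: "nat \<Rightarrow> color \<Rightarrow> int \<Rightarrow> int plane_tree set" where
  "labelled_trees m c h = {t. well_formed m c t \<and> labels_ok h (walk t) \<and> (c = White \<longrightarrow> is_node t)}"

lemma blossoming_iff: "blossoming t \<longleftrightarrow> net_step (walk t) = -1"
proof -
  have "net_step ls = int (length (filter (\<lambda>l. \<not> is_closing l) ls)) - int (length (filter is_closing ls))"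
    for ls :: "'a leaf list"
  proof (induction ls)
    case (Cons l ls)
    then show ?case by (cases l) (auto simp: is_closing_def)
  qed simp
  then show ?thesis unfolding blossoming_def by auto
qed

definition local_cond :: "nat \<Rightarrow> color \<Rightarrow> 'a plane_tree list \<Rightarrow> bool" where
  "local_cond m c ts \<longleftrightarrow>
         Suc (length ts) = m \<and>
         (\<forall>us. Node c us \<notin> set ts) \<and>
         (Leaf Opening \<in> set ts \<longrightarrow> c = White) \<and>
         (\<forall>x. Leaf (Closing x) \<in> set ts \<longrightarrow> c = Black) \<and>
         (c = White \<longrightarrow>
            length (filter is_black_node ts) = 1 \<and>
            (\<forall>u\<in>set ts. is_black_node u \<or> u = Leaf Opening))"

definition top_cond :: "color \<Rightarrow> 'a plane_tree \<Rightarrow> bool" where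
  "top_cond c t \<longleftrightarrow> (case t of Leaf Opening \<Rightarrow> c = White | Leaf (Closing x) \<Rightarrow> c = Black | Node c' us \<Rightarrow> c' \<noteq> c)"

lemma local_cond_iff:
  "local_cond m c ts \<longleftrightarrow> Suc (length ts) = m \<and> (\<forall>t\<in>set ts. top_cond c t) \<and>
     (c = White \<longrightarrow> length (filter is_node ts) = 1)"
proof (cases c)
  case Black
  then show ?thesis unfolding local_cond_def top_cond_def
    by (auto split: plane_tree.splits leaf.splits)
next
  case White
  have top: "top_cond White t \<longleftrightarrow> is_black_node t \<or> t = Leaf Opening"
    "is_black_node t \<Longrightarrow> is_node t" "top_cond White t \<Longrightarrow> is_node t \<Longrightarrow> is_black_node t" for t :: "'a plane_tree"
  proof -
    show "top_cond White t \<longleftrightarrow> is_black_node t \<or> t = Leaf Opening"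
    proof (cases t)
      case (Leaf l)
      then show ?thesis by (cases l) (auto simp: top_cond_def is_black_node_def)
    next
      case (Node c us)
      then show ?thesis by (cases c) (auto simp: top_cond_def is_black_node_def)
    qed
    then show "is_black_node t \<Longrightarrow> is_node t" "top_cond White t \<Longrightarrow> is_node t \<Longrightarrow> is_black_node t"
      by (auto simp: is_black_node_def is_node_def)
  qed
  have "(\<forall>us. Node White us \<notin> set ts) \<and> (\<forall>x. Leaf (Closing x) \<notin> set ts)"
    if "\<forall>t\<in>set ts. top_cond White t"
    using that by (auto simp: top_cond_def)
  moreover have "filter is_black_node ts = filter is_node ts" if "\<forall>t\<in>set ts. top_cond White t"
    using that top by (intro filter_cong) auto
  moreover have "(\<forall>t\<in>set ts. is_black_node t \<or> t = Leaf Opening) \<longleftrightarrow> (\<forall>t\<in>set ts. top_cond White t)"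
    using top by blast
  ultimately show ?thesis unfolding local_cond_def using White by (simp, metis)
qed

lemma well_formed_iff_nodes:
  "well_formed m c t \<longleftrightarrow> top_cond c t \<and> (\<forall>(c', ts)\<in>nodes t. local_cond m c' ts)"
proof (induction m c t rule: well_formed.induct)
  case (3 m c c' ts)
  then have "(\<forall>t\<in>set ts. well_formed m c' t) \<longleftrightarrow>
      (\<forall>t\<in>set ts. top_cond c' t) \<and> (\<forall>t\<in>set ts. \<forall>(c'', us)\<in>nodes t. local_cond m c'' us)" by auto
  then show ?case by (auto simp: local_cond_iff top_cond_def[of c])
qed (auto simp: top_cond_def)

text \<open>The blossoming condition is automatic for well-formed trees, because by
  \<open>net_step_well_formed\<close> their net is -1.\<close>

lemma T_family_eq:
  assumes "m \<ge> 3"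
  shows "T_family m i =
    {t. \<exists>ts. t = Node White ts \<and> t \<in> labelled_trees m Black (int i) \<and> is_node (last ts)}"
proof -
  have bip: "m_bipartite m (Node c ts) \<longleftrightarrow> c = White \<and> well_formed m Black (Node c ts)"
    for c and ts :: "int plane_tree list"
  proof -
    have "blossoming (Node c ts)" if "well_formed m Black (Node c ts)"
      using net_step_well_formed[OF that] assms by (simp add: blossoming_iff)
    moreover have "m_bipartite m (Node c ts) \<longleftrightarrow>
      blossoming (Node c ts) \<and> c = White \<and> (\<forall>(c', us)\<in>nodes (Node c ts). local_cond m c' us)"
      unfolding m_bipartite_def local_cond_def by auto
    ultimately show ?thesis
      unfolding well_formed_iff_nodes[of m Black] by (cases c) (auto simp: top_cond_def)
  qed
  have "ts \<noteq> []" if "well_formed m Black (Node c ts)" for c and ts :: "int plane_tree list"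
    using that assms by auto
  then show ?thesis
    unfolding T_family_def enriched_iff labelled_trees_def using bip by auto
qed

text \<open>Each tree lowers the height by 1, so the tree at index \<open>k\<close> starts at
  \<open>h - k\<close>. This is the origin of the descending indices in the product for
  \<open>q\<close>.\<close>

lemma labels_ok_concat:
  assumes "\<forall>t\<in>set ts. net_step (walk t) = -1"
  shows "labels_ok h (concat (map walk ts)) \<longleftrightarrow> (\<forall>k<length ts. labels_ok (h - int k) (walk (ts ! k)))"
  using assms
proof (induction ts arbitrary: h)
  case (Cons t ts)
  then show ?case by (simp add: labels_ok_append All_less_Suc2 algebra_simps)
qed simp

lemma labelled_trees_White:
  assumes "m \<ge> 2"
  shows "labelled_trees m White h =
    Node Black ` {us. length us = m - 1 \<and> (\<forall>k<m - 1. us ! k \<in> labelled_trees m Black (h - int k))}"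
proof -
  have net: "net_step (walk t) = -1" if "well_formed m Black t" for t :: "int plane_tree"
    using net_step_well_formed[OF that] assms by simp
  have "t \<in> labelled_trees m White h \<longleftrightarrow> (\<exists>us. t = Node Black us \<and> length us = m - 1 \<and>
      (\<forall>k<m - 1. us ! k \<in> labelled_trees m Black (h - int k)))" for t
  proof (cases t)
    case (Node c us)
    have "well_formed m White (Node Black us) \<longleftrightarrow> length us = m - 1 \<and> (\<forall>k<m - 1. well_formed m Black (us ! k))"
      using assms by (auto simp: all_set_conv_all_nth)
    moreover have "labels_ok h (walk (Node Black us)) \<longleftrightarrow> (\<forall>k<m - 1. labels_ok (h - int k) (walk (us ! k)))"
      if "length us = m - 1" "\<forall>k<m - 1. well_formed m Black (us ! k)"
    proof -
      have "\<forall>t\<in>set us. net_step (walk t) = -1"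
        using that net by (simp add: all_set_conv_all_nth)
      then show ?thesis using that labels_ok_concat[of us h] by simp
    qed
    ultimately show ?thesis using Node
      by (cases c) (auto simp: labelled_trees_def is_node_def)
  qed (auto simp: labelled_trees_def is_node_def)
  then show ?thesis by auto
qed

definition white_node :: "nat \<Rightarrow> nat \<Rightarrow> 'a plane_tree \<Rightarrow> 'a plane_tree" where
  "white_node m k b = Node White (replicate k (Leaf Opening) @ b # replicate (m - 2 - k) (Leaf Opening))"

lemma white_node_exhaust:
  assumes "well_formed m Black (Node White ts)"
  shows "\<exists>k b. k \<le> m - 2 \<and> is_node b \<and> well_formed m White b \<and> Node White ts = white_node m k b"
proof -
  have leaf: "t = Leaf Opening" if "t \<in> set ts" "\<not> is_node t" for t
  proof -
    have "well_formed m White t" using assms that by auto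
    then show ?thesis using that(2) by (cases "(m, White, t)" rule: well_formed.cases) (auto simp: is_node_def)
  qed
  have len: "length (filter is_node ts) = 1" "Suc (length ts) = m" using assms by auto
  then obtain b where b: "filter is_node ts = [b]" by (cases "filter is_node ts") auto
  then obtain us vs where ts: "ts = us @ b # vs" "\<forall>u\<in>set us. \<not> is_node u" "is_node b" "[] = filter is_node vs"
    using filter_eq_ConsD[OF b] by blast
  have "replicate (length us) (Leaf Opening) = us" "replicate (length vs) (Leaf Opening) = vs"
    using ts leaf by (auto simp: filter_empty_conv[of _ vs] dest!: sym[of "[]"] intro!: replicate_eqI[symmetric])
  moreover have "length vs = m - 2 - length us" "length us \<le> m - 2" using len ts by auto
  moreover have "well_formed m White b" using assms ts by auto
  ultimately show ?thesis
    using ts by (intro exI[of _ "length us"] exI[of _ b]) (simp add: white_node_def)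
qed

lemma well_formed_white_node:
  assumes "is_node b" "k \<le> m - 2" "m \<ge> 2"
  shows "well_formed m c (white_node m k b) \<longleftrightarrow> c = Black \<and> well_formed m White b"
  using assms by (cases c) (auto simp: white_node_def is_node_def filter_replicate)

text \<open>Only the \<open>k\<close> opening leaves to the left of \<open>b\<close> raise the
  heights of its closing leaves; those to the right come after all closing leaves.\<close>

lemma labels_ok_white_node:
  "labels_ok h (walk (white_node m k b)) \<longleftrightarrow> labels_ok (h + int k) (walk b)"
proof -
  have "concat (map walk (replicate j (Leaf Opening))) = replicate j (Opening :: int leaf)" for j
    by (induction j) auto
  moreover have "net_step (replicate j (Opening :: int leaf)) = int j" for j
    by (induction j) auto
  ultimately show ?thesis
    by (simp add: white_node_def labels_ok_append labels_ok_replicate)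
qed

lemma labelled_trees_Black:
  assumes "m \<ge> 2"
  shows "labelled_trees m Black h =
    (\<lambda>x. Leaf (Closing x)) ` {0..<h} \<union>
    (\<Union>k\<in>{0..m - 2}. white_node m k ` labelled_trees m White (h + int k))"
proof -
  have "t \<in> labelled_trees m Black h \<longleftrightarrow> (\<exists>x\<in>{0..<h}. t = Leaf (Closing x)) \<or>
      (\<exists>k\<in>{0..m - 2}. \<exists>b\<in>labelled_trees m White (h + int k). t = white_node m k b)" for t
  proof (cases t)
    case (Leaf l)
    then show ?thesis by (cases l) (auto simp: labelled_trees_def white_node_def)
  next
    case (Node c us)
    show ?thesis
    proof
      assume t: "t \<in> labelled_trees m Black h"
      then have wf: "well_formed m Black t" "labels_ok h (walk t)" by (auto simp: labelled_trees_def)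
      then have "c = White" using Node by (cases c) auto
      then obtain k b where kb: "k \<le> m - 2" "is_node b" "well_formed m White b" "t = white_node m k b"
        using white_node_exhaust[of m us] wf Node by auto
      then show "(\<exists>x\<in>{0..<h}. t = Leaf (Closing x)) \<or>
        (\<exists>k\<in>{0..m - 2}. \<exists>b\<in>labelled_trees m White (h + int k). t = white_node m k b)"
        using wf labels_ok_white_node[of h m k b] by (auto simp: labelled_trees_def)
    next
      assume "(\<exists>x\<in>{0..<h}. t = Leaf (Closing x)) \<or>
        (\<exists>k\<in>{0..m - 2}. \<exists>b\<in>labelled_trees m White (h + int k). t = white_node m k b)"
      then obtain k b where "k \<le> m - 2" "b \<in> labelled_trees m White (h + int k)" "t = white_node m k b"
        using Node by auto
      then show "t \<in> labelled_trees m Black h"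
        using assms well_formed_white_node[of b k m Black] labels_ok_white_node[of h m k b]
        by (simp add: labelled_trees_def)
    qed
  qed
  then show ?thesis by blast
qed

text \<open>The net is negative, so some leaf is closing and the final height, \<open>h - 1\<close>
  or \<open>h + 1 - m\<close>, is nonnegative. The second case yields the convention that
  \<open>q\<close> vanishes at indices \<open>\<le> 0\<close>.\<close>

lemma labelled_trees_empty:
  assumes "m \<ge> 2"
  shows "h \<le> 0 \<Longrightarrow> labelled_trees m Black h = {}" "h < int m - 1 \<Longrightarrow> labelled_trees m White h = {}"
proof -
  have closing: "\<exists>x. Closing x \<in> set ls" if "net_step ls < 0" for ls :: "int leaf list"
  proof (rule ccontr)
    assume "\<nexists>x. Closing x \<in> set ls"
    then have "net_step ls \<ge> 0"
      by (induction ls) (auto, metis add_increasing leaf.exhaust step.simps(1) zero_le_one)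
    then show False using that by simp
  qed
  show "labelled_trees m Black h = {}" if "h \<le> 0"
  proof -
    have False if "t \<in> labelled_trees m Black h" for t
      using that \<open>h \<le> 0\<close> net_step_well_formed[of m Black t] closing[of "walk t"] assms
        labels_ok_final_nonneg[of h "walk t"] by (auto simp: labelled_trees_def)
    then show ?thesis by blast
  qed
  show "labelled_trees m White h = {}" if "h < int m - 1"
  proof -
    have False if "t \<in> labelled_trees m White h" for t
      using that \<open>h < int m - 1\<close> net_step_well_formed[of m White t] closing[of "walk t"] assms
        labels_ok_final_nonneg[of h "walk t"] by (auto simp: labelled_trees_def)
    then show ?thesis by blast
  qed
qed

lemma white_node_inj: "white_node m k b = white_node m l b' \<Longrightarrow> is_node b \<Longrightarrow> is_node b' \<Longrightarrow> k = l \<and> b = b'"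
proof -
  assume eq: "white_node m k b = white_node m l b'" and b: "is_node b" "is_node b'"
  have tw: "takeWhile (\<lambda>t. \<not> is_node t) (replicate j (Leaf Opening) @ b # vs) = replicate j (Leaf Opening)"
    "dropWhile (\<lambda>t. \<not> is_node t) (replicate j (Leaf Opening) @ b # vs) = b # vs"
    if "is_node b" for j b and vs :: "'a plane_tree list"
  proof -
    have "\<not> is_node (Leaf Opening :: 'a plane_tree)" by (simp add: is_node_def)
    then show "takeWhile (\<lambda>t. \<not> is_node t) (replicate j (Leaf Opening) @ b # vs) = replicate j (Leaf Opening)"
      "dropWhile (\<lambda>t. \<not> is_node t) (replicate j (Leaf Opening) @ b # vs) = b # vs"
      using that by (induction j) auto
  qed
  show "k = l \<and> b = b'"
    using eq arg_cong[of _ _ "takeWhile (\<lambda>t. \<not> is_node t)"] arg_cong[of _ _ "dropWhile (\<lambda>t. \<not> is_node t)"]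
      tw[OF b(1)] tw[OF b(2)] unfolding white_node_def
    by (metis length_replicate list.inject plane_tree.inject(2))
qed

text \<open>A black root uses up one black node, which drives the induction on the bound; a white
  root adds only the finite choice of the position of its black child, and a closing leaf the finite
  choice of its label.\<close>

lemma finite_labelled_trees:
  assumes "m \<ge> 2"
  shows "finite {t \<in> labelled_trees m White h. black_nodes t \<le> n}"
    and "finite {t \<in> labelled_trees m Black h. black_nodes t \<le> n}"
proof -
  have B: "finite {t \<in> labelled_trees m Black h. black_nodes t \<le> n}"
    if "\<And>h. finite {t \<in> labelled_trees m White h. black_nodes t \<le> n}" for n h
  proof -
    have bn: "black_nodes (white_node m k b) = black_nodes b" for k and b :: "int plane_tree"
      by (simp add: white_node_def sum_list_replicate)
    have "{t \<in> labelled_trees m Black h. black_nodes t \<le> n} \<subseteq> (\<lambda>x. Leaf (Closing x)) ` {0..<h} \<union>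
        (\<Union>k\<in>{0..m - 2}. white_node m k ` {t \<in> labelled_trees m White (h + int k). black_nodes t \<le> n})"
      unfolding labelled_trees_Black[OF assms] using bn by auto
    then show ?thesis by (rule finite_subset) (use that in auto)
  qed
  have W: "finite {t \<in> labelled_trees m White h. black_nodes t \<le> n}" for n h
  proof (induction n arbitrary: h)
    case 0
    have "{t \<in> labelled_trees m White h. black_nodes t \<le> 0} = {}"
      unfolding labelled_trees_White[OF assms] by auto
    then show ?case by (simp only: finite.emptyI)
  next
    case (Suc n)
    let ?A = "\<Union>k<m - 1. {t \<in> labelled_trees m Black (h - int k). black_nodes t \<le> n}"
    have "{t \<in> labelled_trees m White h. black_nodes t \<le> Suc n} \<subseteq>
        Node Black ` {us. set us \<subseteq> ?A \<and> length us = m - 1}"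
    proof
      fix t assume "t \<in> {t \<in> labelled_trees m White h. black_nodes t \<le> Suc n}"
      then obtain us where us: "t = Node Black us" "length us = m - 1"
        "\<forall>k<m - 1. us ! k \<in> labelled_trees m Black (h - int k)" "sum_list (map black_nodes us) \<le> n"
        unfolding labelled_trees_White[OF assms] by auto
      have "black_nodes u \<le> n" if "u \<in> set us" for u
        using member_le_sum_list[of "black_nodes u" "map black_nodes us"] that us(4) by auto
      then have "set us \<subseteq> ?A" using us(2,3) by (auto simp: set_conv_nth)
      then show "t \<in> Node Black ` {us. set us \<subseteq> ?A \<and> length us = m - 1}"
        using us by auto
    qed
    moreover have "finite ?A" using B[OF Suc.IH] by blast
    ultimately show ?case
      by (rule finite_subset[OF _ finite_imageI[OF finite_lists_length_eq]])
  qed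
  show "finite {t \<in> labelled_trees m White h. black_nodes t \<le> n}" by (rule W)
  show "finite {t \<in> labelled_trees m Black h. black_nodes t \<le> n}" by (rule B[OF W])
qed

definition tree_series :: "nat \<Rightarrow> color \<Rightarrow> int \<Rightarrow> int fps" where
  "tree_series m c h = Abs_fps (\<lambda>n. int (card {t \<in> labelled_trees m c h. black_nodes t = n}))"

lemma has_counting_series_tree_series:
  assumes "m \<ge> 2"
  shows "has_counting_series (labelled_trees m c h) black_nodes (tree_series m c h)"
proof -
  have "finite {t \<in> labelled_trees m c h. black_nodes t = n}" for n
    by (rule finite_subset[of _ "{t \<in> labelled_trees m c h. black_nodes t \<le> n}"])
       (use finite_labelled_trees[OF assms] in \<open>cases c; auto\<close>)+
  then show ?thesis by (simp add: has_counting_series_def tree_series_def)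
qed

lemma has_counting_series_unique:
  "has_counting_series F wt f \<Longrightarrow> has_counting_series F wt g \<Longrightarrow> f = g"
  by (simp add: has_counting_series_def fps_eq_iff)

lemma tree_series_White:
  assumes "m \<ge> 2"
  shows "tree_series m White h = fps_X * (\<Prod>k<m - 1. tree_series m Black (h - int k))"
proof (rule has_counting_series_unique)
  show "has_counting_series (labelled_trees m White h) black_nodes (tree_series m White h)"
    by (rule has_counting_series_tree_series[OF assms])
  show "has_counting_series (labelled_trees m White h) black_nodes
      (fps_X * (\<Prod>k<m - 1. tree_series m Black (h - int k)))"
    unfolding labelled_trees_White[OF assms]
    by (rule has_counting_series_image_Suc[OF has_counting_series_lists[OF has_counting_series_tree_series[OF assms]]])
       (auto simp: inj_on_def)
qed

text \<open>The constant \<open>nat h\<close> counts the labels of a single closing leaf; the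
  summation index is the number of opening leaves to the left of the black child.\<close>

lemma tree_series_Black:
  assumes "m \<ge> 2"
  shows "tree_series m Black h =
    of_nat (nat h) + (\<Sum>k=0..m - 2. tree_series m White (h + int k))"
proof (rule has_counting_series_unique)
  show "has_counting_series (labelled_trees m Black h) black_nodes (tree_series m Black h)"
    by (rule has_counting_series_tree_series[OF assms])
  let ?C = "(\<lambda>x. Leaf (Closing x)) ` {0..<h} :: int plane_tree set"
  have "{t \<in> ?C. black_nodes t = n} = (if n = 0 then ?C else {})" for n by auto
  then have C: "has_counting_series ?C black_nodes (of_nat (nat h))"
    by (simp add: has_counting_series_def fps_of_nat[symmetric] card_image inj_on_def)
  have node: "is_node b" if "b \<in> labelled_trees m White k" for b k
    using that by (simp add: labelled_trees_def)
  show "has_counting_series (labelled_trees m Black h) black_nodes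
      (of_nat (nat h) + (\<Sum>k=0..m - 2. tree_series m White (h + int k)))"
    unfolding labelled_trees_Black[OF assms]
  proof (intro has_counting_series_Un[OF C] has_counting_series_UN
      has_counting_series_image[OF has_counting_series_tree_series[OF assms]])
    show "inj_on (white_node m k) (labelled_trees m White (h + int k))" for k
      using white_node_inj node by (auto simp: inj_on_def) blast
    show "black_nodes (white_node m k b) = black_nodes b" for k and b :: "int plane_tree"
      by (simp add: white_node_def sum_list_replicate)
    show "white_node m k ` labelled_trees m White (h + int k) \<inter>
        white_node m l ` labelled_trees m White (h + int l) = {}" if "k \<noteq> l" for k l
      using white_node_inj node that by (auto, blast)
    show "?C \<inter> (\<Union>k\<in>{0..m - 2}. white_node m k ` labelled_trees m White (h + int k)) = {}"
      by (auto simp: white_node_def)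
  qed simp
qed

theorem has_counting_series_T_family:
  assumes "m \<ge> 3" "i \<ge> 1" "rq_system m r q"
  shows "has_counting_series (T_family m i) black_nodes (q (int i))"
proof -
  have m: "m \<ge> 2" using assms by simp
  \<comment> \<open>In the family the black child is rightmost, so \<open>m - 2\<close> opening
    leaves precede it and it is read from height \<open>j + m - 2\<close>.\<close>
  define q' where "q' j = (if j \<le> 0 then 0 else tree_series m White (j + int m - 2))" for j
  have zero: "tree_series m White (j + int m - 2) = 0" if "j \<le> 0" for j
    using labelled_trees_empty(2)[OF m, of "j + int m - 2"] that
    by (simp add: tree_series_def fps_eq_iff)
  then have q': "q' j = tree_series m White (j + int m - 2)" for j
    by (simp add: q'_def)
  have "rq_system m (tree_series m Black) q'"
    unfolding rq_system_def
  proof (intro conjI allI impI)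
    show "q' j = 0" if "j \<le> 0" for j using that by (simp add: q'_def)
    show "tree_series m Black j = of_int j + (\<Sum>a=0..m - 2. q' (j - int a))" if "j \<ge> 1" for j
    proof -
      \<comment> \<open>The index \<open>a\<close> of the system counts the opening leaves to the
        right of the black child, hence the reversal \<open>k = m - 2 - a\<close>.\<close>
      have "(\<Sum>k=0..m - 2. tree_series m White (j + int k)) = (\<Sum>a=0..m - 2. tree_series m White (j + int (m - 2 - a)))"
        using sum.atLeastAtMost_rev[of "\<lambda>k. tree_series m White (j + int k)" 0 "m - 2"] by simp
      also have "\<dots> = (\<Sum>a=0..m - 2. q' (j - int a))"
        using m by (intro sum.cong) (auto simp: q' of_nat_diff algebra_simps)
      finally show ?thesis using that by (simp add: tree_series_Black[OF m])
    qed
    show "q' j = fps_X * (\<Prod>a=0..m - 2. tree_series m Black (j + int a))" if "j \<ge> 1" for j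
    proof -
      have "(\<Prod>k<m - 1. tree_series m Black (j + int m - 2 - int k)) = (\<Prod>k=0..m - 2. tree_series m Black (j + int m - 2 - int k))"
        using m by (intro prod.cong) auto
      also have "\<dots> = (\<Prod>a=0..m - 2. tree_series m Black (j + int m - 2 - int (m - 2 - a)))"
        using prod.atLeastAtMost_rev[of "\<lambda>k. tree_series m Black (j + int m - 2 - int k)" 0 "m - 2"] by simp
      also have "\<dots> = (\<Prod>a=0..m - 2. tree_series m Black (j + int a))"
        using m by (intro prod.cong) (auto simp: of_nat_diff algebra_simps)
      finally show ?thesis by (simp add: q' tree_series_White[OF m])
    qed
  qed
  then have q: "q (int i) = tree_series m White (int i + int m - 2)"
    using rq_system_unique(2)[OF _ assms(3)] assms(2) by (auto simp: q')
  have "T_family m i = white_node m (m - 2) ` labelled_trees m White (int i + int (m - 2))"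
  proof (intro equalityI subsetI)
    fix t assume "t \<in> T_family m i"
    then obtain ts where t: "t = Node White ts" "t \<in> labelled_trees m Black (int i)" "is_node (last ts)"
      unfolding T_family_eq[OF assms(1)] by auto
    then obtain k b where kb: "k \<le> m - 2" "t = white_node m k b" "b \<in> labelled_trees m White (int i + int k)"
      unfolding labelled_trees_Black[OF m] by auto
    have "k = m - 2"
    proof (rule ccontr)
      assume "k \<noteq> m - 2"
      then have "last ts = Leaf Opening" using t kb by (auto simp: white_node_def)
      then show False using t(3) by (simp add: is_node_def)
    qed
    then show "t \<in> white_node m (m - 2) ` labelled_trees m White (int i + int (m - 2))" using kb by auto
  next
    fix t assume t: "t \<in> white_node m (m - 2) ` labelled_trees m White (int i + int (m - 2))"
    then have "t \<in> labelled_trees m Black (int i)"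
      unfolding labelled_trees_Black[OF m] by auto
    moreover have "\<exists>ts. t = Node White ts \<and> is_node (last ts)"
      using t by (auto simp: white_node_def labelled_trees_def)
    ultimately show "t \<in> T_family m i" unfolding T_family_eq[OF assms(1)] by auto
  qed
  moreover have "has_counting_series (white_node m (m - 2) ` labelled_trees m White (int i + int (m - 2)))
      black_nodes (tree_series m White (int i + int (m - 2)))"
  proof (rule has_counting_series_image[OF has_counting_series_tree_series[OF m]])
    show "inj_on (white_node m (m - 2)) (labelled_trees m White (int i + int (m - 2)))"
      by (auto simp: inj_on_def white_node_def)
  qed (simp add: white_node_def sum_list_replicate)
  moreover have "int i + int (m - 2) = int i + int m - 2" using m by simp
  ultimately show ?thesis unfolding q by (simp only:)
qed

section \<open>Forgetting the labels of the closing leaves\<close>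

definition forget :: "'a plane_tree \<Rightarrow> unit plane_tree" where
  "forget t = map_plane_tree (\<lambda>_. ()) t"

lemma forget_Node [simp]: "forget (Node c ts) = Node c (map forget ts)"
  by (simp add: forget_def)

definition leaf_word :: "'a leaf list \<Rightarrow> bool list" where
  "leaf_word ls = map (\<lambda>l. \<not> is_closing l) ls"

lemma walk_map: "walk (map_plane_tree f t) = map (map_leaf f) (walk t)"
  by (induction t) (simp_all add: map_concat o_def cong: map_cong)

lemma is_closing_map [simp]: "is_closing (map_leaf f l) = is_closing l"
  by (cases l) (auto simp: is_closing_def)

lemma leaf_word_forget: "leaf_word (walk (forget t)) = leaf_word (walk t)"
  by (simp add: forget_def walk_map leaf_word_def o_def)

lemma leaf_word_append [simp]: "leaf_word (xs @ ys) = leaf_word xs @ leaf_word ys"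
  by (simp add: leaf_word_def)

lemma net_leaf_word: "net (leaf_word ls) = net_step ls"
proof (induction ls)
  case (Cons l ls)
  then show ?case by (cases l) (auto simp: leaf_word_def is_closing_def)
qed (simp add: leaf_word_def)

lemma black_nodes_forget: "black_nodes (forget t) = black_nodes t"
  unfolding forget_def by (induction t) (simp_all add: o_def cong: map_cong)

lemma is_node_forget: "is_node (forget t) = is_node t"
  by (cases t) (auto simp: is_node_def forget_def)

lemma well_formed_forget: "well_formed m c (forget t) = well_formed m c t"
proof (induction m c t rule: well_formed.induct)
  case (3 m c c' ts)
  have "length (filter is_node (map forget ts)) = length (filter is_node ts)"
    by (simp add: filter_map o_def is_node_forget)
  then show ?case using 3 by auto
qed (simp_all add: forget_def)

text \<open>Heights depend only on the unlabelled tree, so the labels are chosen independently, with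
  \<open>h\<close> choices at a closing leaf of height \<open>h\<close>.\<close>

lemma card_labellings:
  assumes "h \<ge> 0"
  shows "finite {t. forget t = s \<and> labels_ok h (walk t)} \<and>
    int (card {t. forget t = s \<and> labels_ok h (walk t)}) = height_prod h (leaf_word (walk s))"
  using assms
proof (induction s arbitrary: h)
  case (Leaf l)
  show ?case
  proof (cases l)
    case Opening
    have "{t. forget t = Leaf Opening \<and> labels_ok h (walk t)} = {Leaf Opening}"
    proof (intro equalityI subsetI)
      fix t :: "int plane_tree" assume t: "t \<in> {t. forget t = Leaf Opening \<and> labels_ok h (walk t)}"
      then obtain l where "t = Leaf l" by (cases t) (auto simp: forget_def)
      then show "t \<in> {Leaf Opening}" using t by (cases l) (auto simp: forget_def)
    qed (auto simp: forget_def)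
    then show ?thesis using Opening by (simp add: leaf_word_def is_closing_def)
  next
    case (Closing u)
    have "{t. forget t = Leaf (Closing ()) \<and> labels_ok h (walk t)} = (\<lambda>x. Leaf (Closing x)) ` {0..<h}"
    proof (intro equalityI subsetI)
      fix t :: "int plane_tree" assume t: "t \<in> {t. forget t = Leaf (Closing ()) \<and> labels_ok h (walk t)}"
      then obtain l where "t = Leaf l" by (cases t) (auto simp: forget_def)
      then show "t \<in> (\<lambda>x. Leaf (Closing x)) ` {0..<h}" using t by (cases l) (auto simp: forget_def)
    qed (auto simp: forget_def)
    then show ?thesis using Closing Leaf
      by (simp add: leaf_word_def is_closing_def card_image inj_on_def)
  qed
next
  case (Node c ss)
  define L where "L ss h = {ts. map forget ts = ss \<and> labels_ok h (concat (map walk ts))}" for ss h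
  have *: "finite (L ss h) \<and> int (card (L ss h)) = height_prod h (leaf_word (concat (map walk ss)))"
    if "h \<ge> 0" "\<And>s h. s \<in> set ss \<Longrightarrow> h \<ge> 0 \<Longrightarrow> finite {t. forget t = s \<and> labels_ok h (walk t)} \<and>
    int (card {t. forget t = s \<and> labels_ok h (walk t)}) = height_prod h (leaf_word (walk s))" for ss h
    using that
  proof (induction ss arbitrary: h)
    case Nil
    have "L [] h = {[]}" by (auto simp: L_def)
    then show ?case by (simp add: leaf_word_def)
  next
    case (Cons s ss)
    let ?A = "{t. forget t = s \<and> labels_ok h (walk t)}" and ?h = "h + net_step (walk s)"
    have A: "finite ?A" "int (card ?A) = height_prod h (leaf_word (walk s))"
      using Cons.prems by auto
    have net: "net_step (walk t) = net_step (walk s)" if "forget t = s" for t :: "int plane_tree"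
      using that net_leaf_word leaf_word_forget by metis
    have L: "L (s # ss) h = (\<lambda>(t, ts). t # ts) ` (?A \<times> L ss ?h)"
      using net by (auto simp: L_def labels_ok_append image_iff Cons_eq_map_conv map_eq_Cons_conv)
    have inj: "inj_on (\<lambda>(t, ts). t # ts) (?A \<times> L ss ?h)" by (auto simp: inj_on_def)
    show ?case
    proof (cases "?A = {}")
      case True
      then have "height_prod h (leaf_word (walk s)) = 0" using A(2) by (simp only: card.empty)
      then show ?thesis unfolding L True by (simp add: height_prod_append)
    next
      case False
      then obtain t where "forget t = s" "labels_ok h (walk t)" by auto
      then have "?h \<ge> 0" using labels_ok_final_nonneg[of h "walk t"] net Cons.prems by auto
      then have "finite (L ss ?h) \<and> int (card (L ss ?h)) = height_prod ?h (leaf_word (concat (map walk ss)))"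
        using Cons.prems by (intro Cons.IH) auto
      then show ?thesis using A unfolding L card_image[OF inj]
        by (simp add: card_cartesian_product height_prod_append net_leaf_word)
    qed
  qed
  have "{t. forget t = Node c ss \<and> labels_ok h (walk t)} = Node c ` L ss h"
  proof (intro equalityI subsetI)
    fix t :: "int plane_tree" assume t: "t \<in> {t. forget t = Node c ss \<and> labels_ok h (walk t)}"
    then obtain ts where "t = Node c ts" by (cases t) (auto simp: forget_def)
    then show "t \<in> Node c ` L ss h" using t by (auto simp: forget_def L_def)
  qed (auto simp: forget_def L_def)
  then show ?case using *[of h ss] Node by (simp add: card_image inj_on_def)
qed

section \<open>Spanning trees of bipartite maps\<close>

text \<open>
  \<open>W\<close> is the set of darts at white vertices, \<open>r\<close> the dart preceding the root corner, \<open>K\<close> the set of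
  marked darts.
\<close>

locale bipartite_map =
  fixes D :: "'d set" and rot opp :: "'d \<Rightarrow> 'd" and m :: nat and W :: "'d set" and r :: 'd and K :: "'d set"
  assumes finite_D: "finite D"
    and rot_permutes: "rot permutes D"
    and opp_permutes: "opp permutes D"
    and opp_neq: "d \<in> D \<Longrightarrow> opp d \<noteq> d"
    and opp_opp: "d \<in> D \<Longrightarrow> opp (opp d) = d"
    and rot_m: "d \<in> D \<Longrightarrow> (rot ^^ m) d = d"
    and rot_less: "d \<in> D \<Longrightarrow> 0 < k \<Longrightarrow> k < m \<Longrightarrow> (rot ^^ k) d \<noteq> d"
    and W_D: "W \<subseteq> D"
    and rot_W: "d \<in> D \<Longrightarrow> rot d \<in> W \<longleftrightarrow> d \<in> W"
    and opp_W: "d \<in> D \<Longrightarrow> opp d \<in> W \<longleftrightarrow> d \<notin> W"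
    and r_W: "r \<in> W"
    and K_W: "K \<subseteq> W"
    and m_ge: "m \<ge> 2"
begin

definition V :: "'d \<Rightarrow> 'd set" where "V d = orbit rot d"

lemma rot_D: "d \<in> D \<Longrightarrow> rot d \<in> D"
  using rot_permutes by (simp add: permutes_in_image)

lemma opp_D: "d \<in> D \<Longrightarrow> opp d \<in> D"
  using opp_permutes by (simp add: permutes_in_image)

lemma opp_inj: "opp d = opp e \<Longrightarrow> d = e"
  using opp_permutes by (meson permutes_inj injD)

lemma inj_opp: "inj_on opp A"
  using opp_inj by (auto simp: inj_on_def)

lemma r_D: "r \<in> D" using r_W W_D by blast

lemma rot_pow_D: "d \<in> D \<Longrightarrow> (rot ^^ k) d \<in> D"
  by (induction k) (auto simp: rot_D)

lemma permutation_rot: "permutation rot"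
  using rot_permutes finite_D permutation_permutes by blast

lemma self_V: "d \<in> V d"
  unfolding V_def by (rule permutation_self_in_orbit[OF permutation_rot])

lemma V_eq: "e \<in> V d \<Longrightarrow> V e = V d"
  unfolding V_def
  using orbit_trans orbit_swap[OF permutation_self_in_orbit[OF permutation_rot]] by (metis subsetI subset_antisym)

lemma V_rot: "V (rot d) = V d"
  by (rule V_eq) (simp add: V_def orbit.base)

lemma V_pow: "V ((rot ^^ k) d) = V d"
  by (induction k) (auto simp: V_rot)

lemma in_V_iff: "e \<in> V d \<longleftrightarrow> V e = V d"
  using V_eq self_V by blast

lemma V_altdef: "d \<in> D \<Longrightarrow> V d = (\<lambda>k. (rot ^^ k) d) ` {..<m}"
proof (intro equalityI subsetI)
  fix e assume d: "d \<in> D" and "e \<in> V d"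
  then obtain n where "e = (rot ^^ n) d" by (auto simp: V_def orbit_altdef)
  moreover have "(rot ^^ (k * m)) d = d" for k
    by (induction k) (auto simp: funpow_add rot_m[OF d])
  moreover have "(rot ^^ n) d = (rot ^^ (n mod m)) ((rot ^^ (n div m * m)) d)"
    by (metis add.commute comp_apply div_mult_mod_eq funpow_add)
  ultimately show "e \<in> (\<lambda>k. (rot ^^ k) d) ` {..<m}" using m_ge by auto
next
  fix e assume "e \<in> (\<lambda>k. (rot ^^ k) d) ` {..<m}"
  then show "e \<in> V d" by (auto simp: in_V_iff V_pow)
qed

lemma rot_inj: "rot d = rot e \<Longrightarrow> d = e"
  using rot_permutes by (meson permutes_inj injD)

lemma rot_pow_inj: "(rot ^^ k) d = (rot ^^ k) e \<Longrightarrow> d = e"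
  by (induction k) (auto dest: rot_inj)

lemma inj_on_rot_pow:
  assumes "d \<in> D"
  shows "inj_on (\<lambda>k. (rot ^^ k) d) {..<m}"
proof -
  have False if "k < l" "l < m" "(rot ^^ k) d = (rot ^^ l) d" for k l
  proof -
    have "(rot ^^ l) d = (rot ^^ k) ((rot ^^ (l - k)) d)"
      using that by (metis add_diff_inverse_nat comp_apply funpow_add not_less_iff_gr_or_eq)
    then have "(rot ^^ (l - k)) d = d" using that rot_pow_inj[of k d] by metis
    then show False using rot_less[OF assms, of "l - k"] that by auto
  qed
  then show ?thesis by (auto simp: inj_on_def) (metis nat_neq_iff)
qed

lemma card_V: "d \<in> D \<Longrightarrow> card (V d) = m"
  using V_altdef inj_on_rot_pow by (simp add: card_image)

lemma V_subset: "d \<in> S \<Longrightarrow> (\<And>x. x \<in> S \<Longrightarrow> rot x \<in> S) \<Longrightarrow> V d \<subseteq> S"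
proof
  fix e assume S: "d \<in> S" "\<And>x. x \<in> S \<Longrightarrow> rot x \<in> S" and "e \<in> V d"
  then obtain n where "e = (rot ^^ n) d" by (auto simp: V_def orbit_altdef)
  moreover have "(rot ^^ n) d \<in> S" by (induction n) (use S in auto)
  ultimately show "e \<in> S" by simp
qed

lemma V_D: "d \<in> D \<Longrightarrow> V d \<subseteq> D"
  by (rule V_subset) (auto simp: rot_D)

lemma V_W: "d \<in> W \<Longrightarrow> V d \<subseteq> W"
  by (rule V_subset) (use rot_W W_D in auto)

lemma V_notW: "d \<in> D - W \<Longrightarrow> V d \<subseteq> D - W"
  by (rule V_subset) (use rot_W rot_D in auto)

lemma W_V: "d \<in> D \<Longrightarrow> V d = V e \<Longrightarrow> d \<in> W \<longleftrightarrow> e \<in> W"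
  using V_W V_notW self_V by (metis DiffI in_V_iff subsetD Diff_iff V_D)

lemma finite_V: "d \<in> D \<Longrightarrow> finite (V d)"
  using V_D finite_D finite_subset by blast

lemma card_closed:
  assumes "S \<subseteq> D" "\<And>d. d \<in> S \<Longrightarrow> V d \<subseteq> S"
  shows "card S = m * card (V ` S)"
proof -
  have "S = \<Union> (V ` S)" using assms(2) self_V by blast
  moreover have "card (\<Union> (V ` S)) = (\<Sum>v\<in>V ` S. card v)"
  proof (rule card_Union_disjoint)
    show "pairwise disjnt (V ` S)"
      using in_V_iff by (auto simp: pairwise_def disjnt_def)
    show "finite v" if "v \<in> V ` S" for v using that assms(1) finite_V by blast
  qed
  moreover have "(\<Sum>v\<in>V ` S. card v) = (\<Sum>v\<in>V ` S. m)"
    using assms(1) card_V by (intro sum.cong) auto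
  ultimately show ?thesis by simp
qed

text \<open>\<open>opp\<close> exchanges white and black darts, and every vertex has
  \<open>m\<close> darts.\<close>

lemma card_white_black: "card (V ` W) = card (V ` (D - W))"
proof -
  have "opp ` W = D - W"
  proof (intro equalityI subsetI)
    fix d assume "d \<in> D - W"
    then have "d = opp (opp d)" "opp d \<in> W" using opp_opp opp_W by auto
    then show "d \<in> opp ` W" by blast
  qed (use W_D opp_W opp_D in auto)
  then have "card (D - W) = card W" using card_image[OF inj_opp, of W] by simp
  then show ?thesis
    using card_closed[of W] card_closed[of "D - W"] V_W V_notW W_D m_ge by auto
qed

section \<open>Arborescences directed to the root, and spanning trees\<close>

definition links :: "'d set \<Rightarrow> ('d set \<times> 'd set) set" where
  "links T = {(V d, V (opp d)) | d. d \<in> T}"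

lemma links_mono: "S \<subseteq> T \<Longrightarrow> links S \<subseteq> links T"
  by (auto simp: links_def)

text \<open>\<open>P\<close> contains, for every vertex but the root, the dart of its parent edge at
  the vertex itself. The function \<open>h\<close>, which decreases towards the parent, certifies
  that there are no cycles and serves as the measure for inductions along the tree.\<close>

definition arborescence :: "'d set \<Rightarrow> ('d set \<Rightarrow> nat) \<Rightarrow> bool" where
  "arborescence P h \<longleftrightarrow> P \<subseteq> D \<and> V r \<inter> P = {} \<and>
     (\<forall>d\<in>D. V d \<noteq> V r \<longrightarrow> (\<exists>!p. p \<in> V d \<inter> P)) \<and> (\<forall>p\<in>P. h (V (opp p)) < h (V p))"

lemma arborescence_exists:
  assumes Y: "Y \<subseteq> D" and reach: "\<And>d. d \<in> D \<Longrightarrow> (V d, V r) \<in> (links Y)\<^sup>*"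
  shows "\<exists>P h. P \<subseteq> Y \<and> arborescence P h"
proof -
  \<comment> \<open>The distance to the root vertex; the first dart of a shortest path is chosen as
    the parent dart.\<close>
  define h where "h v = (LEAST n. (v, V r) \<in> links Y ^^ n)" for v
  have "\<exists>p. p \<in> Y \<and> V p = v \<and> h (V (opp p)) < h v" if v: "v \<in> V ` D" "v \<noteq> V r" for v
  proof -
    obtain n where "(v, V r) \<in> links Y ^^ n"
      using v reach rtrancl_imp_relpow by blast
    then have hv: "(v, V r) \<in> links Y ^^ h v" unfolding h_def by (rule LeastI)
    then obtain k where k: "h v = Suc k" using v(2) by (cases "h v") auto
    then obtain w where w: "(v, w) \<in> links Y" "(w, V r) \<in> links Y ^^ k"
      using hv relpow_Suc_D2 by metis
    have "h w \<le> k" unfolding h_def using w(2) by (rule Least_le)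
    then show ?thesis using w(1) k by (auto simp: links_def)
  qed
  then obtain p where p: "\<And>v. v \<in> V ` D \<Longrightarrow> v \<noteq> V r \<Longrightarrow> p v \<in> Y \<and> V (p v) = v \<and> h (V (opp (p v))) < h v"
    by metis
  let ?P = "p ` (V ` D - {V r})"
  have "arborescence ?P h"
    unfolding arborescence_def
  proof (intro conjI ballI impI)
    have pv: "p v \<in> Y" "V (p v) = v" "h (V (opp (p v))) < h v" if "v \<in> V ` D - {V r}" for v
      using p[of v] that by simp_all
    show "?P \<subseteq> D"
    proof
      fix q assume "q \<in> ?P"
      then obtain v where "v \<in> V ` D - {V r}" "q = p v" by (rule imageE)
      then show "q \<in> D" using pv(1) Y by auto
    qed
    show "V r \<inter> ?P = {}"
    proof (rule ccontr)
      assume "V r \<inter> ?P \<noteq> {}"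
      then obtain q where "q \<in> V r" "q \<in> ?P" by blast
      then obtain v where "v \<in> V ` D - {V r}" "q = p v" by (elim imageE)
      then show False using pv(2)[of v] \<open>q \<in> V r\<close> by (simp add: in_V_iff)
    qed
    show "h (V (opp q)) < h (V q)" if "q \<in> ?P" for q
      using that by (rule imageE) (simp add: pv)
    show "\<exists>!q. q \<in> V d \<inter> ?P" if "d \<in> D" "V d \<noteq> V r" for d
    proof (rule ex1I[of _ "p (V d)"])
      show "p (V d) \<in> V d \<inter> ?P" using p[of "V d"] that by (auto simp: in_V_iff)
      show "q = p (V d)" if q: "q \<in> V d \<inter> ?P" for q
      proof -
        obtain v where v: "v \<in> V ` D - {V r}" "q = p v" using q by blast
        then show ?thesis using pv(2)[of v] q by (simp add: in_V_iff)
      qed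
    qed
  qed
  moreover have "?P \<subseteq> Y"
  proof
    fix q assume "q \<in> ?P"
    then obtain v where "v \<in> V ` D - {V r}" "q = p v" by (rule imageE)
    then show "q \<in> Y" using p[of v] by simp
  qed
  ultimately show ?thesis by blast
qed

lemma arborescence_parent:
  assumes "arborescence P h" "d \<in> D" "V d \<noteq> V r"
  shows "\<exists>p\<in>P. p \<in> V d"
proof -
  have "\<exists>!p. p \<in> V d \<inter> P" using assms by (simp add: arborescence_def)
  then show ?thesis by blast
qed

lemma arborescence_reach:
  assumes P: "arborescence P h" and d: "d \<in> D"
  shows "(V d, V r) \<in> (links P)\<^sup>*"
  using d
proof (induction "h (V d)" arbitrary: d rule: less_induct)
  case less
  show ?case
  proof (cases "V d = V r")
    case False
    then obtain p where p: "p \<in> V d" "p \<in> P" using arborescence_parent[OF P less.prems] by blast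
    then have "V p = V d" by (simp add: in_V_iff)
    moreover have "h (V (opp p)) < h (V p)" "opp p \<in> D" using P p opp_D by (auto simp: arborescence_def)
    ultimately have "(V (opp p), V r) \<in> (links P)\<^sup>*" using less.hyps by simp
    moreover have "(V d, V (opp p)) \<in> links P" using p \<open>V p = V d\<close> by (auto simp: links_def)
    ultimately show ?thesis by (rule converse_rtrancl_into_rtrancl[rotated])
  qed simp
qed

lemma arborescence_opp:
  assumes "arborescence P h" "p \<in> P"
  shows "opp p \<notin> P"
  using assms opp_opp unfolding arborescence_def by (metis not_less_iff_gr_or_eq subsetD)

lemma arborescence_unique:
  assumes "arborescence P h" "p \<in> P" "q \<in> P" "V p = V q"
  shows "p = q"
proof -
  have "p \<in> D" "V p \<noteq> V r" using assms self_V unfolding arborescence_def by blast+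
  then have "\<exists>!x. x \<in> V p \<inter> P" using assms unfolding arborescence_def by blast
  then show ?thesis using assms by (metis Int_iff in_V_iff)
qed

lemma card_arborescence:
  assumes "arborescence P h"
  shows "card P = card (V ` D) - 1"
proof -
  have "V ` P = V ` D - {V r}"
  proof (intro equalityI subsetI)
    fix v assume "v \<in> V ` P"
    then show "v \<in> V ` D - {V r}" using assms self_V unfolding arborescence_def by blast
  next
    fix v assume "v \<in> V ` D - {V r}"
    then obtain d where d: "d \<in> D" "v = V d" "V d \<noteq> V r" by auto
    then obtain p where "p \<in> V d" "p \<in> P" using arborescence_parent[OF assms] by blast
    then show "v \<in> V ` P" using d by (auto simp: in_V_iff)
  qed
  moreover have "card (V ` P) = card P"
    using arborescence_unique[OF assms] by (intro card_image) (auto simp: inj_on_def)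
  ultimately show ?thesis using r_D by (simp add: finite_D)
qed

text \<open>A tree is given by both darts of each of its edges. Acyclicity is not stated: the
  degrees at the white vertices fix the number of edges, and together with connectedness this leaves
  no room for a cycle.\<close>

definition spanning :: "'d set \<Rightarrow> bool" where
  "spanning T \<longleftrightarrow> T \<subseteq> D \<and> (\<forall>d\<in>T. opp d \<in> T) \<and> T \<inter> K = {} \<and>
     (\<forall>d\<in>D. (V d, V r) \<in> (links T)\<^sup>*) \<and>
     (\<forall>d\<in>W. V d \<noteq> V r \<longrightarrow> card (V d \<inter> T) = 2) \<and> V r \<inter> T = {r}"

text \<open>With \<open>n\<close> white and therefore \<open>n\<close> black vertices, the degrees
  give \<open>2n - 1\<close> white darts in \<open>T\<close>, hence \<open>2n - 1\<close> edges. An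
  arborescence inside \<open>T\<close> already has \<open>2n - 1\<close> edges, one for each vertex
  but the root, so it exhausts \<open>T\<close>.\<close>

lemma spanning_arborescence:
  assumes T: "spanning T"
  shows "\<exists>P h. arborescence P h \<and> T = P \<union> opp ` P"
proof -
  have TD: "T \<subseteq> D" and opT: "\<And>d. d \<in> T \<Longrightarrow> opp d \<in> T" using T by (auto simp: spanning_def)
  obtain P h where P: "P \<subseteq> T" "arborescence P h"
    using arborescence_exists[of T] T by (auto simp: spanning_def)
  have sub: "P \<union> opp ` P \<subseteq> T" using P opT by auto
  have fin: "finite T" "finite P"
    using finite_subset[OF TD finite_D] finite_subset[OF P(1)] by auto
  have finW: "finite (V ` W)" using finite_subset[OF W_D finite_D] by simp
  have disj: "V ` W \<inter> V ` (D - W) = {}"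
  proof (rule ccontr)
    assume "V ` W \<inter> V ` (D - W) \<noteq> {}"
    then obtain d e where "d \<in> W" "e \<in> D - W" "V d = V e" by auto
    then show False using W_V[of d e] W_D by auto
  qed
  have "V ` D = V ` W \<union> V ` (D - W)" using W_D by blast
  then have "card (V ` D) = card (V ` W) + card (V ` (D - W))"
    using disj finite_D finite_subset[OF W_D] by (simp add: card_Un_disjoint)
  then have cP: "card P = 2 * card (V ` W) - 1"
    using card_arborescence[OF P(2)] card_white_black by simp
  have "card (P \<union> opp ` P) = 2 * card P"
    using arborescence_opp[OF P(2)] fin card_image[OF inj_opp, of P] by (subst card_Un_disjoint) auto
  moreover have "card T = 2 * card P"
  proof -
    have "T \<inter> W = (\<Union>v\<in>V ` W. v \<inter> T)" using V_W self_V by blast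
    then have "card (T \<inter> W) = card (\<Union>v\<in>V ` W. v \<inter> T)" by simp
    also have "\<dots> = (\<Sum>v\<in>V ` W. card (v \<inter> T))"
    proof (rule card_UN_disjoint)
      show "finite (V ` W)" by (rule finW)
      show "\<forall>v\<in>V ` W. finite (v \<inter> T)" using fin by blast
      show "\<forall>v\<in>V ` W. \<forall>w\<in>V ` W. v \<noteq> w \<longrightarrow> v \<inter> T \<inter> (w \<inter> T) = {}" using in_V_iff by auto
    qed
    also have "\<dots> = card (V r \<inter> T) + (\<Sum>v\<in>V ` W - {V r}. card (v \<inter> T))"
      using r_W finW by (intro sum.remove) auto
    also have "(\<Sum>v\<in>V ` W - {V r}. card (v \<inter> T)) = (\<Sum>v\<in>V ` W - {V r}. 2)"
      using T by (intro sum.cong) (auto simp: spanning_def)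
    also have "card (V r \<inter> T) = 1" using T by (simp add: spanning_def)
    also have "1 + (\<Sum>v\<in>V ` W - {V r}. 2) = 2 * card (V ` W) - 1"
    proof -
      have "card (V ` W) > 0" using r_W finW by (auto simp: card_gt_0_iff)
      then show ?thesis using r_W finW by simp
    qed
    finally have "card (T \<inter> W) = 2 * card (V ` W) - 1" .
    moreover have "opp ` (T \<inter> W) = T - W"
    proof (intro equalityI subsetI)
      fix d assume "d \<in> T - W"
      then have "d = opp (opp d)" "opp d \<in> T \<inter> W" using opp_opp opp_W opT TD by auto
      then show "d \<in> opp ` (T \<inter> W)" by blast
    qed (use W_D opp_W opT in auto)
    then have "card (T - W) = card (T \<inter> W)" using card_image[OF inj_opp, of "T \<inter> W"] by simp
    moreover have "card T = card (T \<inter> W) + card (T - W)"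
      using fin by (subst card_Un_disjoint[symmetric]) (auto intro: arg_cong[of _ _ card])
    ultimately show ?thesis using cP by simp
  qed
  ultimately have "P \<union> opp ` P = T" using sub fin by (intro card_subset_eq) auto
  then show ?thesis using P by blast
qed

text \<open>Of the two tree edges at a white vertex one leads to the parent; the root vertex has a
  single tree edge and no parent.\<close>

lemma spanning_white_child:
  assumes T: "spanning T" "arborescence P h" "T = P \<union> opp ` P" and d: "d \<in> W"
  shows "\<exists>!e. e \<in> V d \<and> opp e \<in> P"
proof -
  have PD: "P \<subseteq> D" using T by (simp add: arborescence_def)
  have oppP: "opp e \<in> P \<longleftrightarrow> e \<in> T \<and> e \<notin> P" if "e \<in> D" for e
    using T(3) that arborescence_opp[OF T(2)] opp_opp PD by (auto simp: image_iff) metis+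
  have VD: "V d \<subseteq> D" using V_D W_D d by blast
  show ?thesis
  proof (cases "V d = V r")
    case True
    have "V r \<inter> T = {r}" "V r \<inter> P = {}" using T by (auto simp: spanning_def arborescence_def)
    then show ?thesis using oppP VD True by (intro ex1I[of _ r]) auto
  next
    case False
    then have two: "card (V d \<inter> T) = 2" using T(1) d unfolding spanning_def by blast
    have "d \<in> D" using d W_D by blast
    then obtain p where p: "p \<in> V d" "p \<in> P"
      using arborescence_parent[OF T(2) _ False] by blast
    have only: "q = p" if "q \<in> V d" "q \<in> P" for q
      using arborescence_unique[OF T(2) that(2) p(2)] that(1) p(1) by (simp add: in_V_iff)
    have "p \<in> V d \<inter> T" using p(1,2) unfolding T(3) by blast
    then have "card (V d \<inter> T - {p}) = 1" using two by (simp add: card_Diff_singleton)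
    then obtain q where "V d \<inter> T - {p} = {q}" by (auto simp: card_1_singleton_iff)
    then have q: "V d \<inter> T = {p, q}" "p \<noteq> q" using \<open>p \<in> V d \<inter> T\<close> by blast+
    show ?thesis
    proof (rule ex1I[of _ q])
      have "q \<in> V d \<inter> T" using q by blast
      then have "q \<in> D" "q \<in> T" "q \<in> V d" using VD by auto
      moreover have "q \<notin> P" using only[of q] q(2) \<open>q \<in> V d\<close> by auto
      ultimately show "q \<in> V d \<and> opp q \<in> P" using oppP[of q] by simp
      show "e = q" if "e \<in> V d \<and> opp e \<in> P" for e
      proof -
        have "e \<in> D" using that VD by blast
        then have "e \<in> V d \<inter> T" "e \<notin> P" using that oppP[of e] by auto
        then have "e \<in> {p, q}" using q(1) by blast
        then show ?thesis using \<open>e \<notin> P\<close> p(2) by auto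
      qed
    qed
  qed
qed

end

text \<open>
  In \<open>DNode d u ts\<close> the edge to the parent consists of the dart \<open>d\<close> at the parent and the dart \<open>u\<close> at
  the node itself; a leaf is a cut edge and keeps only its dart at the parent.
\<close>

datatype 'd dart_tree = DLeaf 'd | DNode 'd 'd "'d dart_tree list"

primrec top_dart :: "'d dart_tree \<Rightarrow> 'd" where
  "top_dart (DLeaf d) = d"
| "top_dart (DNode d u ts) = d"

primrec tour :: "'d dart_tree \<Rightarrow> 'd list" where
  "tour (DLeaf d) = [d]"
| "tour (DNode d u ts) = d # concat (map tour ts) @ [u]"

lemma list_choice: "(\<forall>x\<in>set xs. \<exists>t. f t = x \<and> Q t) \<Longrightarrow> \<exists>ts. map f ts = xs \<and> (\<forall>t\<in>set ts. Q t)"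
proof (induction xs)
  case (Cons x xs)
  then obtain ts t where "map f ts = xs" "\<forall>t\<in>set ts. Q t" "f t = x" "Q t" by auto
  then show ?case by (intro exI[of _ "t # ts"]) auto
qed simp

text \<open>By injectivity a repetition can be moved back step by step until it involves the head,
  which does not recur.\<close>

lemma distinct_successively:
  assumes "successively (\<lambda>x y. y = f x) xs" "inj_on f (set xs)" "hd xs \<notin> set (tl xs)"
  shows "distinct xs"
proof -
  have "xs ! i \<noteq> xs ! j" if "i < j" "j < length xs" for i j
    using that
  proof (induction i arbitrary: j)
    case 0
    have "xs \<noteq> []" using 0 by auto
    moreover have "xs ! j = tl xs ! (j - 1)" using 0 by (cases xs) auto
    moreover have "tl xs ! (j - 1) \<in> set (tl xs)" using 0 by (intro nth_mem) auto
    ultimately show ?case using assms(3) by (auto simp: hd_conv_nth)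
  next
    case (Suc i)
    then obtain k where k: "j = Suc k" "i < k" by (cases j) auto
    have s: "xs ! Suc l = f (xs ! l)" if "Suc l < length xs" for l
      using assms(1) that by (simp add: successively_conv_nth)
    have "xs ! i \<noteq> xs ! k" using Suc k by auto
    then have "f (xs ! i) \<noteq> f (xs ! k)"
      using assms(2) Suc.prems k by (auto simp: inj_on_def)
    then show ?case using s[of i] s[of k] Suc.prems k by auto
  qed
  then show ?thesis unfolding distinct_conv_nth by (metis nat_neq_iff)
qed

lemma successively_funpow:
  assumes "successively (\<lambda>x y. y = f x) xs" "k < length xs"
  shows "xs ! k = (f ^^ k) (hd xs)"
  using assms(2)
proof (induction k)
  case 0
  then show ?case by (simp add: hd_conv_nth)
next
  case (Suc k)
  then show ?case using assms(1) by (simp add: successively_conv_nth)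
qed

section \<open>The walk around a tree and the unfolding of a map into dart trees\<close>

context bipartite_map begin

definition child_darts :: "'d \<Rightarrow> 'd list" where
  "child_darts u = map (\<lambda>k. (rot ^^ k) u) [1..<m]"

text \<open>As \<open>P\<close> holds the child end of each edge, \<open>u \<in> P\<close> says that
  the edge is crossed downwards; a dart is a leaf if neither end of its edge belongs to
  \<open>P\<close>.\<close>

fun fits :: "'d set \<Rightarrow> 'd dart_tree \<Rightarrow> bool" where
  "fits P (DLeaf d) \<longleftrightarrow> d \<in> D \<and> d \<notin> P \<and> opp d \<notin> P"
| "fits P (DNode d u ts) \<longleftrightarrow> u \<in> P \<and> d = opp u \<and> map top_dart ts = child_darts u \<and> (\<forall>t\<in>set ts. fits P t)"

text \<open>
  The walk around the tree with edge set \<open>T\<close>: edges in \<open>T\<close> are crossed, all others are cut.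
\<close>

definition turn :: "'d set \<Rightarrow> 'd \<Rightarrow> 'd" where
  "turn T d = rot (if d \<in> T then opp d else d)"

text \<open>The walk starts at the dart just after the root corner. In a spanning tree this dart is
  cut, because \<open>r\<close> is the only tree dart at the root vertex, and it represents the root
  leaf.\<close>

definition visit :: "'d set \<Rightarrow> nat \<Rightarrow> 'd" where
  "visit T k = (turn T ^^ k) (rot r)"

lemma visit_Suc: "visit T (Suc k) = turn T (visit T k)"
  by (simp add: visit_def)

lemma visit_0 [simp]: "visit T 0 = rot r"
  by (simp add: visit_def)

lemma child_darts_neq: "child_darts u \<noteq> []"
  using m_ge by (simp add: child_darts_def)

lemma hd_child_darts: "hd (child_darts u) = rot u"
  using m_ge by (simp add: child_darts_def hd_map hd_upt)

lemma rot_last_child_darts: "u \<in> D \<Longrightarrow> rot (last (child_darts u)) = u"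
proof -
  assume "u \<in> D"
  then have "rot ((rot ^^ (m - 1)) u) = u" using rot_m[of u] m_ge by (cases m) auto
  then show ?thesis using m_ge by (simp add: child_darts_def last_map last_upt)
qed

lemma successively_child_darts: "successively (\<lambda>x y. y = rot x) (child_darts u)"
  by (auto simp: child_darts_def successively_conv_nth)

lemma set_child_darts: "u \<in> D \<Longrightarrow> set (child_darts u) = V u - {u}"
proof -
  assume u: "u \<in> D"
  have "V u = insert u ((\<lambda>k. (rot ^^ k) u) ` {1..<m})"
  proof -
    have "{..<m} = insert 0 {1..<m}" using m_ge by auto
    then show ?thesis unfolding V_altdef[OF u] by simp
  qed
  moreover have "u \<notin> (\<lambda>k. (rot ^^ k) u) ` {1..<m}"
  proof
    assume "u \<in> (\<lambda>k. (rot ^^ k) u) ` {1..<m}"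
    then obtain k where "u = (rot ^^ k) u" "k \<in> {1..<m}" by (rule imageE)
    then show False using rot_less[OF u, of k] by simp
  qed
  moreover have "set (child_darts u) = (\<lambda>k. (rot ^^ k) u) ` {1..<m}" by (simp add: child_darts_def)
  ultimately show ?thesis by (simp only:) blast
qed

lemma child_darts_D: "u \<in> D \<Longrightarrow> set (child_darts u) \<subseteq> D"
  using set_child_darts V_D by blast

lemma fits_exists:
  assumes P: "arborescence P h" and u: "u \<in> D" "u \<in> P \<or> u = rot r"
  shows "\<exists>ts. map top_dart ts = child_darts u \<and> (\<forall>t\<in>set ts. fits P t)"
  using u
\<comment> \<open>Children have larger \<open>h\<close> than their parent, so the distance to the
  maximum decreases. For the root vertex the cut dart \<open>rot r\<close> stands in for the missing
  parent dart.\<close>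
proof (induction "Max (h ` V ` D) - h (V u)" arbitrary: u rule: less_induct)
  case less
  have fin: "finite (h ` V ` D)" using finite_D by simp
  have PD: "P \<subseteq> D" using P by (simp add: arborescence_def)
  have "\<exists>t. top_dart t = d \<and> fits P t" if d: "d \<in> set (child_darts u)" for d
  proof -
    have dV: "d \<in> V u" "d \<noteq> u" "d \<in> D"
      using d set_child_darts[OF less.prems(1)] child_darts_D[OF less.prems(1)] by auto
    then have Vd: "V d = V u" by (simp add: in_V_iff)
    have "d \<notin> P"
    proof
      assume dP: "d \<in> P"
      then have "V d \<noteq> V r" using P self_V unfolding arborescence_def by blast
      then have "u \<in> P" using less.prems(2) Vd V_rot by metis
      then show False using arborescence_unique[OF P dP] Vd dV by blast
    qed
    show ?thesis
    proof (cases "opp d \<in> P")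
      case False
      then show ?thesis using \<open>d \<notin> P\<close> dV by (intro exI[of _ "DLeaf d"]) simp
    next
      case True
      have "h (V (opp (opp d))) < h (V (opp d))" using P True by (simp add: arborescence_def)
      then have "h (V u) < h (V (opp d))" using Vd dV opp_opp by simp
      moreover have "h (V (opp d)) \<le> Max (h ` V ` D)" using fin True PD by (intro Max_ge) auto
      ultimately obtain ts where "map top_dart ts = child_darts (opp d)" "\<forall>t\<in>set ts. fits P t"
        using less.hyps[of "opp d"] True PD diff_less_mono2[of "h (V u)" "h (V (opp d))" "Max (h ` V ` D)"]
        by (meson order.strict_trans2 subsetD)
      then show ?thesis using True dV opp_opp by (intro exI[of _ "DNode d (opp d) ts"]) simp
    qed
  qed
  then show ?case using list_choice[of "child_darts u" top_dart "fits P"] by blast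
qed

definition chain :: "'d set \<Rightarrow> 'd list \<Rightarrow> 'd \<Rightarrow> 'd \<Rightarrow> bool" where
  "chain T xs a b \<longleftrightarrow> successively (\<lambda>x y. y = turn T x) xs \<and> xs \<noteq> [] \<and> hd xs = a \<and> turn T (last xs) = b"

lemma chain_concat:
  assumes "successively (\<lambda>x y. y = rot x) (map top_dart ts)" "ts \<noteq> []"
    "\<And>t. t \<in> set ts \<Longrightarrow> chain T (tour t) (top_dart t) (rot (top_dart t))"
  shows "chain T (concat (map tour ts)) (top_dart (hd ts)) (rot (top_dart (last ts)))"
  using assms
proof (induction ts)
  case (Cons t ts)
  show ?case
  proof (cases "ts = []")
    case True
    then show ?thesis using Cons.prems by simp
  next
    case False
    then have "chain T (concat (map tour ts)) (top_dart (hd ts)) (rot (top_dart (last ts)))"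
      using Cons by (auto simp: successively_Cons)
    moreover have "chain T (tour t) (top_dart t) (rot (top_dart t))" using Cons.prems by simp
    moreover have "top_dart (hd ts) = rot (top_dart t)"
      using Cons.prems False by (simp add: successively_Cons hd_map)
    ultimately show ?thesis using False
      by (auto simp: chain_def successively_append_iff)
  qed
qed simp

text \<open>The walk enters a subtree at its top dart, runs through it in the order of
  \<open>tour\<close>, and leaves towards the next dart around the parent, whether the top edge is
  cut or crossed.\<close>

lemma chain_fits:
  assumes "fits P t" "P \<subseteq> D" "T = P \<union> opp ` P"
  shows "chain T (tour t) (top_dart t) (rot (top_dart t))"
  using assms
proof (induction t)
  case (DLeaf d)
  then have "d \<notin> T" using opp_opp by auto
  then show ?case by (simp add: chain_def turn_def)
next
  case (DNode d u ts)
  have u: "u \<in> P" "d = opp u" "u \<in> D" and ts: "map top_dart ts = child_darts u" "\<forall>t\<in>set ts. fits P t"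
    using DNode.prems by auto
  have ne: "ts \<noteq> []" using ts(1) child_darts_neq[of u] by auto
  have "chain T (concat (map tour ts)) (top_dart (hd ts)) (rot (top_dart (last ts)))"
    using DNode ts ne by (intro chain_concat) (auto simp: successively_child_darts)
  moreover have "top_dart (hd ts) = rot u" "rot (top_dart (last ts)) = u"
    using hd_map[OF ne, of top_dart] last_map[OF ne, of top_dart] ts(1) hd_child_darts[of u]
      rot_last_child_darts[OF u(3)] by simp_all
  moreover have "turn T d = rot u" "turn T u = rot d"
    using u DNode.prems(3) opp_opp by (auto simp: turn_def)
  ultimately show ?case
    by (auto simp: chain_def successively_Cons successively_append_iff)
qed

lemma turn_inj:
  assumes "T \<subseteq> D" "\<And>d. d \<in> T \<Longrightarrow> opp d \<in> T"
  shows "inj_on (turn T) D"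
proof (rule inj_onI)
  fix d e assume de: "d \<in> D" "e \<in> D" and eq: "turn T d = turn T e"
  have *: "(if d \<in> T then opp d else d) = (if e \<in> T then opp e else e)"
    using rot_inj[OF eq[unfolded turn_def]] .
  show "d = e"
  proof (cases "d \<in> T \<longleftrightarrow> e \<in> T")
    case True
    then show ?thesis using * opp_inj by (metis (full_types))
  next
    case False
    then show ?thesis using * assms(2)[of d] assms(2)[of e] by metis
  qed
qed

text \<open>The walk does not meet its starting dart again, as \<open>distinct_successively\<close>
  requires: the darts of \<open>child_darts u\<close> lie at vertices other than the root
  vertex.\<close>

lemma fits_avoids_root:
  assumes "fits P t" "P \<subseteq> D" "V r \<inter> P = {}" "V r \<inter> (P \<union> opp ` P) = {r}" "top_dart t \<noteq> rot r"
  shows "rot r \<notin> set (tour t) \<and> set (tour t) \<subseteq> D"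
  using assms
proof (induction t)
  case (DLeaf d)
  have "d \<in> D" "rot r \<noteq> d" using DLeaf.prems(1,5) by auto
  then show ?case by simp
next
  case (DNode d u ts)
  have ru: "rot r \<in> V r" "rot r \<noteq> r" using rot_less[OF r_D, of 1] m_ge by (auto simp: in_V_iff V_rot)
  have u: "u \<in> P" "u \<in> D" "d = opp u" "d \<in> D" using DNode.prems opp_D by auto
  have Vu: "V u \<noteq> V r" using u DNode.prems(3) self_V by blast
  have "rot r \<notin> set (tour t) \<and> set (tour t) \<subseteq> D" if t: "t \<in> set ts" for t
  proof (rule DNode.IH[OF t])
    have "top_dart t \<in> set (child_darts u)" using DNode.prems(1) t by (metis fits.simps(2) imageI set_map)
    then have "top_dart t \<in> V u" using set_child_darts[OF u(2)] by blast
    then show "top_dart t \<noteq> rot r" using Vu ru by (auto simp: in_V_iff)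
  qed (use DNode.prems t in auto)
  moreover have "rot r \<noteq> d" using DNode.prems(5) by auto
  moreover have "rot r \<noteq> u" using u DNode.prems(3) ru by blast
  ultimately show ?case using u by auto
qed

lemma fits_tree_closed:
  assumes "fits P t" "P \<subseteq> D" "x \<in> set (tour t)" "x \<in> P \<union> opp ` P"
  shows "opp x \<in> set (tour t)"
  using assms
proof (induction t)
  case (DLeaf d)
  then show ?case using opp_opp by auto
next
  case (DNode d u ts)
  have u: "u \<in> D" "d = opp u" using DNode.prems by auto
  consider "x = d" | "x = u" | t where "t \<in> set ts" "x \<in> set (tour t)" using DNode.prems(3) by auto
  then show ?case
  proof cases
    case 3
    then have "opp x \<in> set (tour t)" using DNode by auto
    then show ?thesis using 3 by auto
  qed (use u opp_opp in auto)
qed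

text \<open>A subtree occupies a contiguous factor of the tour; this is what makes the time interval
  in \<open>segment\<close> possible.\<close>

lemma fits_find:
  assumes "fits P t" "u \<in> P" "u \<in> set (tour t)" "\<And>p. p \<in> P \<Longrightarrow> opp p \<notin> P"
  shows "\<exists>us pre post. tour t = pre @ tour (DNode (opp u) u us) @ post \<and> fits P (DNode (opp u) u us)"
  using assms
proof (induction t)
  case (DLeaf d)
  then show ?case by auto
next
  case (DNode d v ts)
  show ?case
  proof (cases "u = v")
    case True
    then show ?thesis using DNode.prems by (intro exI[of _ ts] exI[of _ "[]"]) auto
  next
    case False
    moreover have "u \<noteq> d" using DNode.prems by auto
    ultimately obtain t where t: "t \<in> set ts" "u \<in> set (tour t)" using DNode.prems(3) by auto
    then obtain us pre post where *: "tour t = pre @ tour (DNode (opp u) u us) @ post" "fits P (DNode (opp u) u us)"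
      using DNode.IH[OF t(1)] DNode.prems by auto
    obtain ts1 ts2 where "ts = ts1 @ t # ts2" using t(1) by (auto dest: split_list)
    then have "tour (DNode d v ts) = (d # concat (map tour ts1) @ pre) @ tour (DNode (opp u) u us) @ (post @ concat (map tour ts2) @ [v])"
      using *(1) by simp
    then show ?thesis using *(2) by blast
  qed
qed

end

locale spanned_map = bipartite_map D rot opp m W r K
  for D :: "'d set" and rot opp m W r K +
  fixes T P :: "'d set" and h
  assumes spanning: "spanning T" and arborescence: "arborescence P h" and T_eq: "T = P \<union> opp ` P"
begin

lemma P_D: "P \<subseteq> D" using arborescence by (simp add: arborescence_def)

lemma T_D: "T \<subseteq> D" using spanning by (simp add: spanning_def)

lemma opp_T: "d \<in> T \<Longrightarrow> opp d \<in> T" using spanning by (simp add: spanning_def)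

lemma opp_T_iff: "d \<in> D \<Longrightarrow> opp d \<in> T \<longleftrightarrow> d \<in> T" using opp_T opp_opp by metis

lemma T_cases: "d \<in> T \<Longrightarrow> d \<in> P \<or> opp d \<in> P"
  using T_eq opp_opp P_D by auto

lemma root_T: "V r \<inter> T = {r}" using spanning by (simp add: spanning_def)

lemma root_P: "V r \<inter> P = {}" using arborescence by (simp add: arborescence_def)

lemma rot_r_notin_T: "rot r \<notin> T"
proof -
  have "rot r \<in> V r" "rot r \<noteq> r" using rot_less[OF r_D, of 1] m_ge by (auto simp: in_V_iff V_rot)
  then show ?thesis using root_T by blast
qed

text \<open>The subtrees are listed from the dart after \<open>rot r\<close> round to
  \<open>r\<close>, so the tree edge at the root vertex comes last. It becomes the rightmost child
  of the root node.\<close>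

definition rooted_at :: "'d dart_tree list \<Rightarrow> bool" where
  "rooted_at ts \<longleftrightarrow> map top_dart ts = child_darts (rot r) \<and> (\<forall>t\<in>set ts. fits P t)"

definition root_tour :: "'d dart_tree list \<Rightarrow> 'd list" where
  "root_tour ts = rot r # concat (map tour ts)"

lemma rooted_at_exists: "\<exists>ts. rooted_at ts"
  unfolding rooted_at_def using fits_exists[OF arborescence] rot_D[OF r_D] by blast

context
  fixes ts assumes ts: "rooted_at ts"
begin

lemma chain_root_tour: "chain T (root_tour ts) (rot r) (rot r)"
proof -
  have tops: "map top_dart ts = child_darts (rot r)" and fits: "\<forall>t\<in>set ts. fits P t"
    using ts by (auto simp: rooted_at_def)
  have ne: "ts \<noteq> []" using tops child_darts_neq[of "rot r"] by auto
  have "chain T (concat (map tour ts)) (top_dart (hd ts)) (rot (top_dart (last ts)))"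
    using ne tops fits chain_fits[OF _ P_D T_eq] by (intro chain_concat) (auto simp: successively_child_darts)
  moreover have "top_dart (hd ts) = rot (rot r)" "rot (top_dart (last ts)) = rot r"
    using hd_map[OF ne, of top_dart] last_map[OF ne, of top_dart] tops hd_child_darts[of "rot r"]
      rot_last_child_darts[OF rot_D[OF r_D]] by simp_all
  moreover have "turn T (rot r) = rot (rot r)" using rot_r_notin_T by (simp add: turn_def)
  ultimately show ?thesis by (auto simp: chain_def root_tour_def successively_Cons)
qed

lemma root_tour_subset: "set (root_tour ts) \<subseteq> D" and root_notin: "rot r \<notin> set (concat (map tour ts))"
proof -
  have "rot r \<notin> set (tour t) \<and> set (tour t) \<subseteq> D" if t: "t \<in> set ts" for t
  proof (rule fits_avoids_root)
    have "top_dart t \<in> set (child_darts (rot r))" using t ts by (metis rooted_at_def imageI set_map)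
    then show "top_dart t \<noteq> rot r" using set_child_darts[OF rot_D[OF r_D]] by blast
  qed (use t ts P_D root_P root_T T_eq in \<open>auto simp: rooted_at_def\<close>)
  then show "set (root_tour ts) \<subseteq> D" "rot r \<notin> set (concat (map tour ts))"
    using rot_D[OF r_D] by (auto simp: root_tour_def)
qed

lemma distinct_root_tour: "distinct (root_tour ts)"
proof (rule distinct_successively)
  show "successively (\<lambda>x y. y = turn T x) (root_tour ts)" using chain_root_tour by (simp add: chain_def)
  show "inj_on (turn T) (set (root_tour ts))"
    using turn_inj[OF T_D opp_T] root_tour_subset inj_on_subset by blast
  show "hd (root_tour ts) \<notin> set (tl (root_tour ts))" using root_notin by (simp add: root_tour_def)
qed

lemma turn_root_tour: "x \<in> set (root_tour ts) \<Longrightarrow> turn T x \<in> set (root_tour ts)"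
proof -
  let ?L = "root_tour ts"
  assume "x \<in> set ?L"
  then obtain k where k: "k < length ?L" "?L ! k = x" by (auto simp: in_set_conv_nth)
  show ?thesis
  proof (cases "Suc k < length ?L")
    case True
    then have "turn T x = ?L ! Suc k" using chain_root_tour k by (auto simp: chain_def successively_conv_nth)
    then show ?thesis using nth_mem[OF True] by simp
  next
    case False
    then have "k = length ?L - 1" using k by simp
    moreover have "last ?L = ?L ! (length ?L - 1)" by (rule last_conv_nth) (simp add: root_tour_def)
    ultimately have "x = last ?L" using k(2) by metis
    then show ?thesis using chain_root_tour by (auto simp: chain_def root_tour_def)
  qed
qed

lemma opp_root_tour: "x \<in> set (root_tour ts) \<Longrightarrow> x \<in> T \<Longrightarrow> opp x \<in> set (root_tour ts)"
proof -
  assume x: "x \<in> set (root_tour ts)" "x \<in> T"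
  then have "x \<noteq> rot r" using rot_r_notin_T by blast
  then obtain t where t: "t \<in> set ts" "x \<in> set (tour t)" using x by (auto simp: root_tour_def)
  have "opp x \<in> set (tour t)"
    using fits_tree_closed[OF _ P_D t(2)] x(2) t(1) ts T_eq by (simp add: rooted_at_def)
  then show ?thesis using t(1) by (auto simp: root_tour_def)
qed

lemma rot_root_tour: "x \<in> set (root_tour ts) \<Longrightarrow> rot x \<in> set (root_tour ts)"
proof (cases "x \<in> T")
  case True
  assume "x \<in> set (root_tour ts)"
  then have "turn T (opp x) \<in> set (root_tour ts)" using opp_root_tour turn_root_tour True by blast
  then show ?thesis using True opp_T opp_opp T_D by (auto simp: turn_def)
next
  case False
  assume "x \<in> set (root_tour ts)"
  then show ?thesis using turn_root_tour[of x] False by (simp add: turn_def)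
qed

text \<open>The tour is closed under \<open>turn T\<close> and, on tree darts, under
  \<open>opp\<close>, hence under \<open>rot\<close>. With one dart it contains the whole vertex,
  and it spreads from the root to every vertex through the parent edges.\<close>

lemma set_root_tour: "set (root_tour ts) = D"
proof
  show "set (root_tour ts) \<subseteq> D" by (rule root_tour_subset)
  have cl: "V x \<subseteq> set (root_tour ts)" if "x \<in> set (root_tour ts)" for x
    using that rot_root_tour by (intro V_subset) auto
  show "D \<subseteq> set (root_tour ts)"
  proof
    fix d assume "d \<in> D"
    then show "d \<in> set (root_tour ts)"
    proof (induction "h (V d)" arbitrary: d rule: less_induct)
      case less
      show ?case
      proof (cases "V d = V r")
        case True
        have "rot r \<in> set (root_tour ts)" by (simp add: root_tour_def)
        then show ?thesis using cl[of "rot r"] True self_V V_rot by blast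
      next
        case False
        then obtain p where p: "p \<in> P" "p \<in> V d" using arborescence_parent[OF arborescence less.prems] by blast
        then have Vp: "V p = V d" by (simp add: in_V_iff)
        have "h (V (opp p)) < h (V p)" using arborescence p by (simp add: arborescence_def)
        moreover have "opp p \<in> D" using p P_D opp_D by blast
        ultimately have "opp p \<in> set (root_tour ts)" using less.hyps Vp by simp
        moreover have "opp p \<in> T" using p T_eq by blast
        ultimately have "opp (opp p) \<in> set (root_tour ts)" by (rule opp_root_tour)
        then have "p \<in> set (root_tour ts)" using opp_opp p P_D by auto
        then show ?thesis using cl[of p] Vp self_V by blast
      qed
    qed
  qed
qed

lemma length_root_tour: "length (root_tour ts) = card D"
  using distinct_card[OF distinct_root_tour] set_root_tour by simp

lemma nth_root_tour: "k < card D \<Longrightarrow> root_tour ts ! k = visit T k"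
  using successively_funpow[of "turn T" "root_tour ts" k] chain_root_tour length_root_tour
  by (simp add: chain_def visit_def)

end

lemma bij_visit: "bij_betw (visit T) {..<card D} D"
proof -
  obtain ts where ts: "rooted_at ts" using rooted_at_exists by blast
  have "bij_betw ((!) (root_tour ts)) {..<length (root_tour ts)} (set (root_tour ts))"
    using bij_betw_nth[OF distinct_root_tour[OF ts]] by simp
  then show ?thesis
    unfolding length_root_tour[OF ts] set_root_tour[OF ts]
    using bij_betw_cong[of "{..<card D}" "(!) (root_tour ts)" "visit T"] nth_root_tour[OF ts] by simp
qed

text \<open>The darts visited after \<open>opp u\<close> up to \<open>u\<close> are those of the
  vertices in the subtree below \<open>u\<close>. The two closure properties express this: the set
  is a union of vertices, and the edge of \<open>u\<close> is the only tree edge leaving it.\<close>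

lemma segment:
  assumes u: "u \<in> P"
  shows "\<exists>i j. i < j \<and> j < card D \<and> visit T i = opp u \<and> visit T j = u \<and>
    (\<forall>x\<in>visit T ` {i<..j}. rot x \<in> visit T ` {i<..j}) \<and>
    (\<forall>x\<in>visit T ` {i<..j}. x \<in> T \<longrightarrow> x \<noteq> u \<longrightarrow> opp x \<in> visit T ` {i<..j})"
proof -
  obtain ts where ts: "rooted_at ts" using rooted_at_exists by blast
  let ?L = "root_tour ts"
  have uD: "u \<in> D" using u P_D by blast
  have "u \<in> set ?L" using set_root_tour[OF ts] uD by blast
  moreover have "u \<noteq> rot r" using rot_r_notin_T u T_eq by blast
  ultimately obtain t where t: "t \<in> set ts" "u \<in> set (tour t)" by (auto simp: root_tour_def)
  obtain us pre post where *: "tour t = pre @ tour (DNode (opp u) u us) @ post" "fits P (DNode (opp u) u us)"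
    using fits_find[OF _ u t(2)] ts t(1) arborescence_opp[OF arborescence] by (auto simp: rooted_at_def)
  obtain ts1 ts2 where "ts = ts1 @ t # ts2" using t(1) by (auto dest: split_list)
  then obtain A B where L: "?L = A @ tour (DNode (opp u) u us) @ B"
    using *(1) by (simp add: root_tour_def)
      (metis append.assoc append_Cons)
  define i where "i = length A"
  define C where "C = concat (map tour us) @ [u]"
  define j where "j = i + length C"
  have L': "?L = A @ (opp u # C) @ B" using L by (simp add: C_def)
  have len: "length ?L = i + Suc (length C) + length B" by (simp add: L' i_def)
  have jL: "i < j" "j < card D" using len length_root_tour[OF ts] by (auto simp: j_def C_def)
  have vi: "visit T i = opp u" using nth_root_tour[OF ts, of i] jL by (simp add: L' i_def)
  have vC: "visit T (Suc i + k) = C ! k" if "k < length C" for k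
  proof -
    have "Suc i + k < card D" using that jL by (simp add: j_def)
    then have "visit T (Suc i + k) = ?L ! (Suc i + k)" using nth_root_tour[OF ts] by simp
    also have "\<dots> = C ! k" using that by (simp add: L' i_def nth_append)
    finally show ?thesis .
  qed
  have S: "visit T ` {i<..j} = set C"
  proof -
    have "{i<..j} = (\<lambda>k. Suc i + k) ` {..<length C}"
    proof (intro equalityI subsetI)
      fix x assume "x \<in> {i<..j}"
      then show "x \<in> (\<lambda>k. Suc i + k) ` {..<length C}"
        by (intro image_eqI[of _ _ "x - Suc i"]) (auto simp: j_def)
    qed (auto simp: j_def)
    then have "visit T ` {i<..j} = (\<lambda>k. C ! k) ` {..<length C}"
      using vC by (auto simp: image_image)
    then show ?thesis by (auto simp: set_conv_nth)
  qed
  have vj: "visit T j = u"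
    using vC[of "length C - 1"] by (simp add: C_def j_def nth_append)
  have usf: "map top_dart us = child_darts u" "\<forall>t\<in>set us. fits P t" using *(2) by auto
  have opc: "opp x \<in> set C" if "x \<in> set C" "x \<in> T" "x \<noteq> u" for x
    using that fits_tree_closed[OF _ P_D] usf(2) T_eq by (auto simp: C_def)
  have uT: "u \<in> T" "opp u \<in> T" using u T_eq by auto
  have dC: "opp u \<notin> set C" using distinct_root_tour[OF ts] by (auto simp: L')
  have nxt: "turn T x \<in> set C" if "x \<in> set C" "x \<noteq> u" for x
  proof -
    obtain k where k: "k < length C" "C ! k = x" using \<open>x \<in> set C\<close> by (auto simp: in_set_conv_nth)
    have "Suc k \<noteq> length C" using k \<open>x \<noteq> u\<close> by (auto simp: C_def nth_append)
    then have "Suc k < length C" using k by simp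
    then have "C ! Suc k = turn T (C ! k)" using vC[of k] vC[of "Suc k"] k visit_Suc[of T "Suc i + k"] by simp
    then show ?thesis using \<open>Suc k < length C\<close> k by (metis nth_mem)
  qed
  have "rot x \<in> set C" if x: "x \<in> set C" for x
  proof (cases "x = u")
    case True
    have "C ! 0 = turn T (opp u)" using vC[of 0] vi visit_Suc[of T i] by (simp add: C_def)
    moreover have "turn T (opp u) = rot u" using uT opp_opp[OF uD] by (simp add: turn_def)
    ultimately show ?thesis using True by (metis C_def append_is_Nil_conv length_greater_0_conv not_Cons_self2 nth_mem)
  next
    case False
    show ?thesis
    proof (cases "x \<in> T")
      case True
      then have ox: "opp x \<in> set C" "opp x \<in> T" "x \<in> D" using opc x False opp_T T_D by auto
      have "opp x \<noteq> u" using dC x opp_opp ox(3) by metis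
      then have "turn T (opp x) \<in> set C" using nxt ox by blast
      then show ?thesis using ox opp_opp by (simp add: turn_def)
    next
      case xT: False
      then show ?thesis using nxt[OF x False] by (simp add: turn_def)
    qed
  qed
  then show ?thesis
    using jL vi vj opc unfolding S[symmetric] by blast
qed

end

section \<open>Uniqueness of the valid spanning tree\<close>

context spanned_map begin

text \<open>Each black vertex has exactly one parent dart. The right-hand side depends on
  \<open>S\<close> alone, so the count is the same for any two spanning trees; the same holds for
  the white vertices and their unique children in the next lemma.\<close>

lemma card_black_parents:
  assumes "S \<subseteq> D" "\<And>x. x \<in> S \<Longrightarrow> rot x \<in> S"
  shows "card {p \<in> P \<inter> S. p \<notin> W} = card (V ` (S - W))"
proof -
  have "V ` {p \<in> P \<inter> S. p \<notin> W} = V ` (S - W)"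
  proof (intro equalityI subsetI)
    fix v assume "v \<in> V ` (S - W)"
    then obtain d where d: "d \<in> S" "d \<notin> W" "v = V d" by blast
    then have dD: "d \<in> D" using assms(1) by blast
    have "V d \<noteq> V r" using W_V[OF dD, of r] d r_W by blast
    then obtain p where p: "p \<in> P" "p \<in> V d" using arborescence_parent[OF arborescence dD] by blast
    have "V d \<subseteq> S" using V_subset[of d S] d assms(2) by blast
    moreover have "V d \<subseteq> D - W" using V_notW d dD by blast
    ultimately have "p \<in> {p \<in> P \<inter> S. p \<notin> W}" using p by blast
    moreover have "V p = v" using p d by (simp add: in_V_iff)
    ultimately show "v \<in> V ` {p \<in> P \<inter> S. p \<notin> W}" by blast
  qed auto
  moreover have "inj_on V {p \<in> P \<inter> S. p \<notin> W}"
    using arborescence_unique[OF arborescence] by (auto simp: inj_on_def)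
  ultimately show ?thesis using card_image by metis
qed

lemma card_white_children:
  assumes "S \<subseteq> D" "\<And>x. x \<in> S \<Longrightarrow> rot x \<in> S"
  shows "card {d \<in> S \<inter> W. opp d \<in> P} = card (V ` (S \<inter> W))"
proof -
  have child: "\<exists>!e. e \<in> V d \<and> opp e \<in> P" if "d \<in> W" for d
    using spanning_white_child[OF spanning arborescence T_eq that] .
  have "V ` {d \<in> S \<inter> W. opp d \<in> P} = V ` (S \<inter> W)"
  proof (intro equalityI subsetI)
    fix v assume "v \<in> V ` (S \<inter> W)"
    then obtain d where d: "d \<in> S" "d \<in> W" "v = V d" by blast
    then obtain e where e: "e \<in> V d" "opp e \<in> P" using child by blast
    have "V d \<subseteq> S" using V_subset[of d S] d assms(2) by blast
    then have "e \<in> {d \<in> S \<inter> W. opp d \<in> P}" using e V_W[OF d(2)] by blast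
    moreover have "V e = v" using e d by (simp add: in_V_iff)
    ultimately show "v \<in> V ` {d \<in> S \<inter> W. opp d \<in> P}" by blast
  qed auto
  moreover have "inj_on V {d \<in> S \<inter> W. opp d \<in> P}"
  proof (rule inj_onI)
    fix d e assume "d \<in> {d \<in> S \<inter> W. opp d \<in> P}" "e \<in> {d \<in> S \<inter> W. opp d \<in> P}" "V d = V e"
    then show "d = e" using child[of d] self_V[of d] self_V[of e] by auto
  qed
  ultimately show ?thesis using card_image by metis
qed

lemma visit_inj: "i < card D \<Longrightarrow> j < card D \<Longrightarrow> visit T i = visit T j \<Longrightarrow> i = j"
  using bij_visit by (auto simp: bij_betw_def inj_on_def)

lemma visit_in_D: "i < card D \<Longrightarrow> visit T i \<in> D"
  using bij_visit by (auto simp: bij_betw_def)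

lemma visit_surj: "d \<in> D \<Longrightarrow> \<exists>i<card D. visit T i = d"
  using bij_betw_imp_surj_on[OF bij_visit] by (metis imageE lessThan_iff)

lemma notin_K: "d \<in> T \<Longrightarrow> d \<notin> K"
  using spanning by (auto simp: spanning_def)

end

context bipartite_map begin

definition valid :: "'d set \<Rightarrow> bool" where
  "valid T \<longleftrightarrow> (\<forall>d\<in>W. d \<notin> T \<longrightarrow> d \<notin> K \<longrightarrow>
     (\<exists>i j. i < j \<and> j < card D \<and> visit T i = d \<and> visit T j = opp d))"

lemma spanned_mapI:
  assumes "spanning T" obtains P h where "spanned_map D rot opp m W r K T P h"
proof -
  obtain P h where "arborescence P h" "T = P \<union> opp ` P" using spanning_arborescence[OF assms] by blast
  then have "spanned_map D rot opp m W r K T P h" by unfold_locales (use assms in auto)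
  then show ?thesis by (rule that)
qed

lemma visit_agree:
  "(\<And>j. j < k \<Longrightarrow> visit T j \<in> T \<longleftrightarrow> visit T j \<in> T') \<Longrightarrow> visit T' k = visit T k"
proof (induction k)
  case (Suc k)
  then have "visit T' k = visit T k" by simp
  then show ?case using Suc.prems[of k] by (simp add: visit_Suc turn_def)
qed simp

text \<open>Only the case that \<open>T\<close> crosses where \<open>T'\<close> would cut is
  excluded here; exchanging the two trees excludes the other one.\<close>

lemma first_difference:
  assumes sp: "spanned_map D rot opp m W r K T P h" "spanned_map D rot opp m W r K T' P' h'"
    and valid: "valid T" "valid T'" and k: "k < card D"
    and agree: "\<And>j. j < k \<Longrightarrow> visit T j \<in> T \<longleftrightarrow> visit T j \<in> T'"
    and dT: "visit T k \<in> T"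
  shows "visit T k \<in> T'"
proof (rule ccontr)
  interpret A: spanned_map D rot opp m W r K T P h by (rule sp(1))
  interpret B: spanned_map D rot opp m W r K T' P' h' by (rule sp(2))
  define d where "d = visit T k"
  assume "visit T k \<notin> T'"
  then have dT': "d \<notin> T'" by (simp add: d_def)
  have dD: "d \<in> D" using A.visit_in_D[OF k] by (simp add: d_def)
  have same: "visit T' j = visit T j" if "j \<le> k" for j
    using visit_agree[of j T T'] agree that by simp
  have dT: "d \<in> T" using dT by (simp add: d_def)
  then consider "d \<in> P" | "opp d \<in> P" using A.T_cases by blast
  then show False
  proof cases
    case 1
    \<comment> \<open>The walk is returning to the parent: the other end of the edge was visited
      earlier and crossed, by both trees.\<close>
    from A.segment[OF this] obtain i j where ij: "i < j" "j < card D" "visit T i = opp d" "visit T j = d" by blast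
    then have "j = k" using A.visit_inj k by (simp add: d_def)
    then have "opp d \<in> T'" using agree[of i] ij A.opp_T[OF dT] by simp
    then show False using B.opp_T[of "opp d"] opp_opp[OF dD] dT' by simp
  next
    case 2
    define u where "u = opp d"
    have u: "u \<in> P" "opp u = d" "u \<in> D" using 2 opp_opp dD opp_D by (auto simp: u_def)
    from A.segment[OF u(1)] obtain i j where ij: "i < j" "j < card D" "visit T i = opp u" "visit T j = u"
      and rotS: "\<forall>x\<in>visit T ` {i<..j}. rot x \<in> visit T ` {i<..j}"
      and oppS: "\<forall>x\<in>visit T ` {i<..j}. x \<in> T \<longrightarrow> x \<noteq> u \<longrightarrow> opp x \<in> visit T ` {i<..j}" by blast
    have ik: "i = k" using A.visit_inj[of i k] ij k u by (simp add: d_def)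
    have uT': "u \<notin> T'" using B.opp_T[of u] u dT' by auto
    have uT: "u \<in> T" using u A.T_eq by blast
    show False
    proof (cases "d \<in> W")
      case False
      \<comment> \<open>From a black dart \<open>d\<close>: the tree \<open>T'\<close> cuts this
        edge, so validity wants the white end \<open>u\<close> visited before \<open>d\<close>; but
        up to \<open>d\<close> the walks agree, and \<open>T\<close> meets \<open>u\<close> only
        later.\<close>
      then have "u \<in> W" using opp_W[OF dD] by (simp add: u_def)
      moreover have "u \<notin> K" by (rule A.notin_K[OF uT])
      ultimately obtain i' j' where ij': "i' < j'" "j' < card D" "visit T' i' = u" "visit T' j' = opp u"
        using valid(2) uT' unfolding valid_def by blast
      have "j' = k" using B.visit_inj[of j' k] ij' k u same[of k] by (simp add: d_def)
      then have "visit T i' = u" using same[of i'] ij' by simp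
      then have "i' = j" using A.visit_inj[of i' j] ij ij' by simp
      then show False using ij ik ij' \<open>j' = k\<close> by simp
    next
      case True
      define S where "S = visit T ` {i<..j}"
      have SD: "S \<subseteq> D" using A.visit_in_D ij by (auto simp: S_def)
      have rotS: "rot x \<in> S" if "x \<in> S" for x using that unfolding S_def by (rule rotS[rule_format])
      have oppS: "opp x \<in> S" if "x \<in> S" "x \<in> T" "x \<noteq> u" for x using that unfolding S_def by (rule oppS[rule_format])
      have uS: "u \<in> S" unfolding S_def using ij by force
      have dS: "d \<notin> S"
      proof
        assume "d \<in> S"
        then obtain l where "l \<in> {i<..j}" "visit T l = d" by (auto simp: S_def)
        then show False using A.visit_inj[of l k] ij k ik by (auto simp: d_def)
      qed
      have uW: "u \<notin> W" using opp_W[OF dD] True by (simp add: u_def)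
      let ?B = "{p \<in> P \<inter> S. p \<notin> W}" and ?C = "{e \<in> S \<inter> W. opp e \<in> P}"
      let ?B' = "{p \<in> P' \<inter> S. p \<notin> W}" and ?C' = "{e \<in> S \<inter> W. opp e \<in> P'}"
      have fin: "finite S" using SD finite_D finite_subset by blast
      \<comment> \<open>\<open>?C\<close> has one element for each white vertex of \<open>S\<close>
        and \<open>?B\<close> one for each black vertex. Every white vertex of \<open>S\<close> has
        its child inside \<open>S\<close>, and the top vertex of the subtree is a child of none of
        them, so black vertices outnumber white ones.\<close>
      have "opp ` ?C \<subseteq> ?B - {u}"
      proof
        fix x assume "x \<in> opp ` ?C"
        then obtain e where e: "x = opp e" "e \<in> S" "e \<in> W" "opp e \<in> P" by blast
        have eD: "e \<in> D" using e SD by blast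
        have "opp (opp e) \<in> opp ` P" using e by blast
        then have "e \<in> T" using A.T_eq opp_opp[OF eD] by auto
        moreover have "e \<noteq> u" using e uW by blast
        ultimately have "opp e \<in> S" using oppS e by blast
        moreover have "opp e \<notin> W" using opp_W[OF eD] e by blast
        moreover have "opp e \<noteq> u"
        proof
          assume "opp e = u"
          then have "e = d" using opp_inj by (simp add: u_def)
          then show False using e dS by blast
        qed
        ultimately show "x \<in> ?B - {u}" using e by blast
      qed
      then have "card ?C \<le> card (?B - {u})"
        using fin card_image[OF inj_opp, of ?C] card_mono[of "?B - {u}" "opp ` ?C"] by simp
      moreover have "card (?B - {u}) < card ?B"
        using u uS uW fin by (intro card_Diff1_less) auto
      moreover have "card ?B = card ?B'" "card ?C = card ?C'"
        using A.card_black_parents[OF SD rotS] B.card_black_parents[OF SD rotS]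
          A.card_white_children[OF SD rotS] B.card_white_children[OF SD rotS] by simp_all
      ultimately have less: "card ?C' < card ?B'" by simp
      \<comment> \<open>Otherwise every black vertex of \<open>S\<close> would be, in
        \<open>T'\<close>, the child of a white vertex of \<open>S\<close>, and there are too few of
        these since each has one child.\<close>
      have "\<exists>p\<in>?B'. opp p \<notin> S"
      proof (rule ccontr)
        assume *: "\<not> (\<exists>p\<in>?B'. opp p \<notin> S)"
        have "opp ` ?B' \<subseteq> ?C'"
        proof
          fix x assume "x \<in> opp ` ?B'"
          then obtain p where p: "x = opp p" "p \<in> P'" "p \<in> S" "p \<notin> W" by blast
          then have pD: "p \<in> D" using SD by blast
          have "opp p \<in> S" using * p by blast
          moreover have "opp p \<in> W" using opp_W[OF pD] p by blast
          moreover have "opp (opp p) \<in> P'" using opp_opp[OF pD] p by simp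
          ultimately show "x \<in> ?C'" using p by blast
        qed
        then have "card ?B' \<le> card ?C'"
          using fin card_image[OF inj_opp, of ?B'] card_mono[of ?C' "opp ` ?B'"] by simp
        then show False using less by simp
      qed
      then obtain p where p: "p \<in> P'" "p \<in> S" "p \<notin> W" "opp p \<notin> S" by blast
      have pD: "p \<in> D" using p SD by blast
      have pT': "p \<in> T'" "opp p \<in> T'" using p B.T_eq by auto
      have pT: "p \<notin> T"
      proof
        assume "p \<in> T"
        then have "p = u" using oppS p by blast
        then show False using pT' uT' by blast
      qed
      have "opp p \<notin> T" using A.opp_T[of "opp p"] opp_opp[OF pD] pT by auto
      moreover have "opp p \<in> W" using opp_W[OF pD] p by blast
      moreover have "opp p \<notin> K" by (rule B.notin_K[OF pT'(2)])
      ultimately obtain i' j' where ij': "i' < j'" "j' < card D" "visit T i' = opp p" "visit T j' = p"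
        using valid(1) opp_opp[OF pD] unfolding valid_def by auto
      obtain l where l: "l \<in> {i<..j}" "visit T l = p" using p(2) by (auto simp: S_def)
      then have "j' = l" using A.visit_inj[of j' l] ij ij' by auto
      have "i' \<notin> {i<..j}" using p(4) unfolding ij'(3)[symmetric] S_def by blast
      \<comment> \<open>The white end \<open>opp p\<close> lies outside the segment but is visited
        before \<open>p\<close>, hence no later than the entry at \<open>k\<close>; strictly before
        \<open>k\<close> both trees decide alike.\<close>
      then have "i' \<le> k" using l \<open>j' = l\<close> ij' ik by auto
      moreover have "i' \<noteq> k" using ij'(3) dT \<open>opp p \<notin> T\<close> by (auto simp: d_def)
      ultimately have "opp p \<in> T \<longleftrightarrow> opp p \<in> T'" using agree[of i'] ij' by simp
      then show False using pT' \<open>opp p \<notin> T\<close> by blast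
    qed
  qed
qed

theorem valid_spanning_unique:
  assumes "spanning T" "valid T" "spanning T'" "valid T'"
  shows "T = T'"
proof -
  obtain P h where sp: "spanned_map D rot opp m W r K T P h" using spanned_mapI[OF assms(1)] .
  obtain P' h' where sp': "spanned_map D rot opp m W r K T' P' h'" using spanned_mapI[OF assms(3)] .
  interpret A: spanned_map D rot opp m W r K T P h by (rule sp)
  interpret B: spanned_map D rot opp m W r K T' P' h' by (rule sp')
  have agree: "visit T k \<in> T \<longleftrightarrow> visit T k \<in> T'" if "k < card D" for k
    using that
  proof (induction k rule: less_induct)
    case (less k)
    have ag: "visit T j \<in> T \<longleftrightarrow> visit T j \<in> T'" if "j < k" for j
      using less that by simp
    have same: "visit T' j = visit T j" if "j \<le> k" for j
      using visit_agree[of j T T'] ag that by simp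
    have ag': "visit T' j \<in> T' \<longleftrightarrow> visit T' j \<in> T" if "j < k" for j
      using ag[OF that] same[of j] that by simp
    show ?case
      using first_difference[OF sp sp' assms(2,4) less.prems ag]
        first_difference[OF sp' sp assms(4,2) less.prems ag'] same[of k] by auto
  qed
  have "d \<in> T \<longleftrightarrow> d \<in> T'" if "d \<in> D" for d
    using A.visit_surj[OF that] agree by auto
  then show ?thesis using A.T_D B.T_D by blast
qed

end

section \<open>Existence of a valid spanning tree by exchange of edges\<close>

context spanned_map begin

text \<open>Deleting the edge of \<open>u\<close> leaves two components, the subtree
  \<open>S\<close> and the rest. Climbing along parent edges stays on one side until it reaches the
  vertex of \<open>u\<close> or the root vertex.\<close>

lemma arborescence_path:
  assumes d: "d \<in> D"
    and closed: "\<And>x. x \<in> S \<Longrightarrow> rot x \<in> S" "\<And>x. x \<in> S \<Longrightarrow> x \<in> T \<Longrightarrow> x \<noteq> u \<Longrightarrow> opp x \<in> S"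
    and u: "u \<in> P" "u \<in> S" "opp u \<notin> S" and S: "S \<subseteq> D"
  shows "d \<in> S \<Longrightarrow> (V d, V u) \<in> (links (T - {u, opp u}))\<^sup>*"
    and "d \<notin> S \<Longrightarrow> (V d, V r) \<in> (links (T - {u, opp u}))\<^sup>*"
proof -
  have VS: "V x \<subseteq> S" if "x \<in> S" for x using V_subset[of x S] that closed(1) by blast
  have oppu: "opp u \<notin> P" using arborescence_opp[OF arborescence u(1)] .
  have rootS: "r \<notin> S"
  proof
    assume "r \<in> S"
    have *: "x \<in> S" if "x \<in> D" for x
      using that
    proof (induction "h (V x)" arbitrary: x rule: less_induct)
      case less
      show ?case
      proof (cases "V x = V r")
        case True
        then show ?thesis using VS[OF \<open>r \<in> S\<close>] self_V[of x] by auto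
      next
        case False
        then obtain p where p: "p \<in> P" "p \<in> V x" using arborescence_parent[OF arborescence less.prems] by blast
        have Vp: "V p = V x" using p by (simp add: in_V_iff)
        have pD: "p \<in> D" using p P_D by blast
        have "h (V (opp p)) < h (V p)" using arborescence p by (simp add: arborescence_def)
        then have "opp p \<in> S" using less.hyps[of "opp p"] opp_D[OF pD] Vp by simp
        moreover have "opp p \<in> T" using p T_eq by blast
        moreover have "opp p \<noteq> u" using arborescence_opp[OF arborescence p(1)] u(1) by auto
        ultimately have "opp (opp p) \<in> S" using closed(2) by blast
        then have "p \<in> S" using opp_opp[OF pD] by simp
        then show ?thesis using VS[of p] Vp self_V[of x] by auto
      qed
    qed
    then show False using u(3) opp_D u(1) P_D by blast
  qed
  have step: "(V x, V (opp p)) \<in> links (T - {u, opp u}) \<and> h (V (opp p)) < h (V x) \<and> opp p \<in> D"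
    if "p \<in> P" "p \<in> V x" "p \<noteq> u" for p x
  proof -
    have "p \<noteq> opp u" using that(1) oppu by auto
    then have "p \<in> T - {u, opp u}" using that T_eq by blast
    moreover have "V p = V x" using that by (simp add: in_V_iff)
    ultimately have "(V x, V (opp p)) \<in> links (T - {u, opp u})" by (auto simp: links_def)
    moreover have "h (V (opp p)) < h (V x)"
      using arborescence that(1) \<open>V p = V x\<close> by (auto simp: arborescence_def)
    moreover have "opp p \<in> D" using that P_D opp_D by blast
    ultimately show ?thesis by blast
  qed
  show "(V d, V u) \<in> (links (T - {u, opp u}))\<^sup>*" if "d \<in> S"
    using d that
  proof (induction "h (V d)" arbitrary: d rule: less_induct)
    case less
    show ?case
    proof (cases "V d = V u")
      case False
      have "V d \<noteq> V r" using VS[OF less.prems(2)] rootS self_V[of r] by auto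
      then obtain p where p: "p \<in> P" "p \<in> V d" using arborescence_parent[OF arborescence less.prems(1)] by blast
      have "p \<noteq> u" using False p(2) by (auto simp: in_V_iff)
      have "p \<in> S" using VS[OF less.prems(2)] p by blast
      then have "opp p \<in> S" using closed(2) \<open>p \<noteq> u\<close> p(1) T_eq by blast
      then have "(V (opp p), V u) \<in> (links (T - {u, opp u}))\<^sup>*"
        using less.hyps[of "opp p"] step[OF p \<open>p \<noteq> u\<close>] by blast
      then show ?thesis using step[OF p \<open>p \<noteq> u\<close>] by (meson converse_rtrancl_into_rtrancl)
    qed simp
  qed
  show "(V d, V r) \<in> (links (T - {u, opp u}))\<^sup>*" if "d \<notin> S"
    using d that
  proof (induction "h (V d)" arbitrary: d rule: less_induct)
    case less
    show ?case
    proof (cases "V d = V r")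
      case False
      then obtain p where p: "p \<in> P" "p \<in> V d" using arborescence_parent[OF arborescence less.prems(1)] by blast
      have pS: "p \<notin> S"
      proof
        assume "p \<in> S"
        then have "V p \<subseteq> S" by (rule VS)
        moreover have "V p = V d" using p by (simp add: in_V_iff)
        ultimately show False using less.prems(2) self_V[of d] by auto
      qed
      then have "p \<noteq> u" using u(2) by auto
      have pD: "p \<in> D" using p P_D by blast
      have "opp p \<notin> S"
      proof
        assume "opp p \<in> S"
        moreover have "opp p \<in> T" using p T_eq by blast
        moreover have "opp p \<noteq> u" using arborescence_opp[OF arborescence p(1)] u(1) by auto
        ultimately have "opp (opp p) \<in> S" using closed(2) by blast
        then show False using opp_opp[OF pD] pS by simp
      qed
      then have "(V (opp p), V r) \<in> (links (T - {u, opp u}))\<^sup>*"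
        using less.hyps[of "opp p"] step[OF p \<open>p \<noteq> u\<close>] by blast
      then show ?thesis using step[OF p \<open>p \<noteq> u\<close>] by (meson converse_rtrancl_into_rtrancl)
    qed simp
  qed
qed

text \<open>The edge of \<open>u\<close> is the only tree edge between \<open>S\<close> and its
  complement, and the edge of \<open>y\<close> joins them again. The white ends \<open>a\<close> and
  \<open>b\<close> lie at the same vertex, which is not the root, so no white degree changes; black
  degrees are unconstrained.\<close>

lemma exchange:
  assumes closed: "\<And>x. x \<in> S \<Longrightarrow> rot x \<in> S" "\<And>x. x \<in> S \<Longrightarrow> x \<in> T \<Longrightarrow> x \<noteq> u \<Longrightarrow> opp x \<in> S"
    and u: "u \<in> P" "u \<in> S" "opp u \<notin> S" and S: "S \<subseteq> D"
    and y: "y \<in> S" "opp y \<notin> S" "y \<notin> T" "y \<notin> K" "opp y \<notin> K"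
    and a: "a \<in> W" "a \<in> {u, opp u}" and b: "b \<in> W" "b \<in> {y, opp y}" and ab: "V a = V b" "V a \<noteq> V r"
  shows "spanning (T - {u, opp u} \<union> {y, opp y})"
proof -
  let ?T = "T - {u, opp u} \<union> {y, opp y}"
  have uD: "u \<in> D" and yD: "y \<in> D" using u y S by blast+
  have uT: "u \<in> T" "opp u \<in> T" using u T_eq by auto
  have oy: "opp y \<notin> T" using opp_T_iff[OF yD] y by blast
  have aT: "a \<in> T" "b \<notin> T" using a(2) b(2) uT y(3) oy by blast+
  have white: "x \<in> ?T \<longleftrightarrow> x \<in> T \<and> x \<noteq> a \<or> x = b" if "x \<in> W" for x
  proof -
    have iff: "x = e \<longleftrightarrow> x \<in> {z, opp z}" if "e \<in> W" "e \<in> {z, opp z}" "z \<in> D" for e z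
    proof (cases "z \<in> W")
      case True
      then have "opp z \<notin> W" using opp_W[OF \<open>z \<in> D\<close>] by blast
      then show ?thesis using that \<open>x \<in> W\<close> by blast
    next
      case False
      then show ?thesis using that \<open>x \<in> W\<close> by blast
    qed
    show ?thesis unfolding iff[OF a uD] iff[OF b yD] by blast
  qed
  show ?thesis
    unfolding spanning_def
  proof (intro conjI ballI impI)
    show "?T \<subseteq> D" using T_D yD opp_D by auto
    show "opp d \<in> ?T" if "d \<in> ?T" for d
    proof (cases "d \<in> {y, opp y}")
      case False
      then have d: "d \<in> T" "d \<noteq> u" "d \<noteq> opp u" using that by auto
      have "opp (opp d) = d" using d T_D opp_opp by blast
      then have "opp d \<noteq> u" using d(3) by metis
      have "opp d \<noteq> opp u" using opp_inj[of d u] d(2) by blast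
      then show ?thesis using opp_T[OF d(1)] \<open>opp d \<noteq> u\<close> by blast
    qed (use opp_opp[OF yD] in auto)
    show "?T \<inter> K = {}" using notin_K y by blast
    show "card (V d \<inter> ?T) = 2" if d: "d \<in> W" "V d \<noteq> V r" for d
    proof -
      have two: "card (V d \<inter> T) = 2" using spanning d unfolding spanning_def by blast
      have VW: "V d \<subseteq> W" by (rule V_W[OF d(1)])
      show ?thesis
      proof (cases "V d = V a")
        case False
        then have "a \<notin> V d" "b \<notin> V d" using ab by (auto simp: in_V_iff)
        then have "x \<in> ?T \<longleftrightarrow> x \<in> T" if "x \<in> V d" for x
          using white[of x] that VW by blast
        then have "V d \<inter> ?T = V d \<inter> T" by blast
        then show ?thesis using two by (simp only:)
      next
        case True
        then have "a \<in> V d" "b \<in> V d" using ab by (auto simp: in_V_iff)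
        have "x \<in> ?T \<longleftrightarrow> x \<in> T - {a} \<or> x = b" if "x \<in> V d" for x
          using white[of x] that VW by blast
        then have "V d \<inter> ?T = insert b (V d \<inter> T - {a})" using \<open>b \<in> V d\<close> by blast
        moreover have nb: "b \<notin> V d \<inter> T - {a}" using aT by blast
        moreover have fin: "finite (V d \<inter> T)" using finite_subset[OF T_D finite_D] by blast
        moreover have "a \<in> V d \<inter> T" using \<open>a \<in> V d\<close> aT by blast
        then have "card (V d \<inter> T - {a}) = 1" using two by (simp only: card_Diff_singleton)
        moreover have "card (insert b (V d \<inter> T - {a})) = Suc (card (V d \<inter> T - {a}))"
          using fin nb by (intro card_insert_disjoint) blast+
        ultimately show ?thesis by simp
      qed
    qed
    show "V r \<inter> ?T = {r}"
    proof -
      have "a \<notin> V r" "b \<notin> V r" using ab by (auto simp: in_V_iff)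
      then have "x \<in> ?T \<longleftrightarrow> x \<in> T" if "x \<in> V r" for x
        using white[of x] that V_W[OF r_W] by blast
      then have "V r \<inter> ?T = V r \<inter> T" by blast
      then show ?thesis using root_T by (simp only:)
    qed
    have mono: "(links (T - {u, opp u}))\<^sup>* \<subseteq> (links ?T)\<^sup>*"
      by (intro rtrancl_mono links_mono) blast
    have "sym (links (T - {u, opp u}))"
    proof (rule symI)
      fix v w assume "(v, w) \<in> links (T - {u, opp u})"
      then obtain d where d: "d \<in> T" "d \<noteq> u" "d \<noteq> opp u" "v = V d" "w = V (opp d)" by (auto simp: links_def)
      have dD: "d \<in> D" using d T_D by blast
      have "opp d \<in> T - {u, opp u}" using opp_T[OF d(1)] d opp_inj[of d u] opp_opp[OF dD] by auto
      moreover have "V (opp (opp d)) = v" using opp_opp[OF dD] d by simp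
      ultimately show "(w, v) \<in> links (T - {u, opp u})" using d by (auto simp: links_def) 
    qed
    then have sym: "sym ((links (T - {u, opp u}))\<^sup>*)" by (rule sym_rtrancl)
    have path: "x \<in> S \<Longrightarrow> (V x, V u) \<in> (links (T - {u, opp u}))\<^sup>*"
      "x \<notin> S \<Longrightarrow> (V x, V r) \<in> (links (T - {u, opp u}))\<^sup>*" if "x \<in> D" for x
      using arborescence_path[OF that, of S u] closed u S by blast+
    show "(V d, V r) \<in> (links ?T)\<^sup>*" if d: "d \<in> D" for d
    proof (cases "d \<in> S")
      case False
      then show ?thesis using path(2)[OF d] mono by blast
    next
      case True
      have "(V d, V u) \<in> (links ?T)\<^sup>*" using path(1)[OF d True] mono by blast
      moreover have "(V u, V y) \<in> (links ?T)\<^sup>*"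
        using path(1)[OF yD y(1)] mono symD[OF sym] by blast
      moreover have "(V y, V (opp y)) \<in> links ?T" by (auto simp: links_def)
      moreover have "(V (opp y), V r) \<in> (links ?T)\<^sup>*" using path(2)[OF opp_D[OF yD] y(2)] mono by blast
      ultimately show ?thesis by (meson rtrancl_trans converse_rtrancl_into_rtrancl)
    qed
  qed
qed

text \<open>All darts of the root vertex except \<open>r\<close> are cut, so the walk turns around
  the root vertex before it crosses any edge.\<close>

lemma visit_root:
  assumes "k < m - 1"
  shows "visit T k = (rot ^^ k) (rot r)"
  using assms
proof (induction k)
  case (Suc k)
  have "(rot ^^ k) (rot r) = (rot ^^ Suc k) r" by (simp add: funpow_swap1)
  moreover have "(rot ^^ Suc k) r \<noteq> r" using rot_less[OF r_D, of "Suc k"] Suc.prems by simp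
  moreover have "(rot ^^ Suc k) r \<in> V r" by (simp only: in_V_iff V_pow)
  ultimately have "(rot ^^ k) (rot r) \<notin> T" using root_T by auto
  then show ?case using Suc by (simp add: visit_Suc turn_def)
qed simp

definition segment_of :: "'d \<Rightarrow> nat \<Rightarrow> nat \<Rightarrow> 'd set \<Rightarrow> bool" where
  "segment_of u i j S \<longleftrightarrow> i < j \<and> j < card D \<and> visit T i = opp u \<and> visit T j = u \<and> S = visit T ` {i<..j} \<and>
     (\<forall>x\<in>S. rot x \<in> S) \<and> (\<forall>x\<in>S. x \<in> T \<longrightarrow> x \<noteq> u \<longrightarrow> opp x \<in> S)"

lemma segment_exists: "u \<in> P \<Longrightarrow> \<exists>i j S. segment_of u i j S"
  using segment[of u] unfolding segment_of_def by blast

lemma segment_ofD: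
  assumes "segment_of u i j S"
  shows "i < j" "j < card D" "visit T i = opp u" "visit T j = u" "S \<subseteq> D" "u \<in> S" "opp u \<notin> S"
    "\<And>x. x \<in> S \<Longrightarrow> rot x \<in> S" "\<And>x. x \<in> S \<Longrightarrow> x \<in> T \<Longrightarrow> x \<noteq> u \<Longrightarrow> opp x \<in> S"
    "\<And>x. x \<in> S \<Longrightarrow> V x \<subseteq> S" "\<And>l. l < card D \<Longrightarrow> visit T l \<in> S \<longleftrightarrow> i < l \<and> l \<le> j"
proof -
  show ij: "i < j" "j < card D" "visit T i = opp u" "visit T j = u"
    and rot: "\<And>x. x \<in> S \<Longrightarrow> rot x \<in> S" and "\<And>x. x \<in> S \<Longrightarrow> x \<in> T \<Longrightarrow> x \<noteq> u \<Longrightarrow> opp x \<in> S"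
    using assms by (auto simp: segment_of_def)
  show iff: "visit T l \<in> S \<longleftrightarrow> i < l \<and> l \<le> j" if "l < card D" for l
  proof
    assume "visit T l \<in> S"
    then obtain n where "visit T l = visit T n" "n \<in> {i<..j}" using assms by (auto simp: segment_of_def)
    then show "i < l \<and> l \<le> j" using visit_inj[OF that, of n] ij by auto
  qed (use assms in \<open>auto simp: segment_of_def\<close>)
  show "S \<subseteq> D" using assms visit_in_D by (auto simp: segment_of_def)
  show "u \<in> S" "opp u \<notin> S" using iff[of j] iff[of i] ij by auto
  show "V x \<subseteq> S" if "x \<in> S" for x using V_subset[of x S] rot that by blast
qed

text \<open>A white vertex has only one child, so apart from its own darts its subtree is the
  subtree of that child; the proof climbs from \<open>x\<close> until the parent is the vertex of
  \<open>p\<close>.\<close>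

lemma segment_child:
  assumes p: "p \<in> P" "segment_of p i j S" and o: "p \<in> W"
    and d: "d \<in> V p" "opp d \<in> P" "segment_of (opp d) i' j' S'"
    and x: "x \<in> S" "V x \<noteq> V p"
  shows "x \<in> S'"
  using x
proof (induction "h (V x)" arbitrary: x rule: less_induct)
  case less
  note S = segment_ofD[OF p(2)] and S' = segment_ofD[OF d(3)]
  have xD: "x \<in> D" using less.prems S(5) by blast
  have dD: "d \<in> D" using d(1) o W_D V_D by blast
  have "V x \<noteq> V r"
  proof
    assume "V x = V r"
    then have "rot r \<in> V x" by (simp add: in_V_iff V_rot)
    then have "visit T 0 \<in> S" using S(10)[OF less.prems(1)] by auto
    then show False using S(11)[of 0] S(2) by simp
  qed
  then obtain q where q: "q \<in> P" "q \<in> V x" using arborescence_parent[OF arborescence xD] by blast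
  have Vq: "V q = V x" using q by (simp add: in_V_iff)
  have qD: "q \<in> D" using q P_D by blast
  have qS: "q \<in> S" "q \<noteq> p" using S(10)[OF less.prems(1)] q Vq less.prems(2) by auto
  moreover have "q \<in> T" using q T_eq by blast
  ultimately have oq: "opp q \<in> S" using S(9) by blast
  have "q \<in> S'"
  proof (cases "V (opp q) = V p")
    case True
    then have "opp q \<in> V p" by (simp add: in_V_iff)
    moreover have "opp (opp q) \<in> P" using opp_opp[OF qD] q by simp
    ultimately have "opp q = d" using spanning_white_child[OF spanning arborescence T_eq o] d by blast
    then have "q = opp d" using opp_opp[OF qD] by metis
    then show ?thesis using S'(6) by simp
  next
    case False
    have "h (V (opp q)) < h (V x)" using arborescence q(1) Vq by (auto simp: arborescence_def)
    then have "opp q \<in> S'" using less.hyps[OF _ oq False] by blast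
    moreover have "opp q \<in> T" using q T_eq by blast
    moreover have "opp q \<noteq> opp d"
    proof
      assume "opp q = opp d"
      then have "q = d" by (rule opp_inj)
      then show False using arborescence_opp[OF arborescence d(2)] opp_opp[OF dD] q by simp
    qed
    ultimately have "opp (opp q) \<in> S'" using S'(9) by blast
    then show ?thesis using opp_opp[OF qD] by simp
  qed
  then show ?case using S'(10)[of q] Vq self_V[of x] by auto
qed

text \<open>At the first decision that differs, both walks stand at the same dart; there
  \<open>T'\<close> cuts at a white dart or crosses at a black one, and \<open>T\<close> does the
  opposite.\<close>

definition improves :: "'d set \<Rightarrow> bool" where
  "improves T' \<longleftrightarrow> (\<exists>k<card D. (\<forall>j<k. visit T j \<in> T \<longleftrightarrow> visit T j \<in> T') \<and>
     (visit T k \<in> W \<longleftrightarrow> visit T k \<in> T) \<and> (visit T k \<in> W \<longleftrightarrow> visit T k \<notin> T'))"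

text \<open>
  Let \<open>o'\<close> be a white cut dart that is met only after the other end \<open>c\<close> of its edge, and let \<open>p\<close> be
  the edge from its vertex to the parent.  Reinserting the cut edge closes a cycle
  through \<open>p\<close> if \<open>c\<close> lies outside the subtree of \<open>p\<close>, and through the edge to the black child
  otherwise; this tree edge is the one to be removed.
\<close>

lemma improvement:
  assumes "\<not> valid T"
  shows "\<exists>T'. spanning T' \<and> improves T'"
proof -
  obtain o' where o: "o' \<in> W" "o' \<notin> T" "o' \<notin> K"
    and bad: "\<And>i j. i < j \<Longrightarrow> j < card D \<Longrightarrow> visit T i = o' \<Longrightarrow> visit T j \<noteq> opp o'"
    using assms unfolding valid_def by blast
  define c where "c = opp o'"
  have oD: "o' \<in> D" using o W_D by blast
  have c: "c \<in> D" "c \<notin> T" "c \<notin> W" "opp c = o'" "c \<notin> K"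
    using opp_D[OF oD] opp_T_iff[OF oD] opp_W[OF oD] opp_opp[OF oD] o K_W by (auto simp: c_def)
  obtain po where po: "po < card D" "visit T po = o'" using visit_surj[OF oD] by blast
  obtain pc where pc: "pc < card D" "visit T pc = c" using visit_surj[OF c(1)] by blast
  have "po \<noteq> pc" using po pc c o by auto
  then have pcpo: "pc < po" using bad[of po pc] po pc unfolding c_def by (metis nat_neq_iff)
  \<comment> \<open>By \<open>visit_root\<close> the cut darts of the root vertex are visited before
    any black dart, so none of them can violate validity.\<close>
  have nroot: "V o' \<noteq> V r"
  proof
    assume Vo: "V o' = V r"
    then have "o' \<in> V (rot r)" by (simp add: in_V_iff V_rot)
    then obtain k where k: "k < m" "o' = (rot ^^ k) (rot r)" using V_altdef[OF rot_D[OF r_D]] by auto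
    have "k \<noteq> m - 1"
    proof
      assume "k = m - 1"
      then have "o' = (rot ^^ Suc (m - 1)) r" using k by (simp only: funpow_Suc_right comp_apply)
      then have "o' = r" using rot_m[OF r_D] m_ge by simp
      then show False using o(2) root_T by blast
    qed
    then have k': "k < m - 1" using k by simp
    have "m \<le> card D" using card_V[OF r_D] card_mono[OF finite_D V_D[OF r_D]] by simp
    then have "po = k" using visit_inj[of po k] po k visit_root[OF k'] by simp
    then have "c = (rot ^^ pc) (rot r)" using visit_root[of pc] pc pcpo k' by simp
    then have "V c = V r" by (simp only: V_pow V_rot)
    then show False using W_V[OF c(1), of r] r_W c by blast
  qed
  obtain p where p: "p \<in> P" "p \<in> V o'" using arborescence_parent[OF arborescence oD nroot] by blast
  have Vp: "V p = V o'" using p by (simp add: in_V_iff)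
  have pW: "p \<in> W" using p V_W[OF o(1)] by blast
  obtain i j S where seg: "segment_of p i j S" using segment_exists[OF p(1)] by blast
  note S = segment_ofD[OF seg]
  have oS: "o' \<in> S" using S(10)[OF S(6)] Vp self_V[of o'] by auto
  have pT: "p \<in> T" "opp p \<in> T" using p T_eq by auto
  show ?thesis
  proof (cases "c \<in> S")
    case False
    \<comment> \<open>Here \<open>c\<close> is visited even before the parent edge is entered, so
      the earliest change is at the black dart \<open>c\<close>, which is now crossed instead of
      cut.\<close>
    let ?T = "T - {p, opp p} \<union> {o', opp o'}"
    have "spanning ?T"
      by (rule exchange[where S = S and a = p and b = o'])
         (use S False p o c pW Vp nroot oS in \<open>auto simp: c_def[symmetric]\<close>)
    moreover have "improves ?T"
      unfolding improves_def
    proof (intro exI conjI allI impI)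
      show "pc < card D" by (rule pc)
      have posi: "pc < i"
      proof -
        have "\<not> (i < pc \<and> pc \<le> j)" using S(11)[OF pc(1)] pc(2) False by simp
        moreover have "po \<le> j" using S(11)[OF po(1)] po(2) oS by simp
        moreover have "pc \<noteq> i" using S(3) pc(2) c(2) pT by auto
        ultimately show ?thesis using pcpo by simp
      qed
      show "visit T l \<in> T \<longleftrightarrow> visit T l \<in> ?T" if "l < pc" for l
      proof -
        have lD: "l < card D" using that pc by simp
        have "visit T l \<noteq> o'" "visit T l \<noteq> opp o'"
          using visit_inj[OF lD po(1)] visit_inj[OF lD pc(1)] po pc pcpo that by (auto simp: c_def)
        moreover have "visit T l \<noteq> p" "visit T l \<noteq> opp p"
          using visit_inj[OF lD, of j] visit_inj[OF lD, of i] S posi that by auto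
        ultimately show ?thesis by blast
      qed
      show "visit T pc \<in> W \<longleftrightarrow> visit T pc \<in> T" using pc c by simp
      show "visit T pc \<in> W \<longleftrightarrow> visit T pc \<notin> ?T" using pc c by (simp add: c_def)
    qed
    ultimately show ?thesis by blast
  next
    case True
    obtain d where d: "d \<in> V o'" "opp d \<in> P"
      using spanning_white_child[OF spanning arborescence T_eq o(1)] by blast
    define u where "u = opp d"
    have dW: "d \<in> W" using d V_W[OF o(1)] by blast
    then have dD: "d \<in> D" using W_D by blast
    have Vd: "V d = V o'" using d by (simp add: in_V_iff)
    have u: "u \<in> P" "opp u = d" using d opp_opp[OF dD] by (auto simp: u_def)
    obtain i' j' S' where seg': "segment_of u i' j' S'" using segment_exists[OF u(1)] by blast
    note S' = segment_ofD[OF seg']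
    have "V c \<noteq> V p" using W_V[OF c(1), of p] pW c by blast
    then have cS': "c \<in> S'"
      using segment_child[OF p(1) seg pW _ d(2) _ True] seg' d Vp by (simp add: u_def)
    have dT: "d \<in> T" "u \<in> T" using u T_eq by auto
    have oS': "o' \<notin> S'"
    proof
      assume "o' \<in> S'"
      then have "d \<in> S'" using S'(10) d by blast
      then show False using S'(7) u by simp
    qed
    \<comment> \<open>Here \<open>c\<close> lies in the subtree of the black child, so the earliest
      change is at the white dart \<open>d\<close> leading to this child, which is now cut instead
      of crossed.\<close>
    let ?T = "T - {u, opp u} \<union> {c, opp c}"
    have "spanning ?T"
      by (rule exchange[where S = S' and a = d and b = o'])
         (use S' cS' oS' u o c dW Vd nroot in auto)
    moreover have "improves ?T"
      unfolding improves_def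
    proof (intro exI conjI allI impI)
      show "i' < card D" using S' by simp
      have posi: "i' < pc" using S'(11)[OF pc(1)] pc(2) cS' by simp
      show "visit T l \<in> T \<longleftrightarrow> visit T l \<in> ?T" if "l < i'" for l
      proof -
        have lD: "l < card D" using that S' by simp
        have "visit T l \<noteq> o'" "visit T l \<noteq> c"
          using visit_inj[OF lD po(1)] visit_inj[OF lD pc(1)] po pc pcpo that posi by auto
        moreover have "visit T l \<noteq> u" "visit T l \<noteq> opp u"
          using visit_inj[OF lD, of j'] visit_inj[OF lD, of i'] S' that by auto
        ultimately show ?thesis using c by blast
      qed
      have vi: "visit T i' = d" using S' u by simp
      show "visit T i' \<in> W \<longleftrightarrow> visit T i' \<in> T" using vi dW dT by simp
      have "d \<noteq> c" "d \<noteq> o'" using dW c dT o by auto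
      then show "visit T i' \<in> W \<longleftrightarrow> visit T i' \<notin> ?T" using vi dW u c by simp
    qed
    ultimately show ?thesis by blast
  qed
qed

end

context bipartite_map begin

text \<open>
  The lexicographic order on walks, encoded in binary: the digit \<open>1\<close> stands for cutting at a white
  and for crossing at a black vertex.
\<close>

definition tour_code :: "'d set \<Rightarrow> nat" where
  "tour_code T = (\<Sum>k<card D. if visit T k \<in> W \<longleftrightarrow> visit T k \<notin> T then 2 ^ (card D - k) else 0)"

lemma tour_code_less:
  assumes "spanned_map D rot opp m W r K T P h" "spanned_map.improves D rot opp W r T T'"
  shows "tour_code T < tour_code T'"
proof -
  obtain k where k: "k < card D" and agree: "\<And>j. j < k \<Longrightarrow> visit T j \<in> T \<longleftrightarrow> visit T j \<in> T'"
    and at: "visit T k \<in> W \<longleftrightarrow> visit T k \<in> T" "visit T k \<in> W \<longleftrightarrow> visit T k \<notin> T'"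
    using assms(2) unfolding spanned_map.improves_def[OF assms(1)] by blast
  have same: "visit T' j = visit T j" if "j \<le> k" for j
    using visit_agree[of j T T'] agree that by simp
  define f where "f T j = (if visit T j \<in> W \<longleftrightarrow> visit T j \<notin> T then 2 ^ (card D - j) else 0 :: nat)" for T j
  have split: "sum g {..<card D} = sum g {..<k} + g k + sum g {Suc k..<card D}" for g :: "nat \<Rightarrow> nat"
  proof -
    have "sum g {..<card D} = sum g {0..<k} + sum g {k..<card D}"
      using k by (simp add: sum.atLeastLessThan_concat lessThan_atLeast0)
    also have "sum g {k..<card D} = g k + sum g {Suc k..<card D}" using k by (rule sum.atLeast_Suc_lessThan)
    finally show ?thesis by (simp add: lessThan_atLeast0)
  qed
  \<comment> \<open>The smallest weight is 2, at position \<open>n - 1\<close>, so all later digits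
    together reach at most \<open>2 ^ (n - k) - 2\<close>; writing the 2 on the left lets the
    induction double both sides.\<close>
  have geo: "(\<Sum>j=Suc k..<n. 2 ^ (n - j)) + 2 \<le> (2 ^ (n - k) :: nat)" if "k < n" for n
    using that
  proof (induction "n - k" arbitrary: n)
    case (Suc l)
    show ?case
    proof (cases "Suc k = n")
      case False
      then obtain n' where n': "n = Suc n'" "k < n'" using Suc.prems by (cases n) auto
      have "(\<Sum>j=Suc k..<n. 2 ^ (n - j)) = (\<Sum>j=Suc k..<n'. 2 ^ (n - j)) + 2 ^ (n - n')"
        using n' by simp
      also have "(\<Sum>j=Suc k..<n'. 2 ^ (n - j)) = 2 * (\<Sum>j=Suc k..<n'. 2 ^ (n' - j) :: nat)"
        unfolding sum_distrib_left using n' by (intro sum.cong) (auto simp: Suc_diff_le)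
      finally have "(\<Sum>j=Suc k..<n. 2 ^ (n - j)) = 2 * (\<Sum>j=Suc k..<n'. 2 ^ (n' - j)) + (2 :: nat)"
        using n' by simp
      moreover have "(\<Sum>j=Suc k..<n'. 2 ^ (n' - j)) + 2 \<le> (2 ^ (n' - k) :: nat)"
        using Suc n' by auto
      moreover have "(2 ^ (n - k) :: nat) = 2 * 2 ^ (n' - k)" using n' by (simp add: Suc_diff_le)
      ultimately show ?thesis by simp
    next
      case True
      then have "n - k = 1" by simp
      then show ?thesis using True by simp
    qed
  qed simp
  have "sum (f T) {Suc k..<card D} \<le> (\<Sum>j=Suc k..<card D. 2 ^ (card D - j))"
    by (intro sum_mono) (simp add: f_def)
  also have "\<dots> < 2 ^ (card D - k)" using geo[OF k] by linarith
  also have "\<dots> = f T' k" using at same[of k] by (simp add: f_def)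
  finally have "sum (f T) {Suc k..<card D} < f T' k" .
  moreover have "f T k = 0" using at by (simp add: f_def)
  moreover have "sum (f T) {..<k} = sum (f T') {..<k}"
    using agree same by (intro sum.cong) (auto simp: f_def)
  ultimately have "sum (f T) {..<card D} < sum (f T') {..<card D}"
    unfolding split[of "f T"] split[of "f T'"] by simp
  then show ?thesis by (simp add: tour_code_def f_def)
qed

theorem valid_spanning_exists:
  assumes "spanning T0"
  shows "\<exists>T. spanning T \<and> valid T"
proof -
  have fin: "finite {T. spanning T}"
    by (rule finite_subset[of _ "Pow D"]) (auto simp: spanning_def finite_D)
  define M where "M = Max (tour_code ` {T. spanning T})"
  have "M \<in> tour_code ` {T. spanning T}"
    unfolding M_def using fin assms by (intro Max_in) auto
  then obtain T where T: "spanning T" "tour_code T = M" by auto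
  obtain P h where sp: "spanned_map D rot opp m W r K T P h" using spanned_mapI[OF T(1)] .
  have "valid T"
  proof (rule ccontr)
    assume "\<not> valid T"
    then obtain T' where T': "spanning T'" "spanned_map.improves D rot opp W r T T'"
      using spanned_map.improvement[OF sp] by blast
    then have "tour_code T < tour_code T'" using tour_code_less[OF sp] by blast
    moreover have "tour_code T' \<le> M" unfolding M_def using fin T'(1) by (intro Max_ge) auto
    ultimately show False using T(2) by simp
  qed
  then show ?thesis using T(1) by blast
qed

end

section \<open>Admissible maps and spanning trees\<close>

lemma orbit_period:
  assumes f: "permutation f" and m: "card (orbit f d) = m"
  shows "(f ^^ m) d = d" "0 < k \<Longrightarrow> k < m \<Longrightarrow> (f ^^ k) d \<noteq> d"
proof -
  have "d \<in> orbit f d" by (rule permutation_self_in_orbit[OF f])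
  then obtain l where l: "d = (f ^^ l) d" "0 < l" unfolding orbit_altdef by auto
  define n where "n = (LEAST n. 0 < n \<and> (f ^^ n) d = d)"
  have "0 < n \<and> (f ^^ n) d = d" unfolding n_def by (rule LeastI[of _ l]) (use l in auto)
  then have n: "(f ^^ n) d = d" "0 < n" by auto
  have least: "(f ^^ k) d \<noteq> d" if "0 < k" "k < n" for k
    using not_less_Least[of k "\<lambda>n. 0 < n \<and> (f ^^ n) d = d"] that by (auto simp: n_def)
  have "orbit f d = (\<lambda>k. (f ^^ k) d) ` {0..<n}"
    using orbit_altdef_bounded[OF n] by auto
  moreover have "inj_on (\<lambda>k. (f ^^ k) d) {0..<n}"
    using inj_on_funpow_least[OF n(1)] least by blast
  ultimately have "n = m" using m by (simp add: card_image)
  then show "(f ^^ m) d = d" "0 < k \<Longrightarrow> k < m \<Longrightarrow> (f ^^ k) d \<noteq> d" using n least by auto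
qed

definition white_darts :: "marked_map \<Rightarrow> nat set" where
  "white_darts M = {d \<in> darts M. vertex_at M d \<in> white M}"

lemma labelled_Q_vertex:
  assumes "M \<in> labelled_Q m i" "d \<in> darts M" "e \<in> darts M"
  shows "e \<in> vertex_at M d \<longleftrightarrow> vertex_at M e = vertex_at M d"
proof -
  have "permutation (rot M)"
    using assms(1) by (auto simp: labelled_Q_def regular_bipartite_def is_map_def permutation_permutes)
  note self = permutation_self_in_orbit[OF this]
  show ?thesis unfolding vertex_at_def
    using self orbit_trans orbit_swap[OF self] by (metis subsetI subset_antisym)
qed

text \<open>The tree is an arborescence of unmarked oriented edges, which root-accessibility
  provides. Each black vertex has only one outgoing edge, so it is the parent edge; at a white
  vertex the tree consists of the ingoing edge and, except at the root, the parent edge.\<close>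

lemma labelled_Q_bipartite_map:
  assumes M: "M \<in> labelled_Q m i" and m: "m \<ge> 2"
  shows "bipartite_map (darts M) (rot M) (opp M) m (white_darts M) (root_dart M) (marks M)"
    and "\<exists>T. bipartite_map.spanning (darts M) (rot M) (opp M) (white_darts M) (root_dart M) (marks M) T"
proof -
  let ?D = "darts M" and ?W = "white_darts M" and ?r = "root_dart M" and ?K = "marks M"
  note sub = labelled_Q_sub[OF M]
  have rb: "regular_bipartite m M" "rooted M" "marked M" "admissible m M"
    using M by (auto simp: labelled_Q_def)
  have map: "finite ?D" "rot M permutes ?D" "opp M permutes ?D"
    "\<And>d. d \<in> ?D \<Longrightarrow> opp M d \<noteq> d" "\<And>d. d \<in> ?D \<Longrightarrow> opp M (opp M d) = d"
    using rb(1) by (auto simp: regular_bipartite_def is_map_def)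
  have perm: "permutation (rot M)" using map permutation_permutes by blast
  have card: "card (vertex_at M d) = m" if "d \<in> ?D" for d
    using rb(1) that by (auto simp: regular_bipartite_def vertices_def)
  note vertex = labelled_Q_vertex[OF M]
  have self: "d \<in> vertex_at M d" for d
    unfolding vertex_at_def by (rule permutation_self_in_orbit[OF perm])
  have vsub: "vertex_at M d \<subseteq> ?D" if "d \<in> ?D" for d
    using sub(6)[of "vertex_at M d"] that by (auto simp: vertices_def)
  obtain X where X: "one_orientation m M X" "compatible M X" "root_accessible M X"
    "ingoing X (root_vertex M) = {?r}" using rb(4) by (auto simp: admissible_def)
  have XD: "X \<subseteq> ?D" and Xop: "\<And>d. d \<in> ?D \<Longrightarrow> d \<in> X \<longleftrightarrow> opp M d \<notin> X"
    using X(1) by (auto simp: one_orientation_def orientation_def)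
  have Xw: "card (vertex_at M d \<inter> X) = m - 1" if "d \<in> ?W" for d
    using X(1) that by (auto simp: one_orientation_def outgoing_def white_darts_def)
  have Xb: "card (vertex_at M d \<inter> X) = 1" if "d \<in> ?D" "d \<notin> ?W" for d
    using X(1) that by (auto simp: one_orientation_def outgoing_def white_darts_def black_def vertices_def)
  have out: "e = d" if de: "d \<in> X" "d \<notin> ?W" "e \<in> X" "vertex_at M e = vertex_at M d" for d e
  proof -
    have D: "d \<in> ?D" "e \<in> ?D" using de XD by auto
    then have *: "d \<in> vertex_at M d \<inter> X" "e \<in> vertex_at M d \<inter> X" using de vertex[OF D] self[of d] by blast+
    obtain a where a: "vertex_at M d \<inter> X = {a}"
      using Xb[OF D(1) de(2)] by (auto simp: card_1_singleton_iff)
    show ?thesis using * unfolding a by simp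
  qed
  have rD: "?r \<in> ?D" by (rule sub(2))
  have rW: "?r \<in> ?W" using rb(2) by (auto simp: rooted_def root_vertex_def white_darts_def)
  define Y where "Y = {d \<in> X. d \<notin> ?K \<and> opp M d \<notin> ?K}"
  have steps: "unmarked_steps M X = {(vertex_at M d, vertex_at M (opp M d)) | d. d \<in> Y}"
    by (auto simp: unmarked_steps_def Y_def)
  have reach: "(vertex_at M d, vertex_at M ?r) \<in> (unmarked_steps M X)\<^sup>*" if "d \<in> ?D" for d
    using X(3) that by (auto simp: root_accessible_def vertices_def root_vertex_def)
  have KW: "?K \<subseteq> ?W"
  proof
    fix k assume k: "k \<in> ?K"
    then have kX: "k \<in> X" using X(2) by (auto simp: compatible_def)
    show "k \<in> ?W"
    proof (rule ccontr)
      assume kW: "k \<notin> ?W"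
      have kD: "k \<in> ?D" using kX XD by blast
      have "vertex_at M k \<noteq> vertex_at M ?r" using kW rW kD by (auto simp: white_darts_def)
      then obtain v where "(vertex_at M k, v) \<in> unmarked_steps M X"
        using reach[OF kD] by (meson converse_rtranclE)
      then obtain d where d: "d \<in> Y" "vertex_at M k = vertex_at M d" by (auto simp: steps)
      then have "d = k" using out[OF kX kW, of d] by (simp add: Y_def)
      then show False using d k by (simp add: Y_def)
    qed
  qed
  show bm: "bipartite_map ?D (rot M) (opp M) m ?W ?r ?K"
  proof
    show "finite ?D" "rot M permutes ?D" "opp M permutes ?D" by (rule map)+
    show "opp M d \<noteq> d" "opp M (opp M d) = d" "(rot M ^^ m) d = d" if "d \<in> ?D" for d
      using map(4,5)[OF that] orbit_period(1)[OF perm] card[OF that] by (auto simp: vertex_at_def)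
    show "(rot M ^^ k) d \<noteq> d" if "d \<in> ?D" "0 < k" "k < m" for d k
      using orbit_period(2)[OF perm _ that(2,3)] card[OF that(1)] by (auto simp: vertex_at_def)
    show "?W \<subseteq> ?D" by (auto simp: white_darts_def)
    show "rot M d \<in> ?W \<longleftrightarrow> d \<in> ?W" if "d \<in> ?D" for d
    proof -
      have "rot M d \<in> vertex_at M d" by (simp add: vertex_at_def orbit.base)
      then have "vertex_at M (rot M d) = vertex_at M d" using vertex[OF that sub(4)[OF that]] by blast
      then show ?thesis using that sub(4)[OF that] by (simp add: white_darts_def)
    qed
    show "opp M d \<in> ?W \<longleftrightarrow> d \<notin> ?W" if "d \<in> ?D" for d
      using rb(1) that sub(5)[OF that] by (auto simp: regular_bipartite_def white_darts_def)
    show "?r \<in> ?W" "?K \<subseteq> ?W" "2 \<le> m" by (rule rW KW m)+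
  qed
  interpret bipartite_map ?D "rot M" "opp M" m ?W ?r ?K by (rule bm)
  have V: "V d = vertex_at M d" for d by (simp add: V_def vertex_at_def)
  have YD: "Y \<subseteq> ?D" using XD by (auto simp: Y_def)
  have links: "links Y = unmarked_steps M X" unfolding steps links_def V ..
  obtain P h where P: "P \<subseteq> Y" "arborescence P h"
    using arborescence_exists[OF YD] reach unfolding links V by blast
  have PX: "P \<subseteq> X" using P by (auto simp: Y_def)
  have bP: "d \<in> P" if d: "d \<in> X" "d \<notin> ?W" for d
  proof -
    have dD: "d \<in> ?D" using d XD by blast
    then have "V d \<noteq> V ?r" using W_V[of d ?r] d rW by blast
    then obtain p where "p \<in> P" "p \<in> V d" using arborescence_parent[OF P(2) dD] by blast
    then have "p \<in> X" "vertex_at M p = vertex_at M d" using PX by (auto simp: in_V_iff V[symmetric])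
    then have "p = d" by (rule out[OF d])
    then show ?thesis using \<open>p \<in> P\<close> by simp
  qed
  let ?T = "P \<union> opp M ` P"
  have PD: "P \<subseteq> ?D" using PX XD by blast
  \<comment> \<open>An ingoing edge at a white vertex is the outgoing edge of its black end and
    therefore a parent edge; this decides membership in the tree by the orientation.\<close>
  have inT: "x \<in> ?T \<longleftrightarrow> x \<in> P \<or> x \<notin> X" if "x \<in> ?W" for x
  proof -
    have xD: "x \<in> ?D" using that by (simp add: white_darts_def)
    have "x \<in> opp M ` P \<longleftrightarrow> opp M x \<in> P"
      using opp_opp[OF xD] opp_opp PD by (metis (no_types, lifting) imageE image_eqI subsetD)
    moreover have "opp M x \<in> P \<longleftrightarrow> x \<notin> X"
      using bP[of "opp M x"] opp_W[OF xD] that Xop[OF xD] PX by blast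
    ultimately show ?thesis by blast
  qed
  have "spanning ?T"
    unfolding spanning_def
  proof (intro conjI ballI impI)
    show "?T \<subseteq> ?D" using PD opp_D by blast
    show "opp M d \<in> ?T" if "d \<in> ?T" for d using that opp_opp PD by auto
    show "?T \<inter> ?K = {}" using P(1) by (auto simp: Y_def)
    show "(V d, V ?r) \<in> (links ?T)\<^sup>*" if "d \<in> ?D" for d
      using arborescence_reach[OF P(2) that] rtrancl_mono[OF links_mono[of P ?T]] by blast
    show "V ?r \<inter> ?T = {?r}"
    proof -
      have "V ?r - X = {?r}" using X(4) by (simp add: ingoing_def V root_vertex_def)
      moreover have "V ?r \<inter> P = {}" using P(2) by (simp add: arborescence_def)
      moreover have "x \<in> ?W" if "x \<in> V ?r" for x using that V_W[OF rW] by blast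
      ultimately show ?thesis using inT by blast
    qed
    show "card (V d \<inter> ?T) = 2" if d: "d \<in> ?W" "V d \<noteq> V ?r" for d
    proof -
      have dD: "d \<in> ?D" using d W_D by blast
      obtain p where p: "p \<in> P" "p \<in> V d" using arborescence_parent[OF P(2) dD d(2)] by blast
      have only: "q = p" if "q \<in> P" "q \<in> V d" for q
        using arborescence_unique[OF P(2) that(1) p(1)] that(2) p(2) by (simp add: in_V_iff)
      have "V d \<inter> ?T = insert p (V d - X)"
        using inT V_W[OF d(1)] p only by blast
      moreover have "p \<notin> V d - X" using p PX by blast
      moreover have "card (V d - X) = 1"
      proof -
        have "card (V d - X) = card (V d) - card (V d \<inter> X)"
          using card_Diff_subset_Int[of "V d" X] finite_V[OF dD] by simp
        then show ?thesis using card_V[OF dD] Xw[OF d(1)] m by (simp add: V)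
      qed
      moreover have "finite (V d - X)" using finite_V[OF dD] by simp
      ultimately show ?thesis by (simp only: card_insert_disjoint not_False_eq_True Suc_1)
    qed
  qed
  then show "\<exists>T. spanning T" by blast
qed

context spanned_map begin

text \<open>Tree edges point towards the root, and all cut edges point from white to black; the
  latter makes the orientation compatible with the marks.\<close>

definition orient :: "'d set" where
  "orient = {d \<in> W. opp d \<notin> P} \<union> (P - W)"

lemma orient_white: "d \<in> W \<Longrightarrow> d \<in> orient \<longleftrightarrow> opp d \<notin> P" and orient_black: "d \<notin> W \<Longrightarrow> d \<in> orient \<longleftrightarrow> d \<in> P"
  by (auto simp: orient_def)

lemma orient_opp: "d \<in> D \<Longrightarrow> d \<in> orient \<longleftrightarrow> opp d \<notin> orient"
  using orient_white orient_black opp_W opp_opp by metis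

lemma P_orient: "P \<subseteq> orient"
  using arborescence_opp[OF arborescence] by (auto simp: orient_def)

lemma card_out_white: "d \<in> W \<Longrightarrow> card (V d \<inter> orient) = m - 1"
proof -
  assume d: "d \<in> W"
  then have dD: "d \<in> D" using W_D by blast
  obtain e where e: "e \<in> V d" "opp e \<in> P" "\<And>x. x \<in> V d \<Longrightarrow> opp x \<in> P \<Longrightarrow> x = e"
    using spanning_white_child[OF spanning arborescence T_eq d] by blast
  have "V d \<inter> orient = V d - {e}" using e V_W[OF d] orient_white by blast
  then show ?thesis using e(1) card_V[OF dD] finite_V[OF dD] by (simp add: card_Diff_singleton)
qed

lemma card_out_black: "d \<in> D - W \<Longrightarrow> card (V d \<inter> orient) = 1"
proof -
  assume d: "d \<in> D - W"
  then have dD: "d \<in> D" by blast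
  have "V d \<noteq> V r" using W_V[OF dD, of r] d r_W by blast
  then obtain p where p: "p \<in> P" "p \<in> V d" using arborescence_parent[OF arborescence dD] by blast
  have only: "q = p" if "q \<in> P" "q \<in> V d" for q
    using arborescence_unique[OF arborescence that(1) p(1)] that(2) p(2) by (simp add: in_V_iff)
  have "V d \<inter> orient = {p}" using p only V_notW[OF d] orient_black by blast
  then show ?thesis by simp
qed

lemma in_root: "V r - orient = {r}"
proof -
  have "x \<in> V r - orient \<longleftrightarrow> x \<in> V r \<inter> T" for x
  proof (cases "x \<in> V r")
    case True
    then have xW: "x \<in> W" "x \<in> D" "x \<notin> P" using V_W[OF r_W] W_D root_P by blast+
    have "x \<in> T \<longleftrightarrow> opp x \<in> P"
      using xW T_eq T_cases opp_opp[OF xW(2)] by (metis Un_iff image_eqI)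
    then show ?thesis using True orient_white[OF xW(1)] by blast
  qed simp
  then show ?thesis using root_T by blast
qed

end

text \<open>Converse of the translation: \<open>orient\<close> witnesses admissibility, because
  \<open>P\<close> gives unmarked paths to the root and each white vertex has exactly one edge from
  a child, which at the root is \<open>r\<close>.\<close>

lemma labelled_QI:
  assumes sp: "spanned_map D rot' opp' m W r K T P h"
    and e: "\<And>d. d \<in> K \<Longrightarrow> e d \<ge> 1" "sum e K < i"
  defines "M \<equiv> \<lparr>darts = D, rot = rot', opp = opp', white = orbit rot' ` W, root_dart = r, marks = K, emult = e\<rparr>"
  shows "M \<in> labelled_Q m i" and "white_darts M = W" and "card (black M) = card (orbit rot' ` (D - W))"
proof -
  interpret spanned_map D rot' opp' m W r K T P h by (rule sp)
  have sel: "darts M = D" "rot M = rot'" "opp M = opp'" "white M = V ` W" "root_dart M = r" "marks M = K" "emult M = e"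
    by (simp_all add: M_def V_def[abs_def])
  have vert: "vertex_at M = V" by (simp add: vertex_at_def[abs_def] V_def[abs_def] sel)
  have verts: "vertices M = V ` D" by (simp add: vertices_def vert sel)
  have rv: "root_vertex M = V r" by (simp add: root_vertex_def vert sel)
  have W: "V d \<in> V ` W \<longleftrightarrow> d \<in> W" if "d \<in> D" for d
    using W_V[OF that] by blast
  show "white_darts M = W" using W W_D by (auto simp: white_darts_def vert sel)
  have "V ` D - V ` W = V ` (D - W)" using W W_D by blast
  then have bl: "black M = V ` (D - W)" by (simp add: black_def verts sel)
  then show "card (black M) = card (orbit rot' ` (D - W))" by (simp add: V_def[abs_def])
  have adj: "adjacency M = links D" by (simp add: adjacency_def links_def vert sel)
  have symL: "sym ((links D)\<^sup>*)"
  proof (rule sym_rtrancl, rule symI)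
    fix v w assume "(v, w) \<in> links D"
    then obtain d where d: "d \<in> D" "v = V d" "w = V (opp' d)" by (auto simp: links_def)
    then have "(V (opp' d), V (opp' (opp' d))) \<in> links D" using opp_D unfolding links_def by blast
    then show "(w, v) \<in> links D" using d opp_opp by simp
  qed
  have root: "(V d, V r) \<in> (links D)\<^sup>*" if "d \<in> D" for d
    using spanning that rtrancl_mono[OF links_mono[OF T_D]] by (auto simp: spanning_def)
  have "is_map M"
    unfolding is_map_def sel verts adj
  proof (intro conjI ballI)
    fix u v assume "u \<in> V ` D" "v \<in> V ` D"
    then obtain a b where ab: "a \<in> D" "b \<in> D" "u = V a" "v = V b" by blast
    have "(V r, V b) \<in> (links D)\<^sup>*" by (rule symD[OF symL root[OF ab(2)]])
    then show "(u, v) \<in> (links D)\<^sup>*" unfolding ab by (rule rtrancl_trans[OF root[OF ab(1)]])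
  next
    show "D \<noteq> {}" using r_D by blast
  qed (use finite_D rot_permutes opp_permutes opp_neq opp_opp in blast)+
  then have "regular_bipartite m M"
    unfolding regular_bipartite_def verts vert sel
  proof (intro conjI ballI)
    show "V ` W \<subseteq> V ` D" using W_D by blast
    show "V d \<in> V ` W \<longleftrightarrow> V (opp' d) \<notin> V ` W" if "d \<in> D" for d
      using W[OF that] W[OF opp_D[OF that]] opp_W[OF that] by simp
  qed (auto simp: card_V)
  moreover have "rooted M" using r_D r_W by (simp add: rooted_def rv sel)
  moreover have "marked M"
    unfolding marked_def sel
  proof (intro conjI ballI)
    show "K \<subseteq> D" using K_W W_D by blast
    show "opp' d \<notin> K" if "d \<in> K" for d
      using opp_W[of d] K_W W_D that by blast
  qed
  moreover have "admissible m M"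
    unfolding admissible_def
  proof (intro exI conjI)
    show "one_orientation m M orient"
      unfolding one_orientation_def orientation_def bl outgoing_def sel
    proof (intro conjI ballI)
      show "orient \<subseteq> D" using P_D W_D by (auto simp: orient_def)
    qed (use orient_opp card_out_white card_out_black in blast)+
    show "compatible M orient"
      unfolding compatible_def
    proof
      fix k assume k: "k \<in> marks M"
      then have kW: "k \<in> W" "k \<in> D" using K_W W_D by (auto simp: sel)
      have "opp' k \<notin> P"
      proof
        assume "opp' k \<in> P"
        then have "opp' (opp' k) \<in> T" using T_eq by blast
        then show False using opp_opp[OF kW(2)] notin_K k by (auto simp: sel)
      qed
      then show "k \<in> orient" using orient_white kW by blast
    qed
    show "root_accessible M orient"
      unfolding root_accessible_def verts rv
    proof
      fix v assume "v \<in> V ` D"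
      then have "(v, V r) \<in> (links P)\<^sup>*" using arborescence_reach[OF arborescence] by blast
      moreover have "links P \<subseteq> unmarked_steps M orient"
      proof
        fix z assume "z \<in> links P"
        then obtain p where p: "p \<in> P" "z = (V p, V (opp' p))" by (auto simp: links_def)
        then have "p \<in> T" "opp' p \<in> T" using T_eq by auto
        then have "p \<notin> K" "opp' p \<notin> K" using notin_K by auto
        then show "z \<in> unmarked_steps M orient" using p P_orient unfolding unmarked_steps_def vert sel by blast
      qed
      ultimately show "(v, V r) \<in> (unmarked_steps M orient)\<^sup>*" using rtrancl_mono by blast
    qed
    show "ingoing orient (root_vertex M) = {root_dart M}" using in_root by (simp add: ingoing_def rv sel)
  qed
  ultimately show "M \<in> labelled_Q m i" using e by (simp add: labelled_Q_def sel)
qed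

section \<open>Data read off a dart tree: shape, colours, edges, leaves, vertex cycles\<close>

definition flip :: "color \<Rightarrow> color" where
  "flip c = (if c = White then Black else White)"

lemma flip_simps [simp]: "flip White = Black" "flip Black = White" "flip (flip c) = c" "flip c \<noteq> c" "c \<noteq> flip c"
  by (cases c, simp_all add: flip_def)+

fun shape :: "color \<Rightarrow> 'd dart_tree \<Rightarrow> unit plane_tree" where
  "shape c (DLeaf d) = Leaf (if c = White then Opening else Closing ())"
| "shape c (DNode d u ts) = Node (flip c) (map (shape (flip c)) ts)"

fun coloured_tour :: "color \<Rightarrow> 'd dart_tree \<Rightarrow> ('d \<times> color) list" where
  "coloured_tour c (DLeaf d) = [(d, c)]"
| "coloured_tour c (DNode d u ts) = (d, c) # concat (map (coloured_tour (flip c)) ts) @ [(u, flip c)]"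

text \<open>Both directions are listed, so that the pairs form the graph of an involution.\<close>

fun tree_pairs :: "'d dart_tree \<Rightarrow> ('d \<times> 'd) list" where
  "tree_pairs (DLeaf d) = []"
| "tree_pairs (DNode d u ts) = (d, u) # (u, d) # concat (map tree_pairs ts)"

fun leaf_darts :: "'d dart_tree \<Rightarrow> 'd list" where
  "leaf_darts (DLeaf d) = [d]"
| "leaf_darts (DNode d u ts) = concat (map leaf_darts ts)"

text \<open>Each list is the clockwise order around one node, beginning with the parent dart,
  together with the colour of the node; in a closed tree these lists are the cycles of the
  rotation.\<close>

fun node_cycles :: "color \<Rightarrow> 'd dart_tree \<Rightarrow> (color \<times> 'd list) set" where
  "node_cycles c (DLeaf d) = {}"
| "node_cycles c (DNode d u ts) = insert (flip c, u # map top_dart ts) (\<Union>t\<in>set ts. node_cycles (flip c) t)"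

text \<open>With \<open>f\<close> the rotation and \<open>g\<close> the opposite dart, this
  characterizes the same trees as \<open>fits\<close> but top-down from \<open>T\<close> alone. It
  determines the tree from its top dart and can be transported along isomorphisms.\<close>

fun unfolds :: "('d \<Rightarrow> 'd) \<Rightarrow> ('d \<Rightarrow> 'd) \<Rightarrow> nat \<Rightarrow> 'd set \<Rightarrow> 'd dart_tree \<Rightarrow> bool" where
  "unfolds f g m T (DLeaf d) \<longleftrightarrow> d \<notin> T"
| "unfolds f g m T (DNode d u ts) \<longleftrightarrow> d \<in> T \<and> u = g d \<and> map top_dart ts = map (\<lambda>k. (f ^^ k) u) [1..<m] \<and>
     (\<forall>t\<in>set ts. unfolds f g m T t)"

lemma map_fst_coloured_tour: "map fst (coloured_tour c t) = tour t"
  by (induction c t rule: coloured_tour.induct) (simp_all add: map_concat o_def cong: map_cong)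

lemma tour_decomp: "set (tour t) = set (leaf_darts t) \<union> fst ` set (tree_pairs t)"
  by (induction t) (auto simp: image_Un image_UN)

lemma top_dart_in_tour: "top_dart t \<in> set (tour t)"
  by (cases t) auto

lemma top_coloured: "(top_dart t, c) \<in> set (coloured_tour c t)"
  by (cases t) auto

lemma leaf_darts_tour: "set (leaf_darts t) \<subseteq> set (tour t)"
  unfolding tour_decomp by blast

lemma tree_pairs_tour: "(d, e) \<in> set (tree_pairs t) \<Longrightarrow> d \<in> set (tour t)"
  unfolding tour_decomp by force

lemma mset_tour: "mset (tour t) = mset (leaf_darts t) + mset (map fst (tree_pairs t))"
proof (induction t)
  case (DNode d u ts)
  have "mset (concat (map tour ss)) = mset (concat (map leaf_darts ss)) + mset (map fst (concat (map tree_pairs ss)))"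
    if "\<And>t. t \<in> set ss \<Longrightarrow> mset (tour t) = mset (leaf_darts t) + mset (map fst (tree_pairs t))" for ss :: "'a dart_tree list"
    using that by (induction ss) auto
  then show ?case using DNode by simp
qed simp

lemma mset_forest_tour:
  "mset (concat (map tour ts)) = mset (concat (map leaf_darts ts)) + mset (map fst (concat (map tree_pairs ts)))"
  by (induction ts) (auto simp: mset_tour)

lemma distinct_forest:
  assumes "distinct (concat (map tour ts))"
  shows "distinct (map fst (concat (map tree_pairs ts)))"
    "set (concat (map leaf_darts ts)) \<inter> fst ` set (concat (map tree_pairs ts)) = {}"
proof -
  have "mset (concat (map tour ts)) = mset (concat (map leaf_darts ts) @ map fst (concat (map tree_pairs ts)))"
    by (simp only: mset_forest_tour mset_append)
  then have "distinct (concat (map leaf_darts ts) @ map fst (concat (map tree_pairs ts)))"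
    using assms mset_eq_imp_distinct_iff by blast
  then show "distinct (map fst (concat (map tree_pairs ts)))"
    "set (concat (map leaf_darts ts)) \<inter> fst ` set (concat (map tree_pairs ts)) = {}"
    by (simp_all only: distinct_append set_map)
qed

lemma tree_pairs_sym: "(d, e) \<in> set (tree_pairs t) \<Longrightarrow> (e, d) \<in> set (tree_pairs t)"
  by (induction t) auto

lemma tree_pairs_colours:
  "(d, e) \<in> set (tree_pairs t) \<Longrightarrow> \<exists>c'. (d, c') \<in> set (coloured_tour c t) \<and> (e, flip c') \<in> set (coloured_tour c t)"
proof (induction c t rule: coloured_tour.induct)
  case (2 c d' u ts)
  consider "d = d'" "e = u" | "d = u" "e = d'" | t where "t \<in> set ts" "(d, e) \<in> set (tree_pairs t)"
    using 2 by auto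
  then show ?case
  proof cases
    case 3
    then obtain c' where "(d, c') \<in> set (coloured_tour (flip c) t)" "(e, flip c') \<in> set (coloured_tour (flip c) t)"
      using 2 by blast
    then show ?thesis using 3 by auto
  qed auto
qed simp

lemma node_cycles_coloured:
  "(c', xs) \<in> node_cycles c t \<Longrightarrow> x \<in> set xs \<Longrightarrow> (x, c') \<in> set (coloured_tour c t)"
proof (induction c t rule: node_cycles.induct)
  case (2 c d u ts)
  show ?case
  proof (cases "(c', xs) = (flip c, u # map top_dart ts)")
    case True
    then show ?thesis using 2(3) top_coloured by auto
  next
    case False
    then show ?thesis using 2 by auto
  qed
qed simp

lemma tour_node_cycles:
  "x \<in> set (tour t) \<Longrightarrow> x = top_dart t \<or> (\<exists>(c', xs)\<in>node_cycles c t. x \<in> set xs)"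
proof (induction c t rule: node_cycles.induct)
  case (2 c d u ts)
  consider "x = d" | "x = u" | t where "t \<in> set ts" "x \<in> set (tour t)" using 2(2) by auto
  then show ?case
  proof cases
    case 3
    then consider "x = top_dart t" | c' xs where "(c', xs) \<in> node_cycles (flip c) t" "x \<in> set xs" using 2(1) by blast
    then show ?thesis using 3(1) by cases force+
  qed auto
qed simp

lemma distinct_tops: "distinct (concat (map tour ts)) \<Longrightarrow> distinct (map top_dart ts) \<and> set (map top_dart ts) \<subseteq> set (concat (map tour ts))"
proof (induction ts)
  case (Cons t ts)
  then show ?case using top_dart_in_tour[of t] by auto
qed simp

lemma node_cycles_props:
  assumes "distinct (tour t)" "well_formed m c (shape c t)" "(c', xs) \<in> node_cycles c t"
  shows "distinct xs \<and> length xs = m"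
  using assms
proof (induction c t rule: node_cycles.induct)
  case (2 c d u ts)
  show ?case
  proof (cases "(c', xs) = (flip c, u # map top_dart ts)")
    case True
    then show ?thesis using 2 distinct_tops[of ts] by auto
  next
    case False
    then obtain t where t: "t \<in> set ts" "(c', xs) \<in> node_cycles (flip c) t" using 2(4) by auto
    moreover have "distinct (tour t)" using 2(2) t(1) by (auto simp: distinct_concat_iff)
    moreover have "well_formed m (flip c) (shape (flip c) t)" using 2(3) t(1) by auto
    ultimately show ?thesis using 2(1) by blast
  qed
qed simp

definition cyclic :: "('d \<Rightarrow> 'd) \<Rightarrow> 'd list \<Rightarrow> bool" where
  "cyclic f xs \<longleftrightarrow> xs \<noteq> [] \<and> successively (\<lambda>x y. y = f x) xs \<and> f (last xs) = hd xs"

lemma cyclic_funpow: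
  assumes "cyclic f xs" "j < length xs"
  shows "(f ^^ k) (xs ! j) = xs ! ((j + k) mod length xs)"
proof (induction k)
  case (Suc k)
  define l where "l = (j + k) mod length xs"
  have l: "l < length xs" unfolding l_def using assms(2) by (intro mod_less_divisor) linarith
  have "f (xs ! l) = xs ! (Suc l mod length xs)"
  proof (cases "Suc l = length xs")
    case True
    then have "l = length xs - 1" by simp
    then have "xs ! l = last xs" using assms by (simp add: last_conv_nth cyclic_def)
    then show ?thesis using assms True by (simp add: cyclic_def hd_conv_nth)
  next
    case False
    then show ?thesis using assms l by (simp add: cyclic_def successively_conv_nth)
  qed
  moreover have "Suc l mod length xs = (j + Suc k) mod length xs" by (simp add: l_def mod_Suc_eq)
  ultimately show ?case using Suc by (simp add: l_def)
qed (use assms in simp)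

lemma cyclic_period:
  assumes "cyclic f xs" "distinct xs" "length xs = m" "x \<in> set xs"
  shows "(f ^^ m) x = x" "0 < k \<Longrightarrow> k < m \<Longrightarrow> (f ^^ k) x \<noteq> x" "orbit f x = set xs"
proof -
  obtain j where j: "j < length xs" "xs ! j = x" using assms(4) by (auto simp: in_set_conv_nth)
  have pow: "(f ^^ k) x = xs ! ((j + k) mod m)" for k
    using cyclic_funpow[OF assms(1) j(1)] j(2) assms(3) by simp
  have m: "m > 0" using j assms(3) by auto
  show "(f ^^ m) x = x" using pow[of m] j assms(3) by simp
  show "(f ^^ k) x \<noteq> x" if "0 < k" "k < m" for k
  proof
    assume "(f ^^ k) x = x"
    then have "xs ! ((j + k) mod m) = xs ! j" using pow j by simp
    moreover have "(j + k) mod m < m" using m by (rule mod_less_divisor)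
    ultimately have "(j + k) mod m = j" using assms(2,3) j nth_eq_iff_index_eq by metis
    moreover have "(j + k) mod m = j + k - m" if "\<not> j + k < m"
      using that \<open>k < m\<close> j(1) assms(3) by (simp add: le_mod_geq)
    ultimately show False using that j(1) assms(3) by (cases "j + k < m") auto
  qed
  show "orbit f x = set xs"
  proof (intro equalityI subsetI)
    fix y assume "y \<in> orbit f x"
    then obtain n where "y = (f ^^ n) x" unfolding orbit_altdef by blast
    then have "y = xs ! ((j + n) mod m)" using pow[of n] by simp
    moreover have "(j + n) mod m < length xs" using m assms(3) by simp
    ultimately show "y \<in> set xs" by simp
  next
    fix y assume "y \<in> set xs"
    then obtain l where l: "l < m" "xs ! l = y" using assms(3) by (auto simp: in_set_conv_nth)
    have "(j + (m + l - j)) mod m = l" using l j assms(3) by simp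
    then have "y = (f ^^ (m + l - j)) x" using pow l by simp
    moreover have "0 < m + l - j" using j assms(3) by simp
    ultimately show "y \<in> orbit f x" unfolding orbit_altdef by blast
  qed
qed

lemma cyclic_child_list:
  assumes "cyclic f (u # xs)" "Suc (length xs) = m"
  shows "xs = map (\<lambda>k. (f ^^ k) u) [1..<m]"
proof (rule nth_equalityI)
  fix k assume k: "k < length xs"
  have "(f ^^ Suc k) ((u # xs) ! 0) = (u # xs) ! ((0 + Suc k) mod length (u # xs))"
    by (rule cyclic_funpow[OF assms(1)]) simp
  then show "xs ! k = map (\<lambda>k. (f ^^ k) u) [1..<m] ! k" using k assms(2)[symmetric] by (simp del: upt_Suc)
qed (use assms in auto)

definition precedes :: "'a list \<Rightarrow> 'a \<Rightarrow> 'a \<Rightarrow> bool" where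
  "precedes xs x y \<longleftrightarrow> (\<exists>A B C. xs = A @ x # B @ y # C)"

lemma precedes_Cons: "precedes (z # xs) x y \<longleftrightarrow> z = x \<and> y \<in> set xs \<or> precedes xs x y"
proof
  assume "precedes (z # xs) x y"
  then obtain A B C where "z # xs = A @ x # B @ y # C" by (auto simp: precedes_def)
  then show "z = x \<and> y \<in> set xs \<or> precedes xs x y"
    by (cases A) (auto simp: precedes_def)
next
  assume "z = x \<and> y \<in> set xs \<or> precedes xs x y"
  then show "precedes (z # xs) x y"
  proof
    assume *: "z = x \<and> y \<in> set xs"
    then obtain B C where "xs = B @ y # C" by (auto dest: split_list)
    then have "z # xs = [] @ x # B @ y # C" using * by simp
    then show ?thesis unfolding precedes_def by blast
  next
    assume "precedes xs x y"
    then obtain A B C where "xs = A @ x # B @ y # C" by (auto simp: precedes_def)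
    then have "z # xs = (z # A) @ x # B @ y # C" by simp
    then show ?thesis unfolding precedes_def by blast
  qed
qed

lemma precedes_Nil [simp]: "\<not> precedes [] x y"
  by (simp add: precedes_def)

lemma precedes_filter: "precedes (filter Q xs) x y \<longleftrightarrow> precedes xs x y \<and> Q x \<and> Q y"
  by (induction xs) (auto simp: precedes_Cons)

lemma precedes_map: "precedes (map f xs) u v \<longleftrightarrow> (\<exists>x y. f x = u \<and> f y = v \<and> precedes xs x y)"
  by (induction xs) (auto simp: precedes_Cons)

lemma precedes_in_set: "precedes xs x y \<Longrightarrow> x \<in> set xs \<and> y \<in> set xs"
  by (auto simp: precedes_def)

lemma precedes_nth: "precedes xs x y \<longleftrightarrow> (\<exists>i j. i < j \<and> j < length xs \<and> xs ! i = x \<and> xs ! j = y)"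
proof
  assume "precedes xs x y"
  then obtain A B C where "xs = A @ x # B @ y # C" by (auto simp: precedes_def)
  then show "\<exists>i j. i < j \<and> j < length xs \<and> xs ! i = x \<and> xs ! j = y"
    by (intro exI[of _ "length A"] exI[of _ "length A + Suc (length B)"]) (auto simp: nth_append)
next
  assume "\<exists>i j. i < j \<and> j < length xs \<and> xs ! i = x \<and> xs ! j = y"
  then obtain i j where ij: "i < j" "j < length xs" "xs ! i = x" "xs ! j = y" by blast
  have "xs = take i xs @ x # drop (Suc i) xs" using ij id_take_nth_drop[of i xs] by simp
  moreover have "y \<in> set (drop (Suc i) xs)"
    using ij by (auto simp: in_set_conv_nth intro!: exI[of _ "j - Suc i"])
  ultimately show "precedes xs x y" unfolding precedes_def by (metis split_list)
qed

lemma forward_precedes: "(c, d) \<in> forward w \<longleftrightarrow> precedes w (True, d) (False, c)"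
  by (induction w rule: forward.induct) (auto simp: precedes_Cons closings_def)

fun coloured_leaves :: "color \<Rightarrow> 'd dart_tree \<Rightarrow> (bool \<times> 'd) list" where
  "coloured_leaves c (DLeaf d) = [(c = White, d)]"
| "coloured_leaves c (DNode d u ts) = concat (map (coloured_leaves (flip c)) ts)"

text \<open>The root leaf is included as the initial opening letter, so the word has net 0 for a
  well-formed forest and is read from one unit below the height used for the tree.\<close>

definition leaf_list :: "'d \<Rightarrow> 'd dart_tree list \<Rightarrow> (bool \<times> 'd) list" where
  "leaf_list u ts = (True, u) # concat (map (coloured_leaves White) ts)"

definition forest_shape :: "'d dart_tree list \<Rightarrow> unit plane_tree" where
  "forest_shape ts = Node White (map (shape White) ts)"

lemma leaf_word_concat: "leaf_word (concat xss) = concat (map leaf_word xss)"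
  by (induction xss) (auto simp: leaf_word_def)

lemma map_fst_coloured_leaves: "map fst (coloured_leaves c t) = leaf_word (walk (shape c t))"
proof (induction c t rule: coloured_leaves.induct)
  case (1 c d)
  then show ?case by (simp add: leaf_word_def is_closing_def)
next
  case (2 c d u ts)
  then show ?case by (simp add: map_concat leaf_word_concat o_def cong: map_cong)
qed

lemma map_fst_leaf_list: "map fst (leaf_list u ts) = True # leaf_word (walk (forest_shape ts))"
  by (simp add: leaf_list_def forest_shape_def map_concat leaf_word_concat o_def map_fst_coloured_leaves)

lemma map_snd_coloured_leaves: "map snd (coloured_leaves c t) = leaf_darts t"
  by (induction c t rule: coloured_leaves.induct) (simp_all add: map_concat o_def cong: map_cong)

lemma map_snd_leaf_list: "map snd (leaf_list u ts) = u # concat (map leaf_darts ts)"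
  by (simp add: leaf_list_def map_concat o_def map_snd_coloured_leaves)

lemma coloured_leaves_tour:
  "(b, d) \<in> set (coloured_leaves c t) \<Longrightarrow> (d, if b then White else Black) \<in> set (coloured_tour c t)"
proof (induction c t rule: coloured_leaves.induct)
  case (1 c d)
  then show ?case by (cases c) auto
next
  case (2 c d' u ts)
  then obtain t where t: "t \<in> set ts" "(b, d) \<in> set (coloured_leaves (flip c) t)" by auto
  have "(d, if b then White else Black) \<in> set (coloured_tour (flip c) t)" by (rule 2(1)[OF t])
  then show ?case using t(1) by (simp only: coloured_tour.simps set_append set_concat set_map set_simps) blast
qed

lemma unfolds_unique:
  "unfolds f g m T t \<Longrightarrow> unfolds f g m T t' \<Longrightarrow> top_dart t = top_dart t' \<Longrightarrow> t = t'"
proof (induction t arbitrary: t')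
  case (DLeaf d)
  then show ?case by (cases t') auto
next
  case (DNode d u ts)
  then obtain ts' where t': "t' = DNode d u ts'" by (cases t') auto
  have "map top_dart ts = map top_dart ts'" using DNode.prems t' by simp
  then have "length ts = length ts'" by (metis length_map)
  then have "ts = ts'"
  proof (rule nth_equalityI)
    fix k assume k: "k < length ts"
    then have "top_dart (ts ! k) = top_dart (ts' ! k)"
      using \<open>map top_dart ts = map top_dart ts'\<close> \<open>length ts = length ts'\<close> by (metis nth_map)
    then show "ts ! k = ts' ! k" using DNode t' k \<open>length ts = length ts'\<close> by auto
  qed
  then show ?case using t' by simp
qed

lemma unfolds_forest_unique:
  assumes "\<forall>t\<in>set ts. unfolds f g m T t" "\<forall>t\<in>set ts'. unfolds f g m T t" "map top_dart ts = map top_dart ts'"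
  shows "ts = ts'"
proof (rule nth_equalityI)
  show len: "length ts = length ts'" using assms(3) by (metis length_map)
  fix k assume k: "k < length ts"
  then have "top_dart (ts ! k) = top_dart (ts' ! k)" using assms(3) len by (metis nth_map)
  then show "ts ! k = ts' ! k" using unfolds_unique[of f g m T] assms k len by (metis nth_mem)
qed

section \<open>From a map with a spanning tree to a tree with a matching\<close>

context spanned_map begin

lemma fits_unfolds: "fits P t \<Longrightarrow> unfolds rot opp m T t"
proof (induction t)
  case (DLeaf d)
  then have "d \<notin> T" using T_cases by auto
  then show ?case by simp
next
  case (DNode d u ts)
  then have "u \<in> P" "d = opp u" "u \<in> D" using P_D by auto
  then show ?case using DNode T_eq opp_opp by (auto simp: child_darts_def)
qed

lemma unfolds_rooted_at:
  assumes "\<forall>t\<in>set ts. unfolds rot opp m T t" "map top_dart ts = child_darts (rot r)"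
  shows "rooted_at ts"
proof -
  obtain ts' where ts': "rooted_at ts'" using rooted_at_exists by blast
  then have "ts = ts'"
    using unfolds_forest_unique[OF assms(1), of ts'] fits_unfolds assms(2) by (auto simp: rooted_at_def)
  then show ?thesis using ts' by simp
qed

lemma fits_children:
  assumes "fits P (DNode d u ts)" "t \<in> set ts"
  shows "top_dart t \<in> V u - {u}" "top_dart t \<in> W \<longleftrightarrow> u \<in> W"
proof -
  have u: "u \<in> D" using assms P_D by auto
  have "top_dart t \<in> set (child_darts u)" using assms by (metis fits.simps(2) imageI set_map)
  then show *: "top_dart t \<in> V u - {u}" using set_child_darts[OF u] by blast
  then have "V (top_dart t) = V u" "top_dart t \<in> D" using V_D[OF u] by (auto simp: in_V_iff)
  then show "top_dart t \<in> W \<longleftrightarrow> u \<in> W" using W_V by blast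
qed

lemma fits_coloured:
  "fits P t \<Longrightarrow> top_dart t \<in> W \<longleftrightarrow> c = White \<Longrightarrow> (x, c') \<in> set (coloured_tour c t) \<Longrightarrow> x \<in> W \<longleftrightarrow> c' = White"
proof (induction c t rule: coloured_tour.induct)
  case (2 c d u ts)
  have u: "u \<in> D" "d = opp u" using 2(2) P_D by auto
  have uW: "u \<in> W \<longleftrightarrow> flip c = White" using 2(3) opp_W[OF u(1)] u(2) by (cases c) auto
  consider "x = d" "c' = c" | "x = u" "c' = flip c" | t where "t \<in> set ts" "(x, c') \<in> set (coloured_tour (flip c) t)"
    using 2(4) by auto
  then show ?case
  proof cases
    case 3
    then show ?thesis using 2(1)[OF 3(1)] 2(2) fits_children(2)[OF 2(2) 3(1)] uW by simp
  qed (use uW 2(3) in auto)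
qed auto

lemma fits_tree_pairs: "fits P t \<Longrightarrow> (d, e) \<in> set (tree_pairs t) \<Longrightarrow> d \<in> T \<and> e = opp d"
proof (induction t)
  case (DNode d' u ts)
  have "u \<in> D" "u \<in> P" "d' = opp u" using DNode.prems P_D by auto
  then show ?case using DNode T_eq opp_opp by auto
qed simp

lemma fits_leaf_darts: "fits P t \<Longrightarrow> leaf_darts t = filter (\<lambda>d. d \<notin> T) (tour t)"
proof (induction t)
  case (DLeaf d)
  then show ?case using T_cases by auto
next
  case (DNode d u ts)
  have "u \<in> T" "d \<in> T" using DNode.prems T_eq by auto
  moreover have "concat (map leaf_darts ts) = filter (\<lambda>d. d \<notin> T) (concat (map tour ts))"
    using DNode by (simp add: filter_concat o_def cong: map_cong)
  ultimately show ?case by simp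
qed

lemma fits_is_node: "fits P t \<Longrightarrow> is_node (shape c t) \<longleftrightarrow> opp (top_dart t) \<in> P"
  using opp_opp P_D by (cases t) (auto simp: is_node_def)

lemma length_white_children:
  assumes u: "u \<in> W" "u \<in> P \<or> u = rot r" and tops: "map top_dart ts = child_darts u" and fits: "\<forall>t\<in>set ts. fits P t"
  shows "length (filter is_node (map (shape White) ts)) = 1"
proof -
  have uD: "u \<in> D" using u W_D by blast
  have "length (filter is_node (map (shape White) ts)) = length (filter (\<lambda>t. is_node (shape White t)) ts)"
    by (simp add: filter_map o_def)
  also have "filter (\<lambda>t. is_node (shape White t)) ts = filter (\<lambda>t. opp (top_dart t) \<in> P) ts"
    using fits fits_is_node by (intro filter_cong) auto
  also have "length \<dots> = length (filter (\<lambda>x. opp x \<in> P) (map top_dart ts))"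
    by (simp add: filter_map o_def)
  also have "\<dots> = length (filter (\<lambda>x. opp x \<in> P) (child_darts u))" unfolding tops ..
  also have "\<dots> = card {x \<in> set (child_darts u). opp x \<in> P}"
  proof -
    have "distinct (child_darts u)"
      unfolding child_darts_def distinct_map
      by (intro conjI distinct_upt inj_on_subset[OF inj_on_rot_pow[OF uD]]) auto
    then show ?thesis by (simp add: distinct_length_filter Int_def conj_commute)
  qed
  also have "{x \<in> set (child_darts u). opp x \<in> P} = {x. x \<in> V u \<and> opp x \<in> P}"
  proof -
    \<comment> \<open>The dart \<open>u\<close>, missing from \<open>child_darts u\<close>, must not
      lead to a child: either it is the parent dart, or it is \<open>rot r\<close>, which is
      cut.\<close>
    have "opp u \<notin> P"
    proof (cases "u \<in> P")
      case True
      then show ?thesis using arborescence_opp[OF arborescence] by blast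
    next
      case False
      then have "u = rot r" using u by blast
      then have "opp (opp u) \<notin> opp ` P" using rot_r_notin_T T_eq opp_opp[OF uD] by auto
      then show ?thesis by blast
    qed
    then show ?thesis using set_child_darts[OF uD] by auto
  qed
  also have "card \<dots> = 1"
  proof -
    have ex: "\<exists>!e. e \<in> V u \<and> opp e \<in> P" by (rule spanning_white_child[OF spanning arborescence T_eq u(1)])
    then obtain e where "{x. x \<in> V u \<and> opp x \<in> P} = {e}" by auto
    then show ?thesis by simp
  qed
  finally show ?thesis .
qed

lemma fits_well_formed:
  "fits P t \<Longrightarrow> top_dart t \<in> W \<longleftrightarrow> c = White \<Longrightarrow> well_formed m c (shape c t)"
proof (induction c t rule: shape.induct)
  case (1 c d)
  then show ?case by (cases c) auto
next
  case (2 c d u ts)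
  have u: "u \<in> D" "u \<in> P" "d = opp u" using 2(2) P_D by auto
  have uW: "u \<in> W \<longleftrightarrow> flip c = White" using 2(3) opp_W[OF u(1)] u(3) by (cases c) auto
  have ts: "map top_dart ts = child_darts u" "\<forall>t\<in>set ts. fits P t" using 2(2) by auto
  have "length ts = m - 1" using arg_cong[OF ts(1), of length] by (simp add: child_darts_def)
  moreover have "length (filter is_node (map (shape (flip c)) ts)) = 1" if "flip c = White"
    using length_white_children[of u ts] uW u(2) ts that by simp
  moreover have "well_formed m (flip c) (shape (flip c) t)" if "t \<in> set ts" for t
    using 2(1)[OF that] ts(2) fits_children(2)[OF 2(2) that] uW that by simp
  ultimately show ?case using m_ge by auto
qed

text \<open>A black vertex is counted by its parent dart, which occurs in the tour of the subtree
  hanging from it.\<close>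

lemma fits_black_nodes:
  "fits P t \<Longrightarrow> top_dart t \<in> W \<longleftrightarrow> c = White \<Longrightarrow>
   black_nodes (shape c t) = length (filter (\<lambda>x. x \<in> P \<and> x \<notin> W) (tour t))"
proof (induction c t rule: shape.induct)
  case (2 c d u ts)
  have u: "u \<in> D" "u \<in> P" "d = opp u" using 2(2) P_D by auto
  have uW: "u \<in> W \<longleftrightarrow> flip c = White" using 2(3) opp_W[OF u(1)] u(3) by (cases c) auto
  have dP: "d \<notin> P" using arborescence_opp[OF arborescence u(2)] u(3) by simp
  have "sum_list (map black_nodes (map (shape (flip c)) ts)) =
      (\<Sum>t\<leftarrow>ts. length (filter (\<lambda>x. x \<in> P \<and> x \<notin> W) (tour t)))"
    unfolding map_map o_def
    using 2(1) 2(2) fits_children(2)[OF 2(2)] uW by (intro arg_cong[of _ _ sum_list] map_cong refl) auto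
  also have "\<dots> = length (filter (\<lambda>x. x \<in> P \<and> x \<notin> W) (concat (map tour ts)))"
    by (simp add: filter_concat length_concat o_def)
  finally show ?case using u uW dP by (cases c) auto
qed auto

context
  fixes ts assumes ts: "rooted_at ts"
begin

lemma root_fits: "t \<in> set ts \<Longrightarrow> fits P t" and root_tops: "map top_dart ts = child_darts (rot r)"
  using ts by (auto simp: rooted_at_def)

lemma root_top_W: "t \<in> set ts \<Longrightarrow> top_dart t \<in> W"
proof -
  assume "t \<in> set ts"
  then have "top_dart t \<in> set (child_darts (rot r))" unfolding root_tops[symmetric] by simp
  then show ?thesis using set_child_darts[OF rot_D[OF r_D]] V_rot V_W[OF r_W] by blast
qed

lemma rot_r_W: "rot r \<in> W" using rot_W[OF r_D] r_W by blast

text \<open>The last child dart of the root vertex is \<open>r\<close>, the only tree dart there;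
  this is why the node-child of the root node is rightmost.\<close>

lemma well_formed_forest_shape:
  "well_formed m Black (forest_shape ts)" "is_node (last (map (shape White) ts))"
proof -
  have "length ts = m - 1" using arg_cong[OF root_tops, of length] by (simp add: child_darts_def)
  moreover have "length (filter is_node (map (shape White) ts)) = 1"
    using length_white_children[OF rot_r_W _ root_tops] root_fits by blast
  moreover have "well_formed m White (shape White t)" if "t \<in> set ts" for t
    using fits_well_formed[OF root_fits[OF that], of White] root_top_W[OF that] by simp
  ultimately show "well_formed m Black (forest_shape ts)" using m_ge by (auto simp: forest_shape_def)
  have ne: "ts \<noteq> []" using root_tops child_darts_neq[of "rot r"] by auto
  have "top_dart (last ts) = last (child_darts (rot r))"
    using last_map[OF ne, of top_dart] root_tops by simp
  then have "rot (top_dart (last ts)) = rot r" using rot_last_child_darts[OF rot_D[OF r_D]] by simp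
  then have "top_dart (last ts) = r" by (rule rot_inj)
  moreover have "opp r \<in> P" using root_T root_P T_cases self_V by blast
  ultimately show "is_node (last (map (shape White) ts))"
    using fits_is_node[OF root_fits, of "last ts" White] ne by (simp add: last_map)
qed

lemma black_nodes_forest_shape: "black_nodes (forest_shape ts) = card (V ` (D - W))"
proof -
  have "black_nodes (forest_shape ts) = (\<Sum>t\<leftarrow>ts. length (filter (\<lambda>x. x \<in> P \<and> x \<notin> W) (tour t)))"
    unfolding forest_shape_def using fits_black_nodes[OF root_fits, of _ White] root_top_W
    by (simp add: o_def cong: map_cong)
  also have "\<dots> = length (filter (\<lambda>x. x \<in> P \<and> x \<notin> W) (concat (map tour ts)))"
    by (simp add: filter_concat length_concat o_def)
  also have "\<dots> = length (filter (\<lambda>x. x \<in> P \<and> x \<notin> W) (root_tour ts))"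
    using rot_r_notin_T T_eq by (simp add: root_tour_def)
  also have "\<dots> = card {x \<in> D. x \<in> P \<and> x \<notin> W}"
    using distinct_length_filter[OF distinct_root_tour[OF ts]] set_root_tour[OF ts] by (simp add: Int_def conj_commute)
  also have "{x \<in> D. x \<in> P \<and> x \<notin> W} = {p \<in> P \<inter> D. p \<notin> W}" by blast
  also have "card \<dots> = card (V ` (D - W))" by (rule card_black_parents) (use rot_D in auto)
  finally show ?thesis .
qed

lemma snd_leaf_list: "map snd (leaf_list (rot r) ts) = filter (\<lambda>d. d \<notin> T) (root_tour ts)"
proof -
  have "concat (map leaf_darts ts) = filter (\<lambda>d. d \<notin> T) (concat (map tour ts))"
    using fits_leaf_darts root_fits by (simp add: filter_concat o_def cong: map_cong)
  then show ?thesis using rot_r_notin_T by (simp add: map_snd_leaf_list root_tour_def)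
qed

lemma leaf_list_colour: "(b, d) \<in> set (leaf_list (rot r) ts) \<Longrightarrow> b \<longleftrightarrow> d \<in> W"
proof -
  assume "(b, d) \<in> set (leaf_list (rot r) ts)"
  then consider "b" "d = rot r" | t where "t \<in> set ts" "(b, d) \<in> set (coloured_leaves White t)"
    by (auto simp: leaf_list_def)
  then show ?thesis
  proof cases
    case 2
    then have "(d, if b then White else Black) \<in> set (coloured_tour White t)" by (intro coloured_leaves_tour)
    then show ?thesis using fits_coloured[OF root_fits[OF 2(1)]] root_top_W[OF 2(1)] by (auto split: if_splits)
  qed (use rot_r_W in simp)
qed

lemma leaf_list_openings: "openings (leaf_list (rot r) ts) = W - T"
  and leaf_list_closings: "closings (leaf_list (rot r) ts) = D - W - T"
proof -
  have s: "snd ` set (leaf_list (rot r) ts) = D - T"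
    using arg_cong[OF snd_leaf_list, of set] set_root_tour[OF ts] by auto
  have "d \<in> openings (leaf_list (rot r) ts) \<longleftrightarrow> d \<in> D - T \<and> d \<in> W" for d
    unfolding openings_def s[symmetric] using leaf_list_colour by force
  then show "openings (leaf_list (rot r) ts) = W - T" using W_D by blast
  have "d \<in> closings (leaf_list (rot r) ts) \<longleftrightarrow> d \<in> D - T \<and> d \<notin> W" for d
    unfolding closings_def s[symmetric] using leaf_list_colour by force
  then show "closings (leaf_list (rot r) ts) = D - W - T" by blast
qed

lemma forward_leaf_list:
  "(c, d) \<in> forward (leaf_list (rot r) ts) \<longleftrightarrow>
    d \<in> W \<and> c \<notin> W \<and> c \<notin> T \<and> d \<notin> T \<and> precedes (root_tour ts) d c"
proof -
  have "precedes (leaf_list (rot r) ts) (True, d) (False, c) \<longleftrightarrow>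
      d \<in> W \<and> c \<notin> W \<and> precedes (map snd (leaf_list (rot r) ts)) d c"
    unfolding precedes_map using precedes_in_set leaf_list_colour
    by (metis (full_types) prod.collapse prod.sel(2))
  then show ?thesis unfolding forward_precedes snd_leaf_list precedes_filter by blast
qed

lemma valid_precedes:
  "valid T \<longleftrightarrow> (\<forall>d\<in>W. d \<notin> T \<longrightarrow> d \<notin> K \<longrightarrow> precedes (root_tour ts) d (opp d))"
proof -
  have "precedes (root_tour ts) d e \<longleftrightarrow> (\<exists>i j. i < j \<and> j < card D \<and> visit T i = d \<and> visit T j = e)" for d e
    unfolding precedes_nth length_root_tour[OF ts]
    using nth_root_tour[OF ts] by (metis order.strict_trans)
  then show ?thesis by (simp add: valid_def)
qed

text \<open>Reading off the matching: \<open>opp\<close> pairs black with white ends of cut edges,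
  marked edges keep their multiplicities and the others get 0. Validity supplies the condition on
  the value 0.\<close>

lemma word_matchings_of_map:
  fixes e :: "'d \<Rightarrow> nat"
  assumes valid: "valid T" and e: "\<And>d. d \<in> K \<Longrightarrow> e d \<ge> 1" "sum e K \<le> x"
  defines "C \<equiv> closings (leaf_list (rot r) ts)"
  shows "(restrict opp C, restrict (\<lambda>c. if opp c \<in> K then e (opp c) else 0) C) \<in> word_matchings (leaf_list (rot r) ts) x"
proof -
  have C: "C = D - W - T" by (simp add: C_def leaf_list_closings)
  have img: "opp ` C = W - T"
  proof (intro equalityI subsetI)
    fix d assume "d \<in> opp ` C"
    then show "d \<in> W - T" using opp_W opp_T_iff by (auto simp: C)
  next
    fix d assume d: "d \<in> W - T"
    then have dD: "d \<in> D" using W_D by blast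
    then have "opp d \<in> C" using d opp_W[OF dD] opp_T_iff[OF dD] opp_D[OF dD] by (auto simp: C)
    then have "opp (opp d) \<in> opp ` C" by blast
    then show "d \<in> opp ` C" using opp_opp[OF dD] by simp
  qed
  have bij: "bij_betw (restrict opp C) C (W - T)"
    using img inj_opp[of C] by (simp add: bij_betw_def inj_on_restrict_eq image_restrict_eq)
  have "sum (restrict (\<lambda>c. if opp c \<in> K then e (opp c) else 0) C) C = (\<Sum>c\<in>C. if opp c \<in> K then e (opp c) else 0)"
    by (intro sum.cong) auto
  also have "\<dots> = (\<Sum>d\<in>W - T. if d \<in> K then e d else 0)"
    using sum.reindex[OF inj_opp, of "\<lambda>d. if d \<in> K then e d else 0" C] img by (simp add: o_def)
  also have "\<dots> = sum e K"
  proof -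
    have "K \<subseteq> W - T" using K_W notin_K by blast
    moreover have "finite (W - T)" using finite_subset[OF W_D finite_D] by simp
    ultimately show ?thesis by (intro sum.mono_neutral_cong_right) auto
  qed
  finally have sum: "sum (restrict (\<lambda>c. if opp c \<in> K then e (opp c) else 0) C) C \<le> x" using e(2) by simp
  have "(c, opp c) \<in> forward (leaf_list (rot r) ts)"
    if c: "c \<in> C" "(if opp c \<in> K then e (opp c) else 0) = 0" for c
  proof -
    have cD: "c \<in> D" "c \<notin> W" "c \<notin> T" using c by (auto simp: C)
    have "opp c \<notin> K" using c(2) e(1)[of "opp c"] by (auto split: if_splits)
    moreover have "opp c \<in> W" "opp c \<notin> T" using img c(1) by auto
    ultimately have "precedes (root_tour ts) (opp c) (opp (opp c))" using valid valid_precedes by blast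
    then show ?thesis unfolding forward_leaf_list using cD \<open>opp c \<in> W\<close> \<open>opp c \<notin> T\<close> opp_opp[OF cD(1)] by simp
  qed
  then show ?thesis
    unfolding word_matchings_def matchings_def C_def[symmetric] leaf_list_openings
    using bij sum by auto
qed

end

end

section \<open>Recovering the rotation from the order of a tour\<close>

lemma chain_forest:
  assumes "successively (\<lambda>x y. y = nx x) (concat (map tour ts))" "ts \<noteq> []"
    "\<And>t. t \<in> set ts \<Longrightarrow> successively (\<lambda>x y. y = nx x) (tour t) \<Longrightarrow> nx (last (tour t)) = f (top_dart t)"
  shows "successively (\<lambda>x y. y = f x) (map top_dart ts) \<and> hd (concat (map tour ts)) = top_dart (hd ts) \<and>
    nx (last (concat (map tour ts))) = f (top_dart (last ts)) \<and> concat (map tour ts) \<noteq> []"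
  using assms
proof (induction ts)
  case (Cons t ts)
  have ne: "tour t \<noteq> []" "hd (tour t) = top_dart t" by (cases t; simp)+
  have s: "successively (\<lambda>x y. y = nx x) (tour t)" using Cons.prems(1) by (simp add: successively_append_iff)
  have l: "nx (last (tour t)) = f (top_dart t)" using Cons.prems(3)[of t] s by simp
  show ?case
  proof (cases "ts = []")
    case True
    then show ?thesis using ne l by simp
  next
    case False
    have IH: "successively (\<lambda>x y. y = f x) (map top_dart ts) \<and> hd (concat (map tour ts)) = top_dart (hd ts) \<and>
      nx (last (concat (map tour ts))) = f (top_dart (last ts)) \<and> concat (map tour ts) \<noteq> []"
      using Cons.prems False by (intro Cons.IH) (auto simp: successively_append_iff)
    then have "hd (concat (map tour ts)) = nx (last (tour t))"
      using Cons.prems(1) ne by (auto simp: successively_append_iff)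
    then have "top_dart (hd ts) = f (top_dart t)" using IH l by simp
    then show ?thesis using IH ne False by (simp add: successively_Cons hd_map)
  qed
qed simp

text \<open>A walk is the rotation applied after passing to the other end of a tree edge. As
  \<open>partner\<close> is an involution, the rotation is \<open>nx\<close> after
  \<open>partner\<close>; a subtree is left at the dart that returns to its top, so consecutive
  children become consecutive around the parent.\<close>

lemma chain_cycles:
  assumes "successively (\<lambda>x y. y = nx x) (tour t)" "\<And>d. f d = nx (partner d)"
    "\<And>d e. (d, e) \<in> set (tree_pairs t) \<Longrightarrow> partner d = e" "\<And>d. d \<in> set (leaf_darts t) \<Longrightarrow> partner d = d"
    "well_formed m c (shape c t)" "m \<ge> 2"
  shows "nx (last (tour t)) = f (top_dart t) \<and> (\<forall>(c', xs)\<in>node_cycles c t. cyclic f xs)"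
  using assms
proof (induction c t rule: node_cycles.induct)
  case (2 c d u ts)
  have p: "partner d = u" "partner u = d" using 2(4) by auto
  have wf: "\<forall>t\<in>set ts. well_formed m (flip c) (shape (flip c) t)" "ts \<noteq> []" using 2(6,7) by auto
  have ne: "concat (map tour ts) \<noteq> []"
  proof -
    have "tour (hd ts) \<noteq> []" by (cases "hd ts") auto
    then show ?thesis using wf(2) by (cases ts) auto
  qed
  have s: "successively (\<lambda>x y. y = nx x) (concat (map tour ts))"
    and hd: "hd (concat (map tour ts)) = nx d" and last: "u = nx (last (concat (map tour ts)))"
    using 2(2) ne by (auto simp: successively_Cons successively_append_iff)
  have IH: "nx (last (tour t)) = f (top_dart t) \<and> (\<forall>(c', xs)\<in>node_cycles (flip c) t. cyclic f xs)"
    if t: "t \<in> set ts" and succ: "successively (\<lambda>x y. y = nx x) (tour t)" for t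
  proof (rule 2(1)[OF t succ])
    show "f d = nx (partner d)" for d by (rule 2(3))
    show "partner d = e" if "(d, e) \<in> set (tree_pairs t)" for d e using 2(4)[of d e] t that by auto
    show "partner d = d" if "d \<in> set (leaf_darts t)" for d using 2(5)[of d] t that by auto
    show "well_formed m (flip c) (shape (flip c) t)" using wf(1) t by blast
    show "m \<ge> 2" by (rule 2(7))
  qed
  have st: "successively (\<lambda>x y. y = nx x) (tour t)" if t: "t \<in> set ts" for t
  proof -
    obtain A B where "ts = A @ t # B" using split_list[OF t] by blast
    then show ?thesis using s by (simp add: successively_append_iff)
  qed
  have ch: "successively (\<lambda>x y. y = f x) (map top_dart ts) \<and> hd (concat (map tour ts)) = top_dart (hd ts) \<and>
    nx (last (concat (map tour ts))) = f (top_dart (last ts)) \<and> concat (map tour ts) \<noteq> []"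
    by (rule chain_forest[OF s wf(2)]) (use IH in auto)
  have fu: "f u = top_dart (hd ts)" using 2(3)[of u] p hd ch by simp
  have "cyclic f (u # map top_dart ts)"
    using ch fu last wf(2) by (auto simp: cyclic_def successively_Cons hd_map last_map)
  moreover have "nx (last (tour (DNode d u ts))) = f d" using 2(3)[of d] p by simp
  ultimately show ?case using IH st by auto
next
  case (1 c d)
  then show ?case by simp
qed

lemma unfolds_of_cycles:
  assumes "\<forall>(c', xs)\<in>node_cycles c t. cyclic f xs" "well_formed m c (shape c t)"
    "\<And>d e. (d, e) \<in> set (tree_pairs t) \<Longrightarrow> d \<in> T \<and> g d = e" "\<And>d. d \<in> set (leaf_darts t) \<Longrightarrow> d \<notin> T"
  shows "unfolds f g m T t"
  using assms
proof (induction c t rule: node_cycles.induct)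
  case (2 c d u ts)
  have "cyclic f (u # map top_dart ts)" "Suc (length ts) = m" using 2 by auto
  then have "map top_dart ts = map (\<lambda>k. (f ^^ k) u) [1..<m]" by (intro cyclic_child_list) auto
  moreover have "unfolds f g m T t" if t: "t \<in> set ts" for t
  proof (rule 2(1)[OF t])
    show "\<forall>(c', xs)\<in>node_cycles (flip c) t. cyclic f xs" using 2(2) t by auto
    show "well_formed m (flip c) (shape (flip c) t)" using 2(3) t by auto
    show "d \<in> T \<and> g d = e" if "(d, e) \<in> set (tree_pairs t)" for d e using 2(4)[of d e] t that by auto
    show "d \<notin> T" if "d \<in> set (leaf_darts t)" for d using 2(5)[of d] t that by auto
  qed
  moreover have "d \<in> T" "g d = u" using 2(4)[of d u] by auto
  ultimately show ?case by simp
qed simp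

lemma card_tree_tops:
  assumes "distinct (map top_dart ts)"
    "\<And>t d e. t \<in> set ts \<Longrightarrow> (d, e) \<in> set (tree_pairs t) \<Longrightarrow> d \<in> T"
    "\<And>t d. t \<in> set ts \<Longrightarrow> d \<in> set (leaf_darts t) \<Longrightarrow> d \<notin> T"
  shows "card (set (map top_dart ts) \<inter> T) = length (filter is_node (map (shape c) ts))"
proof -
  have top: "top_dart t \<in> T \<longleftrightarrow> is_node (shape c t)" if "t \<in> set ts" for t
    using assms(2,3)[OF that] by (cases t) (auto simp: is_node_def)
  have "set (map top_dart ts) \<inter> T = set (filter (\<lambda>x. x \<in> T) (map top_dart ts))" by auto
  also have "card \<dots> = length (filter (\<lambda>x. x \<in> T) (map top_dart ts))"
    using assms(1) by (intro distinct_card distinct_filter)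
  also have "\<dots> = length (filter (\<lambda>t. top_dart t \<in> T) ts)" by (simp add: filter_map o_def)
  also have "filter (\<lambda>t. top_dart t \<in> T) ts = filter (\<lambda>t. is_node (shape c t)) ts"
    using top by (intro filter_cong) auto
  finally show ?thesis by (simp add: filter_map o_def)
qed

text \<open>The two tree darts of a white node are its parent dart and the top dart of its single
  node-child.\<close>

lemma node_cycles_degree:
  assumes "(White, xs) \<in> node_cycles c t" "distinct (tour t)" "well_formed m c (shape c t)"
    "\<And>d e. (d, e) \<in> set (tree_pairs t) \<Longrightarrow> d \<in> T" "\<And>d. d \<in> set (leaf_darts t) \<Longrightarrow> d \<notin> T"
  shows "card (set xs \<inter> T) = 2"
  using assms
proof (induction c t rule: node_cycles.induct)
  case (2 c d u ts)
  have dis: "distinct (concat (map tour ts))" "u \<notin> set (concat (map tour ts))" using 2(3) by auto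
  show ?case
  proof (cases "(White, xs) = (flip c, u # map top_dart ts)")
    case True
    have "u \<in> T" using 2(5)[of u d] by auto
    moreover have "u \<notin> set (map top_dart ts)" using dis distinct_tops by blast
    moreover have "card (set (map top_dart ts) \<inter> T) = length (filter is_node (map (shape White) ts))"
      using distinct_tops[OF dis(1)] 2(5,6) by (intro card_tree_tops) auto
    moreover have "length (filter is_node (map (shape White) ts)) = 1" using 2(4) True by auto
    ultimately have "card (insert u (set (map top_dart ts) \<inter> T)) = 2" by (subst card_insert_disjoint) auto
    moreover have "set xs \<inter> T = insert u (set (map top_dart ts) \<inter> T)" using True \<open>u \<in> T\<close> by auto
    ultimately show ?thesis by simp
  next
    case False
    then obtain t where t: "t \<in> set ts" "(White, xs) \<in> node_cycles (flip c) t" using 2(2) by auto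
    moreover have "distinct (tour t)" using dis(1) t(1) by (auto simp: distinct_concat_iff)
    moreover have "well_formed m (flip c) (shape (flip c) t)" using 2(4) t(1) by auto
    ultimately show ?thesis using 2(1)[of t] 2(5,6) t(1) by auto
  qed
qed simp

text \<open>The value \<open>v x\<close> plays the role of the vertex of \<open>x\<close>: it is
  constant on node cycles, and \<open>R\<close> follows tree edges, so every dart is connected to
  the top by climbing.\<close>

lemma tour_reach:
  assumes "\<And>c' xs x y. (c', xs) \<in> node_cycles c t \<Longrightarrow> x \<in> set xs \<Longrightarrow> y \<in> set xs \<Longrightarrow> v x = v y"
    "\<And>d e. (d, e) \<in> set (tree_pairs t) \<Longrightarrow> (v d, v e) \<in> R" "x \<in> set (tour t)"
  shows "(v x, v (top_dart t)) \<in> R\<^sup>*"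
  using assms
proof (induction c t arbitrary: x rule: node_cycles.induct)
  case (2 c d u ts)
  have ud: "(v u, v d) \<in> R" using 2(3)[of u d] by auto
  consider "x = d" | "x = u" | t where "t \<in> set ts" "x \<in> set (tour t)" using 2(4) by auto
  then show ?case
  proof cases
    case 3
    have "(v x, v (top_dart t)) \<in> R\<^sup>*"
    proof (rule 2(1)[OF 3(1) _ _ 3(2)])
      show "v x = v y" if "(c', xs) \<in> node_cycles (flip c) t" "x \<in> set xs" "y \<in> set xs" for c' xs x y
        using 2(2)[of c' xs x y] that 3(1) by auto
      show "(v d, v e) \<in> R" if "(d, e) \<in> set (tree_pairs t)" for d e using 2(3)[of d e] that 3(1) by auto
    qed
    moreover have "v (top_dart t) = v u"
      using 2(2)[of "flip c" "u # map top_dart ts" "top_dart t" u] 3(1) by simp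
    ultimately show ?thesis using ud by (simp add: rtrancl.rtrancl_into_rtrancl)
  qed (use ud in auto)
qed simp

section \<open>Closing a tree\<close>

text \<open>Here \<open>u0\<close> is the dart of the root leaf and \<open>ts\<close> are the
  subtrees of the root node. From these and a matching a map is built in which the given tree
  reappears as the valid spanning tree.\<close>

locale planted =
  fixes u0 :: 'd and ts :: "'d dart_tree list" and m :: nat and p :: "'d \<Rightarrow> 'd" and e :: "'d \<Rightarrow> nat" and x :: nat
  assumes distinct_L: "distinct (u0 # concat (map tour ts))"
    and well_formed: "well_formed m Black (forest_shape ts)"
    and last_node: "is_node (last (map (shape White) ts))"
    and m_ge3: "m \<ge> 3"
    and matching: "(p, e) \<in> word_matchings (leaf_list u0 ts) x"
begin

definition L where "L = u0 # concat (map tour ts)"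
definition CT where "CT = (u0, White) # concat (map (coloured_tour White) ts)"
definition TP where "TP = concat (map tree_pairs ts)"
definition pD where "pD = set L"
definition pW where "pW = {d. (d, White) \<in> set CT}"
definition pT where "pT = fst ` set TP"
definition C where "C = closings (leaf_list u0 ts)"
definition Op where "Op = openings (leaf_list u0 ts)"
text \<open>An edge is marked exactly if its multiplicity is positive, and the mark is put on its
  white dart.\<close>

definition pK where "pK = p ` {c \<in> C. e c > 0}"
definition partner where "partner d = (case map_of TP d of None \<Rightarrow> d | Some d' \<Rightarrow> d')"
definition popp where
  "popp d = (if d \<in> pT then partner d else if d \<in> C then p d else if d \<in> Op then inv_into C p d else d)"
definition nx where "nx = cycle_of_list L"
text \<open>The cyclic order of the tour is to be the walk \<open>turn pT\<close>, that is, the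
  rotation after \<open>partner\<close>; solving for the rotation gives this formula.\<close>

definition prot where "prot d = nx (partner d)"
definition pr where "pr = top_dart (last ts)"

lemma length_ts: "Suc (length ts) = m" using well_formed by (simp add: forest_shape_def)

lemma ts_neq: "ts \<noteq> []" using length_ts m_ge3 by auto

lemma wf_ts: "t \<in> set ts \<Longrightarrow> well_formed m White (shape White t)"
  using well_formed by (auto simp: forest_shape_def)

lemma map_fst_CT: "map fst CT = L"
  by (simp add: CT_def L_def map_concat o_def map_fst_coloured_tour)

lemma colour_unique: "(d, c) \<in> set CT \<Longrightarrow> (d, c') \<in> set CT \<Longrightarrow> c = c'"
  using distinct_L map_fst_CT eq_key_imp_eq_value[of CT] unfolding L_def by metis

lemma in_pD: "d \<in> pD \<longleftrightarrow> (\<exists>c. (d, c) \<in> set CT)"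
  unfolding pD_def map_fst_CT[symmetric] by force

lemma colour: "(d, c) \<in> set CT \<Longrightarrow> d \<in> pW \<longleftrightarrow> c = White"
  using colour_unique by (auto simp: pW_def)

lemma pW_pD: "pW \<subseteq> pD" by (auto simp: pW_def in_pD)

lemma forest_leaves: "set (map snd (leaf_list u0 ts)) = insert u0 (set (concat (map leaf_darts ts)))"
  by (simp only: map_snd_leaf_list set_simps)

lemma distinct_concat_tour: "distinct (concat (map tour ts))" "u0 \<notin> set (concat (map tour ts))"
  using distinct_L by auto

lemma pT_sub: "pT \<subseteq> set (concat (map tour ts))"
  using tree_pairs_tour by (fastforce simp: pT_def TP_def)

lemma pD_split: "pD = pT \<union> snd ` set (leaf_list u0 ts)" "pT \<inter> snd ` set (leaf_list u0 ts) = {}"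
proof -
  have l: "snd ` set (leaf_list u0 ts) = insert u0 (set (concat (map leaf_darts ts)))"
    using forest_leaves by simp
  have "set (concat (map tour ts)) = set (concat (map leaf_darts ts)) \<union> pT"
    unfolding pT_def TP_def by (auto simp: tour_decomp)
  then show "pD = pT \<union> snd ` set (leaf_list u0 ts)" unfolding l by (auto simp: pD_def L_def)
  show "pT \<inter> snd ` set (leaf_list u0 ts) = {}"
    unfolding l using distinct_forest(2)[OF distinct_concat_tour(1)] distinct_concat_tour(2) pT_sub
    unfolding pT_def TP_def by blast
qed

lemma leaf_colour: "(b, d) \<in> set (leaf_list u0 ts) \<Longrightarrow> d \<in> pW \<longleftrightarrow> b"
proof -
  assume bd: "(b, d) \<in> set (leaf_list u0 ts)"
  have "(d, if b then White else Black) \<in> set CT"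
  proof (cases "(b, d) = (True, u0)")
    case False
    then obtain t where "t \<in> set ts" "(b, d) \<in> set (coloured_leaves White t)"
      using bd by (auto simp: leaf_list_def)
    then show ?thesis using coloured_leaves_tour[of b d White t] unfolding CT_def by (auto simp del: split_paired_All)
  qed (simp add: CT_def)
  then show ?thesis using colour by (auto split: if_splits)
qed

lemma C_eq: "C = pD - pT - pW" and Op_eq: "Op = pW - pT"
proof -
  have l: "snd ` set (leaf_list u0 ts) = pD - pT" using pD_split by blast
  have "d \<in> C \<longleftrightarrow> d \<in> pD - pT \<and> d \<notin> pW" for d
    unfolding C_def closings_def l[symmetric] using leaf_colour by force
  then show "C = pD - pT - pW" by blast
  have "d \<in> Op \<longleftrightarrow> d \<in> pD - pT \<and> d \<in> pW" for d
    unfolding Op_def openings_def l[symmetric] using leaf_colour by force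
  then show "Op = pW - pT" using pW_pD by blast
qed

lemma p_bij: "bij_betw p C Op"
  using matching by (auto simp: word_matchings_def matchings_def C_def Op_def)

lemma partner_TP: "(d, d') \<in> set TP \<Longrightarrow> partner d = d'"
  using distinct_forest(1)[OF distinct_concat_tour(1)] unfolding partner_def TP_def[symmetric] by simp

lemma TP_sym: "(d, d') \<in> set TP \<Longrightarrow> (d', d) \<in> set TP"
  using tree_pairs_sym unfolding TP_def by fastforce

lemma TP_colour:
  assumes "(d, d') \<in> set TP"
  shows "d' \<in> pW \<longleftrightarrow> d \<notin> pW" "d \<in> pT" "d' \<in> pT"
proof -
  obtain t where t: "t \<in> set ts" "(d, d') \<in> set (tree_pairs t)" using assms by (auto simp: TP_def)
  obtain c where "(d, c) \<in> set (coloured_tour White t)" "(d', flip c) \<in> set (coloured_tour White t)"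
    using tree_pairs_colours[OF t(2)] by blast
  then have "(d, c) \<in> set CT" "(d', flip c) \<in> set CT" using t(1) by (auto simp: CT_def)
  then show "d' \<in> pW \<longleftrightarrow> d \<notin> pW" using colour[of d c] colour[of d' "flip c"] by (cases c) auto
  show "d \<in> pT" "d' \<in> pT" using assms TP_sym[OF assms] by (force simp: pT_def)+
qed

lemma partner_notin: "d \<notin> pT \<Longrightarrow> partner d = d"
proof -
  assume "d \<notin> pT"
  then have "map_of TP d = None" by (simp add: pT_def map_of_eq_None_iff)
  then show ?thesis by (simp add: partner_def)
qed

lemma pT_TP: "d \<in> pT \<Longrightarrow> (d, partner d) \<in> set TP"
  using partner_TP by (auto simp: pT_def)

lemma partner_in: "d \<in> pT \<Longrightarrow> partner d \<in> pT" "d \<in> pT \<Longrightarrow> partner (partner d) = d"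
  using pT_TP TP_colour TP_sym partner_TP by blast+

lemma partner_invol: "partner (partner d) = d"
  using partner_in partner_notin by (cases "d \<in> pT") auto

lemma pT_pD: "pT \<subseteq> pD" using pD_split by blast

lemma partner_permutes: "partner permutes pD"
proof (rule bij_imp_permutes)
  have "partner d \<in> pD" if "d \<in> pD" for d
    using that partner_in(1) partner_notin pT_pD by (cases "d \<in> pT") auto
  then show "bij_betw partner pD pD"
    by (intro bij_betw_byWitness[of _ partner]) (auto simp: partner_invol)
  show "partner d = d" if "d \<notin> pD" for d using that pT_pD partner_notin by blast
qed

lemma nx_permutes: "nx permutes pD"
  unfolding nx_def pD_def by (rule cycle_permutes)

lemma prot_permutes: "prot permutes pD"
  using permutes_compose[OF partner_permutes nx_permutes] by (simp add: prot_def[abs_def] o_def)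

lemma popp_pT: "d \<in> pT \<Longrightarrow> popp d = partner d" by (simp add: popp_def)

lemma popp_C: "d \<in> C \<Longrightarrow> popp d = p d \<and> popp d \<in> Op \<and> popp (popp d) = d"
  using p_bij C_eq Op_eq bij_betw_apply[OF p_bij, of d] bij_betw_inv_into_left[OF p_bij, of d]
  by (auto simp: popp_def)

lemma popp_Op: "d \<in> Op \<Longrightarrow> popp d \<in> C \<and> popp (popp d) = d"
proof -
  assume "d \<in> Op"
  then obtain c where c: "c \<in> C" "d = p c" using p_bij by (auto simp: bij_betw_def)
  then have "popp c = d" using popp_C by simp
  then show ?thesis using popp_C[OF c(1)] c(1) by auto
qed

lemma pD_cases: "d \<in> pD \<Longrightarrow> d \<in> pT \<or> d \<in> C \<or> d \<in> Op"
  using C_eq Op_eq by blast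

lemma popp_props:
  assumes "d \<in> pD"
  shows "popp d \<in> pD" "popp (popp d) = d" "popp d \<in> pW \<longleftrightarrow> d \<notin> pW"
proof -
  have "popp d \<in> pD \<and> popp (popp d) = d \<and> (popp d \<in> pW \<longleftrightarrow> d \<notin> pW)"
    using pD_cases[OF assms]
  proof (elim disjE)
    assume d: "d \<in> pT"
    then show ?thesis using popp_pT partner_in[OF d] pT_pD TP_colour(1)[OF pT_TP[OF d]] by auto
  next
    assume "d \<in> C"
    then show ?thesis using popp_C[of d] C_eq Op_eq pW_pD by auto
  next
    assume "d \<in> Op"
    then show ?thesis using popp_Op[of d] C_eq Op_eq by auto
  qed
  then show "popp d \<in> pD" "popp (popp d) = d" "popp d \<in> pW \<longleftrightarrow> d \<notin> pW" by auto
qed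

lemma popp_permutes: "popp permutes pD"
proof (rule bij_imp_permutes)
  show "bij_betw popp pD pD"
    by (intro bij_betw_byWitness[of _ popp]) (auto simp: popp_props)
  show "popp d = d" if "d \<notin> pD" for d
    using that pT_pD C_eq Op_eq pW_pD by (auto simp: popp_def)
qed

lemma cyclic_L: "cyclic nx L"
proof -
  have "map (nx ^^ 1) L = rotate 1 L" unfolding nx_def
    by (rule cyclic_rotation) (use distinct_L in \<open>simp add: L_def\<close>)
  then have "map nx L = rotate1 L" by simp
  then have n: "nx (L ! k) = L ! (Suc k mod length L)" if "k < length L" for k
    using that nth_rotate1[of k L] by (metis nth_map)
  have ne: "L \<noteq> []" by (simp add: L_def)
  have "nx (last L) = hd L" using n[of "length L - 1"] ne by (simp add: last_conv_nth hd_conv_nth)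
  then show ?thesis using n ne by (simp add: cyclic_def successively_conv_nth)
qed

definition cycles :: "(color \<times> 'd list) set" where
  "cycles = insert (White, u0 # map top_dart ts) (\<Union>t\<in>set ts. node_cycles White t)"

lemma sub_forest:
  assumes "t \<in> set ts"
  shows "(d, d') \<in> set (tree_pairs t) \<Longrightarrow> (d, d') \<in> set TP" "d \<in> set (leaf_darts t) \<Longrightarrow> d \<notin> pT"
    "distinct (tour t)"
proof -
  show "(d, d') \<in> set (tree_pairs t) \<Longrightarrow> (d, d') \<in> set TP" using assms by (auto simp: TP_def)
  show "d \<notin> pT" if "d \<in> set (leaf_darts t)"
  proof -
    have "d \<in> set (concat (map leaf_darts ts))" using that assms by auto
    then have "d \<in> snd ` set (leaf_list u0 ts)" using forest_leaves by simp
    then show ?thesis using pD_split(2) by blast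
  qed
  show "distinct (tour t)" using distinct_concat_tour(1) assms by (auto simp: distinct_concat_iff)
qed

text \<open>The tour closes up at \<open>u0\<close>, so the chain argument around the root node ends
  where it began.\<close>

lemma cyclic_root: "cyclic prot (u0 # map top_dart ts)"
  and cyclic_node: "t \<in> set ts \<Longrightarrow> (c, xs) \<in> node_cycles White t \<Longrightarrow> cyclic prot xs"
proof -
  have L: "successively (\<lambda>x y. y = nx x) L" "nx (last L) = u0" using cyclic_L by (auto simp: cyclic_def L_def)
  have ne: "concat (map tour ts) \<noteq> []"
  proof -
    have "tour (hd ts) \<noteq> []" by (cases "hd ts") auto
    then show ?thesis using ts_neq by (cases ts) auto
  qed
  have s: "successively (\<lambda>x y. y = nx x) (concat (map tour ts))" "hd (concat (map tour ts)) = nx u0"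
    and last: "nx (last (concat (map tour ts))) = u0"
    using L ne by (auto simp: L_def successively_Cons split: if_splits)
  have key: "nx (last (tour t)) = prot (top_dart t) \<and> (\<forall>(c', xs)\<in>node_cycles White t. cyclic prot xs)"
    if t: "t \<in> set ts" "successively (\<lambda>x y. y = nx x) (tour t)" for t
    by (rule chain_cycles[OF t(2), where partner = partner])
       (use sub_forest[OF t(1)] partner_TP partner_notin wf_ts[OF t(1)] m_ge3 in \<open>auto simp: prot_def\<close>)
  have ch: "successively (\<lambda>x y. y = prot x) (map top_dart ts) \<and> hd (concat (map tour ts)) = top_dart (hd ts) \<and>
    nx (last (concat (map tour ts))) = prot (top_dart (last ts)) \<and> concat (map tour ts) \<noteq> []"
    by (rule chain_forest[OF s(1) ts_neq]) (use key in blast)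
  have "u0 \<notin> pT" using pT_sub distinct_concat_tour(2) by blast
  then have "prot u0 = top_dart (hd ts)" using ch s(2) partner_notin by (simp add: prot_def)
  then show "cyclic prot (u0 # map top_dart ts)"
    using ch last ts_neq by (auto simp: cyclic_def successively_Cons hd_map last_map)
  show "cyclic prot xs" if t: "t \<in> set ts" "(c, xs) \<in> node_cycles White t"
  proof -
    obtain A B where "ts = A @ t # B" using split_list[OF t(1)] by blast
    then have "successively (\<lambda>x y. y = nx x) (tour t)" using s(1) by (simp add: successively_append_iff)
    then show ?thesis using key[OF t(1)] t(2) by blast
  qed
qed

lemma cycles_props:
  assumes "(c, xs) \<in> cycles"
  shows "cyclic prot xs" "distinct xs" "length xs = m" "d \<in> set xs \<Longrightarrow> (d, c) \<in> set CT"
proof -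
  have "cyclic prot xs \<and> distinct xs \<and> length xs = m \<and> (\<forall>d\<in>set xs. (d, c) \<in> set CT)"
  proof (cases "(c, xs) = (White, u0 # map top_dart ts)")
    case True
    have "distinct (map top_dart ts)" "u0 \<notin> set (map top_dart ts)"
      using distinct_tops[OF distinct_concat_tour(1)] distinct_concat_tour(2) by blast+
    moreover have "(top_dart t, White) \<in> set CT" if "t \<in> set ts" for t
      using that top_coloured[of t White] by (auto simp: CT_def)
    moreover have "(u0, White) \<in> set CT" by (simp add: CT_def)
    ultimately show ?thesis using True cyclic_root length_ts by auto
  next
    case False
    then obtain t where t: "t \<in> set ts" "(c, xs) \<in> node_cycles White t" using assms by (auto simp: cycles_def)
    then show ?thesis
      using cyclic_node[OF t] node_cycles_props[OF sub_forest(3)[OF t(1)] wf_ts[OF t(1)] t(2)]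
        node_cycles_coloured[OF t(2)] by (auto simp: CT_def)
  qed
  then show "cyclic prot xs" "distinct xs" "length xs = m" "d \<in> set xs \<Longrightarrow> (d, c) \<in> set CT" by auto
qed

lemma cycles_cover:
  assumes "d \<in> pD"
  shows "\<exists>(c, xs)\<in>cycles. d \<in> set xs"
proof (cases "d = u0")
  case True
  then show ?thesis by (auto simp: cycles_def)
next
  case False
  then obtain t where t: "t \<in> set ts" "d \<in> set (tour t)" using assms by (auto simp: pD_def L_def)
  then have "d = top_dart t \<or> (\<exists>(c', xs)\<in>node_cycles White t. d \<in> set xs)" by (intro tour_node_cycles)
  then show ?thesis using t(1) by (force simp: cycles_def)
qed

lemma cycle_of_dart:
  assumes "d \<in> pD"
  obtains c xs where "(c, xs) \<in> cycles" "d \<in> set xs"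
  using cycles_cover[OF assms] by blast

lemma pr_props: "pr \<in> set (map top_dart ts)" "prot pr = u0" "pr \<in> pT" "(pr, White) \<in> set CT"
proof -
  have l: "last ts \<in> set ts" using ts_neq by simp
  then show "pr \<in> set (map top_dart ts)" by (simp add: pr_def)
  show "prot pr = u0" using cyclic_root ts_neq by (simp add: cyclic_def pr_def last_map)
  have "is_node (shape White (last ts))" using last_node ts_neq by (simp add: last_map)
  then obtain d u us where n: "last ts = DNode d u us" by (cases "last ts") (auto simp: is_node_def)
  then have "(d, u) \<in> set TP" using sub_forest(1)[OF l, of d u] by simp
  then show "pr \<in> pT" using TP_colour(2) n by (simp add: pr_def)
  show "(pr, White) \<in> set CT" using l top_coloured[of "last ts" White] by (auto simp: CT_def pr_def)
qed

lemma pK_sub: "pK \<subseteq> Op"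
  using p_bij by (auto simp: pK_def bij_betw_def)

sublocale bipartite_map pD prot popp m pW pr pK
proof
  show "finite pD" by (simp add: pD_def)
  show "prot permutes pD" "popp permutes pD" by (rule prot_permutes popp_permutes)+
  show "popp d \<noteq> d" if "d \<in> pD" for d using popp_props(3)[OF that] by auto
  show "popp (popp d) = d" "popp d \<in> pW \<longleftrightarrow> d \<notin> pW" if "d \<in> pD" for d
    using popp_props[OF that] by auto
  show "(prot ^^ m) d = d" if "d \<in> pD" for d
  proof -
    obtain c xs where c: "(c, xs) \<in> cycles" "d \<in> set xs" using cycle_of_dart[OF \<open>d \<in> pD\<close>] .
    show ?thesis by (rule cyclic_period(1)[OF cycles_props(1-3)[OF c(1)] c(2)])
  qed
  show "(prot ^^ k) d \<noteq> d" if "d \<in> pD" "0 < k" "k < m" for d k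
  proof -
    obtain c xs where c: "(c, xs) \<in> cycles" "d \<in> set xs" using cycle_of_dart[OF \<open>d \<in> pD\<close>] .
    show ?thesis by (rule cyclic_period(2)[OF cycles_props(1-3)[OF c(1)] c(2) that(2,3)])
  qed
  show "pW \<subseteq> pD" by (rule pW_pD)
  show "prot d \<in> pW \<longleftrightarrow> d \<in> pW" if "d \<in> pD" for d
  proof -
    obtain c xs where c: "(c, xs) \<in> cycles" "d \<in> set xs" using cycle_of_dart[OF \<open>d \<in> pD\<close>] .
    have "prot d \<in> orbit prot d" by (rule orbit.base)
    then have "prot d \<in> set xs" using cyclic_period(3)[OF cycles_props(1-3)[OF c(1)] c(2)] by simp
    then show ?thesis using colour cycles_props(4)[OF c(1)] c(2) by blast
  qed
  show "pr \<in> pW" using pr_props(4) by (simp add: pW_def)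
  show "pK \<subseteq> pW" using pK_sub Op_eq by blast
  show "2 \<le> m" using m_ge3 by simp
qed

lemma V_cycle: "(c, xs) \<in> cycles \<Longrightarrow> d \<in> set xs \<Longrightarrow> V d = set xs"
  unfolding V_def using cyclic_period(3)[OF cycles_props(1-3)] by blast

lemma u0_props: "u0 \<notin> pT" "V u0 = insert u0 (set (map top_dart ts))" "V pr = V u0"
proof -
  show "u0 \<notin> pT" using pT_sub distinct_concat_tour(2) by blast
  have c: "(White, u0 # map top_dart ts) \<in> cycles" by (simp add: cycles_def)
  show "V u0 = insert u0 (set (map top_dart ts))" using V_cycle[OF c, of u0] by simp
  show "V pr = V u0" using V_cycle[OF c, of pr] V_cycle[OF c, of u0] pr_props(1) by simp
qed

lemma spanning_pT: "spanning pT"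
  unfolding spanning_def
proof (intro conjI ballI impI)
  show "pT \<subseteq> pD" by (rule pT_pD)
  show "popp d \<in> pT" if "d \<in> pT" for d using that popp_pT partner_in by simp
  show "pT \<inter> pK = {}" using pK_sub Op_eq by blast
  have tops: "V (top_dart t) = V u0" if "t \<in> set ts" for t
  proof -
    have c: "(White, u0 # map top_dart ts) \<in> cycles" by (simp add: cycles_def)
    show ?thesis using V_cycle[OF c, of "top_dart t"] V_cycle[OF c, of u0] that by simp
  qed
  show "(V d, V pr) \<in> (links pT)\<^sup>*" if dD: "d \<in> pD" for d
  proof (cases "d = u0")
    case True
    then show ?thesis using u0_props(3) by simp
  next
    case False
    then obtain t where t: "t \<in> set ts" "d \<in> set (tour t)" using dD by (auto simp: pD_def L_def)
    have "(V d, V (top_dart t)) \<in> (links pT)\<^sup>*"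
    proof (rule tour_reach[OF _ _ t(2)])
      show "V x = V y" if "(c', xs) \<in> node_cycles White t" "x \<in> set xs" "y \<in> set xs" for c' xs x y
      proof -
        have "(c', xs) \<in> cycles" using that t(1) by (auto simp: cycles_def)
        then show ?thesis using V_cycle that by blast
      qed
      show "(V x, V y) \<in> links pT" if "(x, y) \<in> set (tree_pairs t)" for x y
      proof -
        have "(x, y) \<in> set TP" using sub_forest(1)[OF t(1) that] .
        then have "x \<in> pT" "popp x = y" using TP_colour popp_pT partner_TP by auto
        then show ?thesis by (auto simp: links_def)
      qed
    qed
    then show ?thesis using tops[OF t(1)] u0_props(3) by simp
  qed
  have disj: "d \<in> pT" if "t \<in> set ts" "(d, d') \<in> set (tree_pairs t)" for t d d'
    using sub_forest(1)[OF that] TP_colour(2) by blast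
  show "V pr \<inter> pT = {pr}"
  proof -
    have "card (set (map top_dart ts) \<inter> pT) = length (filter is_node (map (shape White) ts))"
      using distinct_tops[OF distinct_concat_tour(1)] disj sub_forest(2) by (intro card_tree_tops) auto
    also have "\<dots> = 1" using well_formed by (simp add: forest_shape_def)
    finally obtain a where a: "set (map top_dart ts) \<inter> pT = {a}" by (auto simp: card_1_singleton_iff)
    have "pr \<in> set (map top_dart ts) \<inter> pT" using pr_props by blast
    then have "set (map top_dart ts) \<inter> pT = {pr}" unfolding a by simp
    then show ?thesis using u0_props by auto
  qed
  show "card (V d \<inter> pT) = 2" if d: "d \<in> pW" "V d \<noteq> V pr" for d
  proof -
    have dD: "d \<in> pD" using d pW_pD by blast
    obtain c xs where c: "(c, xs) \<in> cycles" "d \<in> set xs" using cycle_of_dart[OF dD] .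
    have "c = White" using cycles_props(4)[OF c] colour d(1) by blast
    have Vd: "V d = set xs" by (rule V_cycle[OF c])
    have "(c, xs) \<noteq> (White, u0 # map top_dart ts)" using Vd d(2) u0_props by auto
    then obtain t where t: "t \<in> set ts" "(White, xs) \<in> node_cycles White t"
      using c(1) \<open>c = White\<close> by (auto simp: cycles_def)
    show ?thesis unfolding Vd
      by (rule node_cycles_degree[OF t(2) sub_forest(3)[OF t(1)] wf_ts[OF t(1)]])
         (use disj[OF t(1)] sub_forest(2)[OF t(1)] in auto)
  qed
qed

text \<open>The forest \<open>ts\<close> unfolds along \<open>prot\<close>, \<open>popp\<close> and
  \<open>pT\<close>, so by uniqueness of unfoldings it is the forest of the constructed map.
  Validity holds because an unmarked edge has multiplicity 0 and hence is a pair of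
  \<open>forward\<close>.\<close>

lemma planted_map:
  obtains P h where "spanned_map pD prot popp m pW pr pK pT P h"
    "spanned_map.rooted_at pD prot popp m pr P ts" "valid pT"
proof -
  obtain P h where sp: "spanned_map pD prot popp m pW pr pK pT P h" using spanned_mapI[OF spanning_pT] .
  interpret S: spanned_map pD prot popp m pW pr pK pT P h by (rule sp)
  have r: "prot pr = u0" by (rule pr_props)
  have tops: "map top_dart ts = child_darts (prot pr)"
    unfolding r child_darts_def using length_ts by (intro cyclic_child_list[OF cyclic_root]) simp
  have rooted: "S.rooted_at ts"
  proof (rule S.unfolds_rooted_at[OF _ tops], rule ballI)
    fix t assume t: "t \<in> set ts"
    show "unfolds prot popp m pT t"
    proof (rule unfolds_of_cycles[OF _ wf_ts[OF t]])
      show "\<forall>(c', xs)\<in>node_cycles White t. cyclic prot xs" using cyclic_node[OF t] by blast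
      show "d \<in> pT \<and> popp d = d'" if "(d, d') \<in> set (tree_pairs t)" for d d'
        using sub_forest(1)[OF t that] TP_colour(2) popp_pT partner_TP by auto
      show "d \<notin> pT" if "d \<in> set (leaf_darts t)" for d by (rule sub_forest(2)[OF t that])
    qed
  qed
  have "valid pT"
    unfolding S.valid_precedes[OF rooted]
  proof (intro ballI impI)
    fix d assume d: "d \<in> pW" "d \<notin> pT" "d \<notin> pK"
    then have "d \<in> Op" using Op_eq by blast
    then obtain c where c: "c \<in> C" "d = p c" using p_bij by (auto simp: bij_betw_def)
    then have "e c = 0" using d(3) by (auto simp: pK_def)
    then have "(c, d) \<in> forward (leaf_list u0 ts)"
      using matching c by (auto simp: word_matchings_def matchings_def C_def)
    then have "precedes (S.root_tour ts) d c" using S.forward_leaf_list[OF rooted] r by simp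
    moreover have "popp d = c" using popp_C[OF c(1)] c(2) by metis
    ultimately show "precedes (S.root_tour ts) d (popp d)" by simp
  qed
  then show ?thesis using that sp rooted by blast
qed

lemma multiplicities:
  "\<And>d. d \<in> pK \<Longrightarrow> e (popp d) \<ge> 1" "sum (\<lambda>d. e (popp d)) pK \<le> x"
proof -
  have pc: "popp (p c) = c" if "c \<in> C" for c using popp_C[OF that] by metis
  show "e (popp d) \<ge> 1" if "d \<in> pK" for d using that pc by (auto simp: pK_def)
  have finC: "finite C" by (simp add: C_def)
  have "inj_on p {c \<in> C. e c > 0}" using p_bij by (auto simp: bij_betw_def inj_on_def)
  then have "sum (\<lambda>d. e (popp d)) pK = (\<Sum>c\<in>{c \<in> C. e c > 0}. e (popp (p c)))"
    unfolding pK_def by (subst sum.reindex) (auto simp: o_def)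
  also have "\<dots> = (\<Sum>c\<in>{c \<in> C. e c > 0}. e c)" using pc by (intro sum.cong) auto
  also have "\<dots> \<le> sum e C" using finC by (intro sum_mono2) auto
  also have "\<dots> \<le> x" using matching by (simp add: word_matchings_def matchings_def C_def)
  finally show "sum (\<lambda>d. e (popp d)) pK \<le> x" .
qed

end

section \<open>Isomorphisms\<close>

text \<open>Everything about spanning trees is defined from these six data, so it is carried along
  \<open>f\<close>; applied to valid trees, this lets the uniqueness theorem compare the trees of
  two isomorphic maps.\<close>

locale isomorphic_maps =
  A: bipartite_map D rot opp m W r K + B: bipartite_map D' rot' opp' m W' r' K'
  for D :: "'a set" and rot opp m W r K and D' :: "'b set" and rot' opp' W' r' K' +
  fixes f :: "'a \<Rightarrow> 'b"
  assumes bij: "bij_betw f D D'"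
    and rot_f: "d \<in> D \<Longrightarrow> f (rot d) = rot' (f d)"
    and opp_f: "d \<in> D \<Longrightarrow> f (opp d) = opp' (f d)"
    and W_f: "W' = f ` W" and r_f: "r' = f r" and K_f: "K' = f ` K"
begin

lemma inj_f: "inj_on f D" and image_f: "D' = f ` D"
  using bij by (auto simp: bij_betw_def)

lemma rot_pow_f: "d \<in> D \<Longrightarrow> f ((rot ^^ k) d) = (rot' ^^ k) (f d)"
  by (induction k) (auto simp: rot_f A.rot_pow_D)

lemma V_f: "d \<in> D \<Longrightarrow> B.V (f d) = f ` A.V d"
proof -
  assume d: "d \<in> D"
  then have "f d \<in> D'" using image_f by blast
  then have "B.V (f d) = (\<lambda>k. (rot' ^^ k) (f d)) ` {..<m}" by (rule B.V_altdef)
  also have "\<dots> = f ` A.V d" unfolding A.V_altdef[OF d] image_image using rot_pow_f[OF d] by simp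
  finally show ?thesis .
qed

lemma spanning_f:
  assumes T: "A.spanning T"
  shows "B.spanning (f ` T)"
proof -
  have TD: "T \<subseteq> D" using T by (simp add: A.spanning_def)
  have int: "f ` S \<inter> f ` T = f ` (S \<inter> T)" if "S \<subseteq> D" for S
    using inj_on_image_Int[OF inj_f that TD] by simp
  have VD: "A.V d \<subseteq> D" if "d \<in> D" for d by (rule A.V_D[OF that])
  show ?thesis
    unfolding B.spanning_def
  proof (intro conjI ballI impI)
    show "f ` T \<subseteq> D'" using TD image_f by blast
    show "opp' d \<in> f ` T" if "d \<in> f ` T" for d
    proof -
      obtain c where c: "c \<in> T" "d = f c" using \<open>d \<in> f ` T\<close> by blast
      have "opp c \<in> T" using T c by (simp add: A.spanning_def)
      moreover have "opp' d = f (opp c)" using opp_f[of c] c TD by auto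
      ultimately show ?thesis by blast
    qed
    have "T \<inter> K = {}" using T by (simp add: A.spanning_def)
    moreover have "K \<subseteq> D" using A.K_W A.W_D by blast
    ultimately show "f ` T \<inter> K' = {}" using int[of K] by (auto simp: K_f Int_commute)
    show "(B.V d, B.V r') \<in> (B.links (f ` T))\<^sup>*" if "d \<in> D'" for d
    proof -
      obtain c where c: "c \<in> D" "d = f c" using \<open>d \<in> D'\<close> image_f by blast
      have "(A.V c, A.V r) \<in> (A.links T)\<^sup>*" using T c by (simp add: A.spanning_def)
      moreover have "(f ` v, f ` w) \<in> B.links (f ` T)" if "(v, w) \<in> A.links T" for v w
      proof -
        obtain z where z: "z \<in> T" "v = A.V z" "w = A.V (opp z)" using \<open>(v, w) \<in> A.links T\<close> by (auto simp: A.links_def)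
        then have "z \<in> D" using TD by blast
        then have "f ` v = B.V (f z)" "f ` w = B.V (opp' (f z))"
          using z V_f[of z] V_f[of "opp z"] opp_f[of z] A.opp_D by auto
        then show ?thesis using z(1) unfolding B.links_def by blast
      qed
      ultimately have "(f ` A.V c, f ` A.V r) \<in> (B.links (f ` T))\<^sup>*"
        by (induction rule: rtrancl_induct) (auto intro: rtrancl.rtrancl_into_rtrancl)
      then show ?thesis using V_f c A.r_D r_f by simp
    qed
    show "card (B.V d \<inter> f ` T) = 2" if d: "d \<in> W'" "B.V d \<noteq> B.V r'" for d
    proof -
      obtain c where c: "c \<in> W" "d = f c" using d W_f by blast
      then have cD: "c \<in> D" using A.W_D by blast
      have "A.V c \<noteq> A.V r" using d(2) V_f[OF cD] V_f[OF A.r_D] c r_f by auto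
      then have "card (A.V c \<inter> T) = 2" using T c unfolding A.spanning_def by blast
      moreover have "B.V d \<inter> f ` T = f ` (A.V c \<inter> T)" using V_f[OF cD] c int[OF VD[OF cD]] by simp
      moreover have "card (f ` (A.V c \<inter> T)) = card (A.V c \<inter> T)"
        using inj_f TD by (intro card_image) (auto intro: inj_on_subset)
      ultimately show ?thesis by simp
    qed
    have "A.V r \<inter> T = {r}" using T by (simp add: A.spanning_def)
    then show "B.V r' \<inter> f ` T = {r'}" using V_f[OF A.r_D] int[OF VD[OF A.r_D]] r_f by simp
  qed
qed

lemma visit_f:
  assumes "A.spanning T"
  shows "A.visit T k \<in> D" "B.visit (f ` T) k = f (A.visit T k)"
proof -
  have TD: "T \<subseteq> D" using assms by (simp add: A.spanning_def)
  have "A.visit T k \<in> D \<and> B.visit (f ` T) k = f (A.visit T k)"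
  proof (induction k)
    case 0
    show ?case unfolding A.visit_0 B.visit_0 using A.rot_D[OF A.r_D] rot_f[OF A.r_D] r_f by simp
  next
    case (Suc k)
    let ?v = "A.visit T k"
    have v: "?v \<in> D" "B.visit (f ` T) k = f ?v" using Suc by auto
    have "f ?v \<in> f ` T \<longleftrightarrow> ?v \<in> T" using inj_on_image_mem_iff[OF inj_f v(1) TD] .
    then show ?case using v A.opp_D[of ?v] A.rot_D[of ?v] A.rot_D[of "opp ?v"] rot_f[of ?v] rot_f[of "opp ?v"] opp_f[of ?v]
      by (simp add: A.visit_Suc B.visit_Suc A.turn_def B.turn_def)
  qed
  then show "A.visit T k \<in> D" "B.visit (f ` T) k = f (A.visit T k)" by auto
qed

lemma valid_f:
  assumes T: "A.spanning T" and valid: "A.valid T"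
  shows "B.valid (f ` T)"
  unfolding B.valid_def
proof (intro ballI impI)
  have TD: "T \<subseteq> D" using T by (simp add: A.spanning_def)
  have card: "card D' = card D" using bij by (simp add: bij_betw_same_card)
  fix d assume d: "d \<in> W'" "d \<notin> f ` T" "d \<notin> K'"
  then obtain c where c: "c \<in> W" "d = f c" using W_f by blast
  then have "c \<notin> T" "c \<notin> K" using d K_f by auto
  then obtain i j where ij: "i < j" "j < card D" "A.visit T i = c" "A.visit T j = opp c"
    using valid c(1) unfolding A.valid_def by blast
  have "c \<in> D" using c A.W_D by blast
  then show "\<exists>i j. i < j \<and> j < card D' \<and> B.visit (f ` T) i = d \<and> B.visit (f ` T) j = opp' d"
    using ij visit_f(2)[OF T] c opp_f card by (intro exI[of _ i] exI[of _ j]) simp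
qed

lemma top_dart_map: "top_dart (map_dart_tree f t) = f (top_dart t)"
  by (cases t) auto

lemma unfolds_f:
  assumes "unfolds rot opp m T t" "T \<subseteq> D" "set (tour t) \<subseteq> D"
  shows "unfolds rot' opp' m (f ` T) (map_dart_tree f t)"
  using assms
proof (induction t)
  case (DLeaf d)
  then show ?case using inj_on_image_mem_iff[OF inj_f _ DLeaf.prems(2), of d] by simp
next
  case (DNode d u ts)
  have du: "d \<in> D" "u \<in> D" "u = opp d" "d \<in> T" using DNode.prems by auto
  have tops: "map top_dart ts = map (\<lambda>k. (rot ^^ k) u) [1..<m]" using DNode.prems by simp
  have "map top_dart (map (map_dart_tree f) ts) = map f (map top_dart ts)" by (simp add: top_dart_map)
  also have "\<dots> = map (\<lambda>k. (rot' ^^ k) (f u)) [1..<m]" unfolding tops using rot_pow_f[OF du(2)] by simp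
  finally have "map top_dart (map (map_dart_tree f) ts) = map (\<lambda>k. (rot' ^^ k) (f u)) [1..<m]" .
  moreover have "unfolds rot' opp' m (f ` T) (map_dart_tree f t)" if "t \<in> set ts" for t
    by (rule DNode.IH[OF that]) (use DNode.prems that in auto)
  ultimately show ?case using du opp_f[OF du(1)] by simp
qed

end

lemma tour_map_dart_tree: "tour (map_dart_tree f t) = map f (tour t)"
  by (induction t) (simp_all add: map_concat o_def cong: map_cong)

lemma shape_map: "shape c (map_dart_tree f t) = shape c t"
  by (induction c t rule: shape.induct) (simp_all add: o_def cong: map_cong)

lemma forest_shape_map: "forest_shape (map (map_dart_tree f) ts) = forest_shape ts"
  by (simp add: forest_shape_def o_def shape_map)

lemma coloured_leaves_map: "coloured_leaves c (map_dart_tree f t) = map (map_prod id f) (coloured_leaves c t)"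
  by (induction c t rule: coloured_leaves.induct) (simp_all add: map_concat o_def cong: map_cong)

lemma leaf_list_map: "leaf_list (f u) (map (map_dart_tree f) ts) = map (map_prod id f) (leaf_list u ts)"
  by (simp add: leaf_list_def coloured_leaves_map map_concat o_def)

lemma coloured_tour_map: "coloured_tour c (map_dart_tree f t) = map (map_prod f id) (coloured_tour c t)"
  by (induction c t rule: coloured_tour.induct) (simp_all add: map_concat o_def cong: map_cong)

lemma tree_pairs_map: "tree_pairs (map_dart_tree f t) = map (map_prod f f) (tree_pairs t)"
  by (induction t rule: tree_pairs.induct) (simp_all add: map_concat o_def cong: map_cong)

text \<open>Trees of equal shape differ only by their labels in tour order. The claim is for every
  \<open>f\<close>, so that a single relabelling of a whole forest serves all its subtrees.\<close>

lemma shape_eq_relabel: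
  fixes t :: "'a dart_tree" and t' :: "'b dart_tree"
  shows "shape c t = shape c t' \<Longrightarrow> length (tour t) = length (tour t') \<and> (\<forall>f. map f (tour t) = tour t' \<longrightarrow> map_dart_tree f t = t')"
proof (induction c t arbitrary: t' rule: shape.induct)
  case (1 c d)
  then show ?case by (cases t') auto
next
  case (2 c d u ts)
  then obtain d' u' ts' where t': "t' = DNode d' u' ts'" "map (shape (flip c)) ts = map (shape (flip c)) ts'"
    by (cases t') auto
  have *: "length (concat (map tour ss)) = length (concat (map tour ss')) \<and>
      (\<forall>f. map f (concat (map tour ss)) = concat (map tour ss') \<longrightarrow> map (map_dart_tree f) ss = ss')"
    if "map (shape (flip c)) ss = map (shape (flip c)) ss'" "set ss \<subseteq> set ts" for ss :: "'a dart_tree list" and ss' :: "'b dart_tree list"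
    using that
  proof (induction ss arbitrary: ss')
    case (Cons s ss)
    then obtain s' ss'' where ss': "ss' = s' # ss''" by (cases ss') auto
    have s: "length (tour s) = length (tour s') \<and> (\<forall>f. map f (tour s) = tour s' \<longrightarrow> map_dart_tree f s = s')"
      using 2(1)[of s s'] Cons.prems ss' by auto
    have "length (concat (map tour ss)) = length (concat (map tour ss'')) \<and>
      (\<forall>f. map f (concat (map tour ss)) = concat (map tour ss'') \<longrightarrow> map (map_dart_tree f) ss = ss'')"
      using Cons ss' by auto
    then show ?case using s ss' by (auto simp: append_eq_append_conv)
  qed simp
  then have IH: "length (concat (map tour ts)) = length (concat (map tour ts')) \<and>
      (\<forall>f. map f (concat (map tour ts)) = concat (map tour ts') \<longrightarrow> map (map_dart_tree f) ts = ts')"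
    using *[OF t'(2)] by simp
  show ?case unfolding t'(1) using IH by (auto simp: append_eq_append_conv)
qed

lemma forest_shape_relabel:
  fixes u :: 'a and u' :: 'b
  assumes "forest_shape ts = forest_shape ts'" "distinct (u # concat (map tour ts))"
  shows "\<exists>f. f u = u' \<and> map f (concat (map tour ts)) = concat (map tour ts') \<and> map (map_dart_tree f) ts = ts'"
proof -
  have len: "length (concat (map tour ss)) = length (concat (map tour ss')) \<and>
      (\<forall>f. map f (concat (map tour ss)) = concat (map tour ss') \<longrightarrow> map (map_dart_tree f) ss = ss')"
    if sh: "map (shape White) ss = map (shape White) ss'" for ss :: "'a dart_tree list" and ss' :: "'b dart_tree list"
  proof -
    \<comment> \<open>A root with dummy darts turns the forest into a tree, so that
      \<open>shape_eq_relabel\<close> applies.\<close>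
    have "shape Black (DNode u u ss) = shape Black (DNode u' u' ss')" using sh by simp
    then have l: "length (concat (map tour ss)) = length (concat (map tour ss'))"
      using shape_eq_relabel by fastforce
    moreover have "map (map_dart_tree f) ss = ss'" if f: "map f (concat (map tour ss)) = concat (map tour ss')" for f
    proof -
      have "shape Black (DNode u u ss) = shape Black (DNode (f u) (f u) ss')" using sh by simp
      from shape_eq_relabel[OF this] show ?thesis using f by auto
    qed
    ultimately show ?thesis by blast
  qed
  have m: "map (shape White) ts = map (shape White) ts'" using assms(1) by (simp add: forest_shape_def)
  let ?L = "u # concat (map tour ts)" and ?L' = "u' # concat (map tour ts')"
  define f where "f d = the (map_of (zip ?L ?L') d)" for d
  have l: "length ?L = length ?L'" using len[OF m] by simp
  have "map f ?L = ?L'"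
  proof (rule nth_equalityI)
    fix k assume k: "k < length (map f ?L)"
    then have "map_of (zip ?L ?L') (?L ! k) = Some (?L' ! k)"
      using map_of_zip_nth[OF l assms(2), of k] l by simp
    then have "f (?L ! k) = ?L' ! k" unfolding f_def by (simp only: option.sel)
    then show "map f ?L ! k = ?L' ! k" using k by (simp only: nth_map length_map)
  qed (use l in simp)
  then have f: "f u = u'" "map f (concat (map tour ts)) = concat (map tour ts')" by simp_all
  then show ?thesis using len[OF m] by blast
qed

text \<open>The lower bound \<open>k\<close> on the labels allows each further subtree to be planted
  above all labels already spent.\<close>

lemma plant_exists:
  assumes "well_formed m c s"
  shows "\<exists>t :: nat dart_tree. shape c t = s \<and> distinct (tour t) \<and> (\<forall>x\<in>set (tour t). k \<le> x)"
  using assms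
proof (induction m c s arbitrary: k rule: well_formed.induct)
  case (1 m c)
  then show ?case by (intro exI[of _ "DLeaf k"]) simp
next
  case (2 m c x)
  then show ?case by (intro exI[of _ "DLeaf k"]) simp
next
  case (3 m c c' ss)
  have "\<exists>ts :: nat dart_tree list. map (shape c') ts = us \<and> distinct (concat (map tour ts)) \<and> (\<forall>x\<in>set (concat (map tour ts)). k \<le> x)"
    if "set us \<subseteq> set ss" for us k
    using that
  proof (induction us arbitrary: k)
    case (Cons u us)
    then obtain t :: "nat dart_tree" where t: "shape c' t = u" "distinct (tour t)" "\<forall>x\<in>set (tour t). k \<le> x"
      using 3 by (metis insert_subset list.simps(15) well_formed.simps(3))
    obtain ts :: "nat dart_tree list" where ts: "map (shape c') ts = us" "distinct (concat (map tour ts))"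
      "\<forall>x\<in>set (concat (map tour ts)). Suc (Max (insert k (set (tour t)))) \<le> x"
      using Cons by (metis insert_subset list.simps(15))
    have b: "x \<le> Max (insert k (set (tour t)))" if "x = k \<or> x \<in> set (tour t)" for x
      using that by (intro Max_ge) auto
    have "set (tour t) \<inter> set (concat (map tour ts)) = {}"
    proof (rule ccontr)
      assume "set (tour t) \<inter> set (concat (map tour ts)) \<noteq> {}"
      then obtain x where "x \<in> set (tour t)" "x \<in> set (concat (map tour ts))" by blast
      then show False using ts(3) b[of x] not_less_eq_eq by blast
    qed
    moreover have "\<forall>x\<in>set (concat (map tour ts)). k \<le> x"
      using ts(3) b[of k] by (meson Suc_leD le_trans)
    ultimately have "map (shape c') (t # ts) = u # us \<and> distinct (concat (map tour (t # ts))) \<and>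
        (\<forall>x\<in>set (concat (map tour (t # ts))). k \<le> x)"
      using t ts by (auto simp del: set_concat)
    then show ?case by (intro exI[of _ "t # ts"])
  qed simp
  from this[of ss "Suc (Suc k)"] obtain ts :: "nat dart_tree list" where
    ts: "map (shape c') ts = ss" "distinct (concat (map tour ts))" "\<forall>x\<in>set (concat (map tour ts)). Suc (Suc k) \<le> x"
    by blast
  have "c' = flip c" using 3(2) by (cases c; cases c') auto
  then have "shape c (DNode k (Suc k) ts) = Node c' ss" using ts(1) by simp
  moreover have "distinct (tour (DNode k (Suc k) ts))" "\<forall>x\<in>set (tour (DNode k (Suc k) ts)). k \<le> x"
    using ts(2,3) by (auto simp del: set_concat)
  ultimately show ?case by blast
qed

lemma forest_exists:
  assumes "well_formed m Black s" "is_node s"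
  shows "\<exists>(u :: nat) ts. distinct (u # concat (map tour ts)) \<and> forest_shape ts = s"
proof -
  obtain t :: "nat dart_tree" where t: "shape Black t = s" "distinct (tour t)"
    using plant_exists[OF assms(1)] by blast
  then obtain d u ts where "t = DNode d u ts" using assms(2) by (cases t) (auto simp: is_node_def)
  then show ?thesis using t by (intro exI[of _ u] exI[of _ ts]) (auto simp: forest_shape_def)
qed

lemma closings_map: "closings (map (map_prod id f) w) = f ` closings w"
  and openings_map: "openings (map (map_prod id f) w) = f ` openings w"
  by (force simp: closings_def openings_def)+

lemma forward_map: "forward (map (map_prod id f) w) = map_prod f f ` forward w"
proof (induction w rule: forward.induct)
  case (2 b d w)
  have "map_prod f f ` (closings w \<times> {d}) = f ` closings w \<times> {f d}" by force
  then show ?case using 2 closings_map[of f w] by (simp add: image_Un id_def)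
qed simp

lemma word_matchings_map:
  assumes pe: "(p, e) \<in> word_matchings w x" and inj: "inj_on f (snd ` set w)"
    and g: "\<And>d. d \<in> snd ` set w \<Longrightarrow> g (f d) = d"
  defines "C \<equiv> f ` closings w"
  shows "(restrict (\<lambda>c. f (p (g c))) C, restrict (\<lambda>c. e (g c)) C) \<in> word_matchings (map (map_prod id f) w) x"
proof -
  have C: "closings (map (map_prod id f) w) = C" by (simp add: closings_map C_def)
  have p: "bij_betw p (closings w) (openings w)" and e: "sum e (closings w) \<le> x"
    and fw: "\<And>c. c \<in> closings w \<Longrightarrow> e c = 0 \<Longrightarrow> (c, p c) \<in> forward w"
    using pe by (auto simp: word_matchings_def matchings_def)
  have gc: "g (f c) = c" if "c \<in> closings w" for c using g closings_sub[OF that] by blast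
  have injc: "inj_on f (closings w)" "inj_on f (openings w)"
    by (rule inj_on_subset[OF inj], rule subsetI, erule closings_sub openings_sub)+
  have "bij_betw g C (closings w)"
    by (rule bij_betw_byWitness[of _ f]) (auto simp: C_def gc)
  moreover have "bij_betw f (openings w) (f ` openings w)" using injc(2) by (rule inj_on_imp_bij_betw)
  ultimately have "bij_betw (f \<circ> (p \<circ> g)) C (f ` openings w)"
    using p by (intro bij_betw_trans)
  then have "bij_betw (restrict (\<lambda>c. f (p (g c))) C) C (f ` openings w)"
    by (subst bij_betw_cong[of _ _ "f \<circ> (p \<circ> g)"]) auto
  moreover have "sum (restrict (\<lambda>c. e (g c)) C) C = sum e (closings w)"
    unfolding C_def by (subst sum.reindex[OF injc(1)]) (auto simp: gc intro!: sum.cong)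
  moreover have "(c, restrict (\<lambda>c. f (p (g c))) C c) \<in> map_prod f f ` forward w"
    if c: "c \<in> C" "restrict (\<lambda>c. e (g c)) C c = 0" for c
  proof -
    obtain d where d: "d \<in> closings w" "c = f d" using c by (auto simp: C_def)
    then have "(d, p d) \<in> forward w" using c fw gc by simp
    then show ?thesis using c d gc by force
  qed
  ultimately show ?thesis
    unfolding word_matchings_def matchings_def C openings_map forward_map using e by auto
qed

definition build :: "nat \<Rightarrow> nat dart_tree list \<Rightarrow> (nat \<Rightarrow> nat) \<Rightarrow> (nat \<Rightarrow> nat) \<Rightarrow> marked_map" where
  "build u ts p e = \<lparr>darts = planted.pD u ts, rot = planted.prot u ts, opp = planted.popp u ts p,
     white = orbit (planted.prot u ts) ` planted.pW u ts, root_dart = planted.pr ts,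
     marks = planted.pK u ts p e, emult = (\<lambda>d. e (planted.popp u ts p d))\<rparr>"

lemma build_in_Q:
  assumes "planted u ts m p e x" "x < i"
  shows "build u ts p e \<in> labelled_Q m i" "card (black (build u ts p e)) = black_nodes (forest_shape ts)"
    "white_darts (build u ts p e) = planted.pW u ts"
proof -
  interpret planted u ts m p e x by (rule assms(1))
  obtain P h where sp: "spanned_map pD prot popp m pW pr pK pT P h"
    and rooted: "spanned_map.rooted_at pD prot popp m pr P ts" using planted_map by blast
  interpret S: spanned_map pD prot popp m pW pr pK pT P h by (rule sp)
  have "sum (\<lambda>d. e (popp d)) pK < i" using multiplicities(2) assms(2) by simp
  note Q = labelled_QI[OF sp, of "\<lambda>d. e (popp d)" i, OF multiplicities(1) this, folded build_def]
  show "build u ts p e \<in> labelled_Q m i" "white_darts (build u ts p e) = pW" by (rule Q; assumption)+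
  have "card (black (build u ts p e)) = card (V ` (pD - pW))"
    using Q(3) by (simp add: V_def[abs_def])
  then show "card (black (build u ts p e)) = black_nodes (forest_shape ts)"
    using S.black_nodes_forest_shape[OF rooted] by simp
qed

lemma map_iso_white_darts:
  assumes M: "M \<in> labelled_Q m i" and iso: "map_iso f M N"
  shows "\<And>d. d \<in> darts M \<Longrightarrow> vertex_at N (f d) = f ` vertex_at M d" "white_darts N = f ` white_darts M"
proof -
  note sub = labelled_Q_sub[OF M]
  have inj: "inj_on f (darts M)" and N: "darts N = f ` darts M" and wN: "white N = (\<lambda>v. f ` v) ` white M"
    using iso by (auto simp: map_iso_def bij_betw_def)
  have pow: "(rot M ^^ n) d \<in> darts M \<and> (rot N ^^ n) (f d) = f ((rot M ^^ n) d)"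
    if "d \<in> darts M" for d n
    using that iso sub(4) by (induction n) (auto simp: map_iso_def)
  show v: "vertex_at N (f d) = f ` vertex_at M d" if "d \<in> darts M" for d
    using pow[OF that] unfolding vertex_at_def orbit_altdef by (force simp: image_iff)
  show "white_darts N = f ` white_darts M"
  proof (intro equalityI subsetI)
    fix x assume "x \<in> white_darts N"
    then obtain d where d: "d \<in> darts M" "x = f d" "vertex_at N x \<in> white N"
      using N by (auto simp: white_darts_def)
    then obtain w where w: "w \<in> white M" "f ` vertex_at M d = f ` w" using v[OF d(1)] wN by auto
    have "vertex_at M d \<subseteq> darts M" using sub(6)[of "vertex_at M d"] d(1) by (auto simp: vertices_def)
    then have "vertex_at M d = w" using inj_on_image_eq_iff[OF inj _ sub(3)[OF w(1)]] w(2) by blast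
    then show "x \<in> f ` white_darts M" using d w(1) by (auto simp: white_darts_def)
  next
    fix x assume "x \<in> f ` white_darts M"
    then show "x \<in> white_darts N" using v N wN by (auto simp: white_darts_def)
  qed
qed

text \<open>The isomorphism takes the valid spanning tree of one map to that of the other. Thus it
  maps the unfolded forests, and then the matchings and multiplicities on the cut edges, onto each
  other.\<close>

lemma build_iso:
  assumes pl: "planted u ts m p e x" "planted u' ts' m p' e' x" and iso: "map_iso f (build u ts p e) (build u' ts' p' e')"
  shows "u' = f u" "ts' = map (map_dart_tree f) ts" "\<And>c. c \<in> closings (leaf_list u ts) \<Longrightarrow> p' (f c) = f (p c) \<and> e' (f c) = e c"
proof -
  interpret A: planted u ts m p e x by (rule pl(1))
  interpret B: planted u' ts' m p' e' x by (rule pl(2))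
  have MQ: "build u ts p e \<in> labelled_Q m (Suc x)" by (rule build_in_Q[OF pl(1)]) simp
  have sel: "bij_betw f A.pD B.pD" "\<And>d. d \<in> A.pD \<Longrightarrow> f (A.prot d) = B.prot (f d)"
    "\<And>d. d \<in> A.pD \<Longrightarrow> f (A.popp d) = B.popp (f d)" "B.pr = f A.pr" "B.pK = f ` A.pK"
    "\<And>d. d \<in> A.pK \<Longrightarrow> e' (B.popp (f d)) = e (A.popp d)"
    using iso by (auto simp: map_iso_def build_def)
  have W: "B.pW = f ` A.pW"
    using map_iso_white_darts(2)[OF MQ iso] build_in_Q(3)[OF pl(1), of "Suc x"] build_in_Q(3)[OF pl(2), of "Suc x"] by simp
  interpret I: isomorphic_maps A.pD A.prot A.popp m A.pW A.pr A.pK B.pD B.prot B.popp B.pW B.pr B.pK f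
    by unfold_locales (use sel W in auto)
  obtain P h where A: "spanned_map A.pD A.prot A.popp m A.pW A.pr A.pK A.pT P h"
    "spanned_map.rooted_at A.pD A.prot A.popp m A.pr P ts" "A.valid A.pT" using A.planted_map by blast
  obtain P' h' where B: "spanned_map B.pD B.prot B.popp m B.pW B.pr B.pK B.pT P' h'"
    "spanned_map.rooted_at B.pD B.prot B.popp m B.pr P' ts'" "B.valid B.pT" using B.planted_map by blast
  interpret SA: spanned_map A.pD A.prot A.popp m A.pW A.pr A.pK A.pT P h by (rule A(1))
  interpret SB: spanned_map B.pD B.prot B.popp m B.pW B.pr B.pK B.pT P' h' by (rule B(1))
  have T: "f ` A.pT = B.pT"
    using B.valid_spanning_unique[OF I.spanning_f[OF A.spanning_pT] I.valid_f[OF A.spanning_pT A(3)] B.spanning_pT B(3)] .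
  have ru: "A.prot A.pr = u" "B.prot B.pr = u'" by (rule A.pr_props B.pr_props)+
  show u': "u' = f u" using sel(2)[OF A.r_D] sel(4) ru by simp
  have uD: "u \<in> A.pD" using A.rot_D[OF A.r_D] ru(1) by simp
  show "ts' = map (map_dart_tree f) ts"
  proof (rule unfolds_forest_unique)
    show "\<forall>t\<in>set ts'. unfolds B.prot B.popp m B.pT t"
      using SB.root_fits[OF B(2)] SB.fits_unfolds by blast
    show "\<forall>t\<in>set (map (map_dart_tree f) ts). unfolds B.prot B.popp m B.pT t"
    proof
      fix t' assume "t' \<in> set (map (map_dart_tree f) ts)"
      then obtain t where t: "t \<in> set ts" "t' = map_dart_tree f t" by auto
      have "set (tour t) \<subseteq> A.pD" using t(1) by (auto simp: A.pD_def A.L_def)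
      then show "unfolds B.prot B.popp m B.pT t'"
        unfolding t(2) T[symmetric] using I.unfolds_f[OF SA.fits_unfolds[OF SA.root_fits[OF A(2) t(1)]] A.pT_pD] by blast
    qed
    have "map top_dart (map (map_dart_tree f) ts) = map f (map top_dart ts)" by (simp add: I.top_dart_map)
    also have "\<dots> = B.child_darts (B.prot B.pr)"
      unfolding SA.root_tops[OF A(2)] A.child_darts_def B.child_darts_def ru
      using I.rot_pow_f[OF uD] unfolding u'[symmetric] by simp
    finally show "map top_dart ts' = map top_dart (map (map_dart_tree f) ts)"
      using SB.root_tops[OF B(2)] by simp
  qed
  show "p' (f c) = f (p c) \<and> e' (f c) = e c" if "c \<in> closings (leaf_list u ts)" for c
  proof -
    have c: "c \<in> A.C" using that by (simp add: A.C_def)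
    then have cD: "c \<in> A.pD" "c \<notin> A.pT" "c \<notin> A.pW" by (auto simp: A.C_eq)
    have fc: "f c \<in> B.C"
    proof -
      have "f c \<notin> B.pT" unfolding T[symmetric] using inj_on_image_mem_iff[OF I.inj_f cD(1) A.pT_pD] cD(2) by simp
      moreover have "f c \<notin> B.pW" unfolding W using inj_on_image_mem_iff[OF I.inj_f cD(1) A.pW_pD] cD(3) by simp
      moreover have "f c \<in> B.pD" using sel(1) cD(1) by (auto simp: bij_betw_def)
      ultimately show ?thesis by (auto simp: B.C_eq)
    qed
    have pc: "A.popp c = p c" "A.popp (p c) = c" "p c \<in> A.pD" using A.popp_C[OF c] A.Op_eq A.pW_pD by auto
    have p'c: "B.popp (f c) = p' (f c)" using B.popp_C[OF fc] by simp
    have pf: "p' (f c) = f (p c)" using sel(3)[OF cD(1)] pc p'c by simp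
    moreover have "e' (f c) = e c"
    \<comment> \<open>Isomorphisms preserve multiplicities only on marked edges; the value 0 is
      recovered from the fact that unmarked edges go to unmarked edges.\<close>
    proof (cases "e c > 0")
      case True
      then have "p c \<in> A.pK" using c by (auto simp: A.pK_def)
      then have "e' (B.popp (f (p c))) = e c" using sel(6) pc by simp
      moreover have "B.popp (f (p c)) = f c" using sel(3)[OF pc(3)] pc(2) by simp
      ultimately show ?thesis by simp
    next
      case False
      have "p c \<notin> A.pK"
      proof
        assume "p c \<in> A.pK"
        then obtain c' where c': "c' \<in> A.C" "e c' > 0" "p c = p c'" by (auto simp: A.pK_def)
        then have "c = c'" using A.p_bij c by (auto simp: bij_betw_def inj_on_def)
        then show False using c'(2) False by simp
      qed
      moreover have "A.pK \<subseteq> A.pD" using A.pK_sub A.Op_eq A.pW_pD by blast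
      ultimately have "f (p c) \<notin> B.pK" using sel(5) inj_on_image_mem_iff[OF I.inj_f pc(3)] by simp
      then have "\<not> e' (f c) > 0" using fc pf unfolding B.pK_def by (metis (mono_tags, lifting) image_eqI mem_Collect_eq)
      then show ?thesis using False by simp
    qed
    ultimately show ?thesis by blast
  qed
qed

definition planted_shape :: "nat \<Rightarrow> unit plane_tree \<Rightarrow> bool" where
  "planted_shape m s \<longleftrightarrow> well_formed m Black s \<and> (\<exists>us. s = Node White us \<and> is_node (last us))"

lemma plantedI:
  assumes "distinct (u # concat (map tour ts))" "planted_shape m (forest_shape ts)" "m \<ge> 3"
    "(p, e) \<in> word_matchings (leaf_list u ts) x"
  shows "planted u ts m p e x"
  using assms by unfold_locales (auto simp: planted_shape_def forest_shape_def)

text \<open>The shape of the unfolding along the valid spanning tree is the one required. Any other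
  dart tree of that shape is a relabelling of it, along which the matching is transported;
  quantifying over all such trees allows the chosen representative to be inserted later.\<close>

lemma labelled_Q_build:
  assumes M: "M \<in> labelled_Q m i" and m: "m \<ge> 3" and i: "i \<ge> 1"
  shows "\<exists>s. planted_shape m s \<and> black_nodes s = card (black M) \<and>
    (\<forall>u' ts'. distinct (u' # concat (map tour ts')) \<and> forest_shape ts' = s \<longrightarrow>
      (\<exists>p' e' f. (p', e') \<in> word_matchings (leaf_list u' ts') (i - 1) \<and> map_iso f M (build u' ts' p' e')))"
proof -
  let ?D = "darts M" and ?W = "white_darts M" and ?r = "root_dart M" and ?K = "marks M"
  have m2: "m \<ge> 2" using m by simp
  interpret bipartite_map ?D "rot M" "opp M" m ?W ?r ?K by (rule labelled_Q_bipartite_map(1)[OF M m2])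
  obtain T where T: "spanning T" "valid T"
    using labelled_Q_bipartite_map(2)[OF M m2] valid_spanning_exists by blast
  obtain P h where sp: "spanned_map ?D (rot M) (opp M) m ?W ?r ?K T P h" using spanned_mapI[OF T(1)] .
  interpret S: spanned_map ?D "rot M" "opp M" m ?W ?r ?K T P h by (rule sp)
  obtain ts where ts: "S.rooted_at ts" using S.rooted_at_exists by blast
  define u where "u = rot M ?r"
  define w where "w = leaf_list u ts"
  let ?L = "u # concat (map tour ts)"
  have L: "S.root_tour ts = ?L" by (simp add: S.root_tour_def u_def)
  have dL: "distinct ?L" and sL: "set ?L = ?D" using S.distinct_root_tour[OF ts] S.set_root_tour[OF ts] by (simp_all only: L)
  have V: "V d = vertex_at M d" for d by (simp add: V_def vertex_at_def)
  have wM: "white M = V ` ?W"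
  proof -
    have "white M \<subseteq> vertices M" using M by (simp add: labelled_Q_def regular_bipartite_def)
    then show ?thesis unfolding V by (auto simp: vertices_def white_darts_def)
  qed
  have bM: "black M = V ` (?D - ?W)"
    unfolding black_def vertices_def V by (auto simp: white_darts_def)
  have shape: "planted_shape m (forest_shape ts)"
    using S.well_formed_forest_shape[OF ts] by (simp add: planted_shape_def forest_shape_def)
  have e1: "emult M d \<ge> 1" if "d \<in> ?K" for d using M that by (simp add: labelled_Q_def)
  have e2: "sum (emult M) ?K \<le> i - 1" using M by (auto simp: labelled_Q_def)
  define \<mu> where "\<mu> c = (if opp M c \<in> ?K then emult M (opp M c) else 0)" for c
  define C where "C = closings w"
  have C: "C = ?D - ?W - T" using S.leaf_list_closings[OF ts] by (simp add: C_def w_def u_def)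
  have wm: "(restrict (opp M) C, restrict \<mu> C) \<in> word_matchings w (i - 1)"
    using S.word_matchings_of_map[OF ts T(2), of "emult M" "i - 1", OF e1 e2] by (simp add: C_def w_def u_def \<mu>_def[abs_def])
  have sw: "snd ` set w \<subseteq> ?D" using S.snd_leaf_list[OF ts] S.set_root_tour[OF ts]
    by (metis (no_types, lifting) filter_is_subset image_set u_def w_def)
  show ?thesis
  proof (intro exI[of _ "forest_shape ts"] conjI allI impI)
    show "planted_shape m (forest_shape ts)" by (rule shape)
    show "black_nodes (forest_shape ts) = card (black M)" using S.black_nodes_forest_shape[OF ts] bM by simp
    fix u' :: nat and ts' :: "nat dart_tree list"
    assume "distinct (u' # concat (map tour ts')) \<and> forest_shape ts' = forest_shape ts"
    then have d': "distinct (u' # concat (map tour ts'))" and sh: "forest_shape ts = forest_shape ts'" by auto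
    obtain f where f: "f u = u'" "map f (concat (map tour ts)) = concat (map tour ts')" "map (map_dart_tree f) ts = ts'"
      using forest_shape_relabel[OF sh dL, of u'] by blast
    have fL: "map f ?L = u' # concat (map tour ts')" using f by simp
    have inj: "inj_on f ?D" using d' unfolding fL[symmetric] distinct_map sL by blast
    define g where "g = inv_into ?D f"
    have gf: "g (f d) = d" if "d \<in> ?D" for d using inj that by (simp add: g_def)
    define p' where "p' = restrict (\<lambda>c. f (restrict (opp M) C (g c))) (f ` C)"
    define e' where "e' = restrict (\<lambda>c. restrict \<mu> C (g c)) (f ` C)"
    have w': "leaf_list u' ts' = map (map_prod id f) w" using leaf_list_map[of f u ts] f by (simp add: w_def)
    have "(p', e') \<in> word_matchings (leaf_list u' ts') (i - 1)"
      unfolding w' p'_def e'_def C_def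
      by (rule word_matchings_map[OF wm[unfolded C_def] inj_on_subset[OF inj sw]]) (use gf sw in blast)
    moreover have "map_iso f M (build u' ts' p' e')"
    proof -
      have "planted u' ts' m p' e' (i - 1)"
        using d' shape sh m \<open>(p', e') \<in> _\<close> by (intro plantedI) simp_all
      then interpret B: planted u' ts' m p' e' "i - 1" .
      have BL: "B.L = map f ?L" using fL by (simp add: B.L_def)
      have D': "B.pD = f ` ?D" unfolding B.pD_def BL using sL by (simp only: set_map)
      have TP': "B.TP = map (map_prod f f) (concat (map tree_pairs ts))"
      proof -
        have "B.TP = concat (map tree_pairs (map (map_dart_tree f) ts))" unfolding B.TP_def by (simp only: f(3))
        then show ?thesis by (simp add: map_concat o_def tree_pairs_map)
      qed
      have CT': "B.CT = map (map_prod f id) ((u, White) # concat (map (coloured_tour White) ts))"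
      proof -
        have "B.CT = (f u, White) # concat (map (coloured_tour White) (map (map_dart_tree f) ts))"
          unfolding B.CT_def by (simp only: f(1,3))
        then show ?thesis by (simp add: map_concat o_def coloured_tour_map)
      qed
      have tp: "d \<in> T \<and> d' = opp M d" if "(d, d') \<in> set (concat (map tree_pairs ts))" for d d'
        using that S.fits_tree_pairs[OF S.root_fits[OF ts]] by auto
      have Ttp: "fst ` set (concat (map tree_pairs ts)) = T"
      proof
        show "fst ` set (concat (map tree_pairs ts)) \<subseteq> T"
        proof
          fix d assume "d \<in> fst ` set (concat (map tree_pairs ts))"
          then obtain d' where "(d, d') \<in> set (concat (map tree_pairs ts))" by (metis imageE prod.collapse)
          then show "d \<in> T" using tp by blast
        qed
        show "T \<subseteq> fst ` set (concat (map tree_pairs ts))"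
        proof
          fix d assume d: "d \<in> T"
          then have "d \<in> set ?L" "d \<noteq> u" using S.T_D sL S.rot_r_notin_T by (auto simp: u_def)
          then obtain t where t: "t \<in> set ts" "d \<in> set (tour t)" by auto
          have "d \<notin> set (leaf_darts t)" using S.fits_leaf_darts[OF S.root_fits[OF ts t(1)]] d by simp
          then have "d \<in> fst ` set (tree_pairs t)" using t(2) unfolding tour_decomp by blast
          then show "d \<in> fst ` set (concat (map tree_pairs ts))" using t(1) by force
        qed
      qed
      have T': "B.pT = f ` T"
      proof -
        have "B.pT = f ` fst ` set (concat (map tree_pairs ts))"
          unfolding B.pT_def TP' set_map image_image by (intro image_cong) auto
        then show ?thesis unfolding Ttp .
      qed
      have col: "d \<in> ?W \<longleftrightarrow> c = White" if "(d, c) \<in> set ((u, White) # concat (map (coloured_tour White) ts))" for d c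
      proof -
        consider "d = u" "c = White" | t where "t \<in> set ts" "(d, c) \<in> set (coloured_tour White t)" using \<open>_ \<in> set _\<close> by auto
        then show ?thesis
        proof cases
          case 1
          then show ?thesis using S.rot_r_W[OF ts] by (simp add: u_def)
        next
          case 2
          then show ?thesis using S.fits_coloured[OF S.root_fits[OF ts 2(1)], of White] S.root_top_W[OF ts 2(1)] by blast
        qed
      qed
      have W': "B.pW = f ` ?W"
      proof -
        have fst_CT: "map fst ((u, White) # concat (map (coloured_tour White) ts)) = ?L"
          by (simp add: map_concat o_def map_fst_coloured_tour)
        have "?W = {d. (d, White) \<in> set ((u, White) # concat (map (coloured_tour White) ts))}"
        proof (intro equalityI subsetI)
          fix d assume d: "d \<in> ?W"
          then have "d \<in> set ?L" using sL W_D by blast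
          then obtain c where c: "(d, c) \<in> set ((u, White) # concat (map (coloured_tour White) ts))"
            unfolding fst_CT[symmetric] by (metis (no_types, lifting) imageE list.set_map prod.collapse)
          then have "c = White" using col[OF c] d by blast
          then show "d \<in> {d. (d, White) \<in> set ((u, White) # concat (map (coloured_tour White) ts))}" using c by blast
        qed (use col in blast)
        moreover have "B.pW = f ` {d. (d, White) \<in> set ((u, White) # concat (map (coloured_tour White) ts))}"
          unfolding B.pW_def CT' set_map by force
        ultimately show ?thesis by simp
      qed
      have par: "B.partner (f d) = (if d \<in> T then f (opp M d) else f d)" if "d \<in> ?D" for d
      proof (cases "d \<in> T")
        case True
        then obtain d' where "(d, d') \<in> set (concat (map tree_pairs ts))"
          unfolding Ttp[symmetric] by (metis imageE prod.collapse)
        then have "(f d, f (opp M d)) \<in> set B.TP" using tp unfolding TP' by force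
        then show ?thesis using B.partner_TP True by simp
      next
        case False
        then have "f d \<notin> B.pT" unfolding T' using inj_on_image_mem_iff[OF inj that S.T_D] by simp
        then show ?thesis using B.partner_notin False by simp
      qed
      \<comment> \<open>The walk in \<open>M\<close> and the successor function \<open>B.nx\<close>
        run through corresponding tours in order, so \<open>f\<close> intertwines them; passing to
        the other end of tree edges turns this into the statement about rotations.\<close>
      have nxt: "f (turn T d) = B.nx (f d)" if d: "d \<in> ?D" for d
      proof -
        obtain k where k: "k < length ?L" "?L ! k = d" using in_set_conv_nth[of d ?L] sL d by metis
        have c1: "cyclic (turn T) ?L" using S.chain_root_tour[OF ts] unfolding L
          by (simp add: chain_def cyclic_def u_def)
        have "turn T d = ?L ! (Suc k mod length ?L)" using cyclic_funpow[OF c1 k(1), of 1] k(2) by simp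
        moreover have "B.nx (B.L ! k) = B.L ! (Suc k mod length ?L)"
          using cyclic_funpow[OF B.cyclic_L, of k 1] k(1) unfolding BL length_map by simp
        moreover have "Suc k mod length ?L < length ?L" by (rule mod_less_divisor) simp
        ultimately show ?thesis using k unfolding BL by (simp only: nth_map)
      qed
      have rot: "f (rot M d) = B.prot (f d)" if d: "d \<in> ?D" for d
      proof -
        define q where "q = (if d \<in> T then opp M d else d)"
        have q: "q \<in> ?D" "B.partner (f d) = f q" using d opp_D par[OF d] by (auto simp: q_def)
        have "turn T q = rot M d" using S.opp_T_iff[OF d] opp_opp[OF d] by (auto simp: turn_def q_def)
        then show ?thesis using nxt[OF q(1)] q(2) by (simp add: B.prot_def)
      qed
      have pC: "p' (f c) = f (opp M c)" "e' (f c) = \<mu> c" if "c \<in> C" for c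
        using that gf[of c] by (auto simp: p'_def e'_def C)
      have C': "B.C = f ` C" unfolding B.C_def w' closings_map C_def ..
      have opp: "f (opp M d) = B.popp (f d)" if d: "d \<in> ?D" for d
      proof (cases "d \<in> T")
        case True
        then have "f d \<in> B.pT" using T' by blast
        then show ?thesis using B.popp_pT par[OF d] True by simp
      next
        case False
        show ?thesis
        proof (cases "d \<in> ?W")
          case dW: False
          then have "d \<in> C" using False d by (simp add: C)
          then show ?thesis using B.popp_C[of "f d"] C' pC by auto
        next
          case True
          have "opp M d \<in> C" using False True opp_D[OF d] opp_W[OF d] S.opp_T_iff[OF d] by (simp add: C)
          then have "B.popp (f (opp M d)) = f d" "B.popp (B.popp (f (opp M d))) = f (opp M d)"
            using B.popp_C[of "f (opp M d)"] C' pC[of "opp M d"] opp_opp[OF d] by auto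
          then show ?thesis by simp
        qed
      qed
      have orb: "orbit B.prot (f d) = f ` V d" if d: "d \<in> ?D" for d
      proof -
        have pow: "(rot M ^^ n) d \<in> ?D \<and> (B.prot ^^ n) (f d) = f ((rot M ^^ n) d)" for n
          using d rot rot_D by (induction n) auto
        show ?thesis using pow unfolding V_def orbit_altdef by (force simp: image_iff)
      qed
      have pr: "B.pr = f ?r"
      proof -
        have ne: "ts \<noteq> []" using S.root_tops[OF ts] child_darts_neq[of "rot M ?r"] by auto
        have "top_dart (last ts) = last (child_darts (rot M ?r))"
          using last_map[OF ne, of top_dart] S.root_tops[OF ts] by simp
        then have "rot M (top_dart (last ts)) = rot M ?r" using rot_last_child_darts[OF rot_D[OF r_D]] by simp
        then have "top_dart (last ts) = ?r" by (rule rot_inj)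
        moreover have "top_dart (map_dart_tree f t) = f (top_dart t)" for t by (cases t) auto
        moreover have "B.pr = top_dart (last (map (map_dart_tree f) ts))" unfolding B.pr_def by (simp only: f(3))
        ultimately show ?thesis using ne by (simp add: last_map)
      qed
      have Kopp: "opp M d \<in> C" "\<mu> (opp M d) = emult M d" "d \<in> ?D" if "d \<in> ?K" for d
      proof -
        have d: "d \<in> ?W" "d \<notin> T" using that K_W S.notin_K by blast+
        then show "d \<in> ?D" using W_D by blast
        then show "opp M d \<in> C" "\<mu> (opp M d) = emult M d"
          using d that opp_D[of d] opp_W[of d] S.opp_T_iff[of d] opp_opp[of d] by (auto simp: C \<mu>_def)
      qed
      have K': "B.pK = f ` ?K"
      proof (intro equalityI subsetI)
        fix y assume "y \<in> B.pK"
        then obtain c where c: "c \<in> C" "y = p' (f c)" "e' (f c) > 0" by (auto simp: B.pK_def C')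
        then have "\<mu> c > 0" "y = f (opp M c)" using pC by auto
        then show "y \<in> f ` ?K" by (auto simp: \<mu>_def split: if_splits)
      next
        fix y assume "y \<in> f ` ?K"
        then obtain d where d: "d \<in> ?K" "y = f d" by blast
        have "e' (f (opp M d)) > 0" using pC(2)[OF Kopp(1)[OF d(1)]] Kopp(2)[OF d(1)] e1[OF d(1)] by simp
        moreover have "p' (f (opp M d)) = y" using pC(1)[OF Kopp(1)[OF d(1)]] opp_opp[OF Kopp(3)[OF d(1)]] d(2) by simp
        ultimately show "y \<in> B.pK" unfolding B.pK_def C' using Kopp(1)[OF d(1)] by blast
      qed
      show ?thesis
        unfolding map_iso_def build_def
      proof (simp, intro conjI ballI)
        show "bij_betw f ?D B.pD" using inj D' by (simp add: bij_betw_def)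
        show "f (rot M d) = B.prot (f d)" "f (opp M d) = B.popp (f d)" if "d \<in> ?D" for d using rot opp that by auto
        show "orbit B.prot ` B.pW = (`) f ` white M"
          unfolding wM W' image_image using orb W_D by (intro image_cong) auto
        show "B.pr = f ?r" "B.pK = f ` ?K" by (rule pr K')+
        show "e' (B.popp (f d)) = emult M d" if "d \<in> ?K" for d
          using opp[OF Kopp(3)[OF that]] pC(2)[OF Kopp(1)[OF that]] Kopp(2)[OF that] by simp
      qed
    qed
    ultimately show "\<exists>p' e' f. (p', e') \<in> word_matchings (leaf_list u' ts') (i - 1) \<and> map_iso f M (build u' ts' p' e')"
      by blast
  qed
qed

section \<open>Counting both families\<close>

text \<open>One representative for each shape: classes of maps are then encoded by a shape together
  with a matching of its fixed word.\<close>

definition plant :: "unit plane_tree \<Rightarrow> nat \<times> nat dart_tree list" where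
  "plant s = (SOME (u, ts). distinct (u # concat (map tour ts)) \<and> forest_shape ts = s)"

definition plant_word :: "unit plane_tree \<Rightarrow> (bool \<times> nat) list" where
  "plant_word s = leaf_list (fst (plant s)) (snd (plant s))"

definition plant_map :: "unit plane_tree \<Rightarrow> (nat \<Rightarrow> nat) \<times> (nat \<Rightarrow> nat) \<Rightarrow> marked_map" where
  "plant_map s z = build (fst (plant s)) (snd (plant s)) (fst z) (snd z)"

lemma plant:
  assumes "planted_shape m s"
  shows "distinct (fst (plant s) # concat (map tour (snd (plant s))))" "forest_shape (snd (plant s)) = s"
proof -
  have "\<exists>(u :: nat) ts. distinct (u # concat (map tour ts)) \<and> forest_shape ts = s"
    using assms by (intro forest_exists) (auto simp: planted_shape_def is_node_def)
  then have "\<exists>z. case z of (u :: nat, ts) \<Rightarrow> distinct (u # concat (map tour ts)) \<and> forest_shape ts = s" by auto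
  then have "case plant s of (u, ts) \<Rightarrow> distinct (u # concat (map tour ts)) \<and> forest_shape ts = s"
    unfolding plant_def by (rule someI_ex)
  then show "distinct (fst (plant s) # concat (map tour (snd (plant s))))" "forest_shape (snd (plant s)) = s"
    by (auto simp: case_prod_beta)
qed

lemma card_plant_matchings:
  assumes s: "planted_shape m s" and m: "m \<ge> 3" and i: "i \<ge> 1"
  shows "int (card (word_matchings (plant_word s) (i - 1))) = height_prod (int i) (leaf_word (walk s))"
    and "finite (word_matchings (plant_word s) (i - 1))"
proof -
  let ?ts = "snd (plant s)" and ?u = "fst (plant s)"
  have fst: "map fst (plant_word s) = True # leaf_word (walk s)"
    unfolding plant_word_def map_fst_leaf_list plant(2)[OF s] ..
  have net: "net_step (walk s) = -1"
    using net_step_well_formed[of m Black s] s m by (auto simp: planted_shape_def)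
  have d: "distinct (concat (map tour ?ts))" "?u \<notin> set (concat (map tour ?ts))" using plant(1)[OF s] by auto
  have ms: "mset (concat (map tour ?ts)) = mset (concat (map leaf_darts ?ts) @ map fst (concat (map tree_pairs ?ts)))"
    by (simp only: mset_forest_tour mset_append)
  have "distinct (concat (map leaf_darts ?ts) @ map fst (concat (map tree_pairs ?ts)))"
    using d(1) mset_eq_imp_distinct_iff[OF ms] by blast
  moreover have "?u \<notin> set (concat (map leaf_darts ?ts))"
    using d(2) unfolding mset_eq_setD[OF ms] by (simp only: set_append Un_iff) blast
  ultimately have "distinct (map snd (plant_word s))"
    unfolding plant_word_def map_snd_leaf_list by (simp only: distinct_append distinct.simps) blast
  then have "int (card (word_matchings (plant_word s) (i - 1))) = height_prod (int (i - 1)) (map fst (plant_word s))"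
    by (rule card_word_matchings) (simp add: fst net_leaf_word net)
  then show "int (card (word_matchings (plant_word s) (i - 1))) = height_prod (int i) (leaf_word (walk s))"
    \<comment> \<open>The initial opening letter raises the height from \<open>i - 1\<close> to
      \<open>i\<close> and contributes no factor.\<close>
    using i by (simp add: fst of_nat_diff)
  show "finite (word_matchings (plant_word s) (i - 1))"
    unfolding word_matchings_def by (rule finite_matchings) simp_all
qed

lemma T_family_shape:
  assumes "m \<ge> 3"
  shows "t \<in> T_family m i \<longleftrightarrow> planted_shape m (forget t) \<and> labels_ok (int i) (walk t)"
proof (cases t)
  case (Leaf l)
  then show ?thesis unfolding T_family_eq[OF assms] planted_shape_def by (auto simp: forget_def)
next
  case (Node c ts)
  have "is_node (last (map forget ts)) \<longleftrightarrow> is_node (last ts)" if "ts \<noteq> []"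
    using that by (simp add: last_map is_node_forget)
  moreover have "ts \<noteq> []" if "well_formed m Black t" using that Node assms by auto
  ultimately show ?thesis
    unfolding T_family_eq[OF assms] planted_shape_def well_formed_forget labelled_trees_def
    using Node by auto
qed

lemma plant_map_in_Q:
  assumes "planted_shape m s" "m \<ge> 3" "i \<ge> 1" "z \<in> word_matchings (plant_word s) (i - 1)"
  shows "plant_map s z \<in> labelled_Q m i" "card (black (plant_map s z)) = black_nodes s"
    "planted (fst (plant s)) (snd (plant s)) m (fst z) (snd z) (i - 1)"
proof -
  show pl: "planted (fst (plant s)) (snd (plant s)) m (fst z) (snd z) (i - 1)"
    using plant[OF assms(1)] assms by (intro plantedI) (simp_all add: plant_word_def)
  show "plant_map s z \<in> labelled_Q m i" "card (black (plant_map s z)) = black_nodes s"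
    unfolding plant_map_def using build_in_Q(1,2)[OF pl, of i] assms(3) plant(2)[OF assms(1)] by auto
qed

text \<open>Isomorphic maps have the same shape, hence the same planted tree. The isomorphism then
  maps the tour to itself in order, so it fixes every dart and the two matchings coincide.\<close>

lemma plant_map_inj:
  assumes s: "planted_shape m s" "planted_shape m s'" and m: "m \<ge> 3" and i: "i \<ge> 1"
    and z: "z \<in> word_matchings (plant_word s) (i - 1)" "z' \<in> word_matchings (plant_word s') (i - 1)"
    and iso: "map_iso f (plant_map s z) (plant_map s' z')"
  shows "s = s' \<and> z = z'"
proof -
  note pl = plant_map_in_Q(3)[OF s(1) m i z(1)] plant_map_in_Q(3)[OF s(2) m i z(2)]
  note iso' = build_iso[OF pl iso[unfolded plant_map_def]]
  have "s' = s" using plant(2)[OF s(1)] plant(2)[OF s(2)] unfolding iso'(2) forest_shape_map by simp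
  let ?u = "fst (plant s)" and ?ts = "snd (plant s)"
  let ?C = "closings (leaf_list ?u ?ts)" and ?O = "openings (leaf_list ?u ?ts)"
  have fu: "f ?u = ?u" and fts: "map (map_dart_tree f) ?ts = ?ts" using iso'(1,2) \<open>s' = s\<close> by simp_all
  have "map f (concat (map tour ?ts)) = concat (map tour (map (map_dart_tree f) ?ts))"
    by (simp add: map_concat o_def tour_map_dart_tree)
  then have "map f (?u # concat (map tour ?ts)) = map id (?u # concat (map tour ?ts))" using fu fts by simp
  then have fall: "\<forall>d\<in>set (?u # concat (map tour ?ts)). f d = id d" by (simp only: map_eq_conv)
  have fid: "f d = d" if "d \<in> set (?u # concat (map tour ?ts))" for d
    using bspec[OF fall that] by simp
  have sub: "snd ` set (leaf_list ?u ?ts) \<subseteq> set (?u # concat (map tour ?ts))"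
  proof -
    have "snd ` set (leaf_list ?u ?ts) = set (?u # concat (map leaf_darts ?ts))"
      unfolding map_snd_leaf_list[symmetric] set_map ..
    moreover have "set (concat (map leaf_darts ?ts)) \<subseteq> set (concat (map tour ?ts))"
      by (auto dest: subsetD[OF leaf_darts_tour])
    ultimately show ?thesis by auto
  qed
  have zz: "fst z \<in> extensional ?C" "snd z \<in> extensional ?C" "fst z' \<in> extensional ?C" "snd z' \<in> extensional ?C"
    "bij_betw (fst z) ?C ?O"
    using z \<open>s' = s\<close> by (auto simp: word_matchings_def matchings_def plant_word_def)
  have "fst z' c = fst z c \<and> snd z' c = snd z c" if c: "c \<in> ?C" for c
  proof -
    have "f c = c" by (rule fid[OF subsetD[OF sub closings_sub[OF c]]])
    moreover have "fst z c \<in> ?O" by (rule bij_betw_apply[OF zz(5) c])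
    then have "f (fst z c) = fst z c" by (intro fid subsetD[OF sub] openings_sub)
    ultimately show ?thesis using iso'(3)[OF c] by simp
  qed
  then have "fst z = fst z'" "snd z = snd z'"
    using zz by (auto intro!: extensionalityI[of _ ?C])
  then show ?thesis using \<open>s' = s\<close> by (simp add: prod_eq_iff)
qed

text \<open>Both sides are sums over shapes, and for each shape the labellings and the matchings are
  counted by the same product of heights.\<close>

lemma card_Q_family:
  assumes m: "m \<ge> 3" and i: "i \<ge> 1" and T: "finite {t \<in> T_family m i. black_nodes t = n}"
  shows "finite {C \<in> Q_family m i. black_vertices C = n} \<and>
    card {C \<in> Q_family m i. black_vertices C = n} = card {t \<in> T_family m i. black_nodes t = n}"
proof -
  define S where "S = forget ` {t \<in> T_family m i. black_nodes t = n}"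
  define F where "F s = {t. forget t = s \<and> labels_ok (int i) (walk t)}" for s
  define codes where "codes = (SIGMA s:S. word_matchings (plant_word s) (i - 1))"
  define cls where "cls = (\<lambda>(s, z). iso_rel m i `` {plant_map s z})"
  have finS: "finite S" unfolding S_def using T by simp
  have shape: "planted_shape m s" "black_nodes s = n" if "s \<in> S" for s
    using that T_family_shape[OF m] black_nodes_forget by (auto simp: S_def)
  \<comment> \<open>\<open>S\<close> contains only shapes that admit a labelling. A shape that
    carries a matching has a nonzero product of heights and hence a labelling, so no map is
    missed.\<close>
  have in_S: "s \<in> S" if s: "planted_shape m s" "black_nodes s = n" "word_matchings (plant_word s) (i - 1) \<noteq> {}" for s
  proof -
    have "card (word_matchings (plant_word s) (i - 1)) \<noteq> 0"
      using s(3) card_plant_matchings(2)[OF s(1) m i] by simp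
    then have "height_prod (int i) (leaf_word (walk s)) \<noteq> 0"
      using card_plant_matchings(1)[OF s(1) m i] by linarith
    moreover have "int (card (F s)) = height_prod (int i) (leaf_word (walk s))"
      using card_labellings[of "int i" s] by (simp add: F_def)
    ultimately have "card (F s) \<noteq> 0" by linarith
    then obtain t where "t \<in> F s" by (metis card.empty ex_in_conv)
    then have "t \<in> T_family m i" "forget t = s" "black_nodes t = n"
      using T_family_shape[OF m, of t i] s(1,2) black_nodes_forget[of t] by (auto simp: F_def)
    then show ?thesis by (auto simp: S_def)
  qed
  have "{t \<in> T_family m i. black_nodes t = n} = (\<Union>s\<in>S. F s)"
  proof (intro equalityI subsetI)
    fix t assume "t \<in> {t \<in> T_family m i. black_nodes t = n}"
    then have "forget t \<in> S" "t \<in> F (forget t)" using T_family_shape[OF m] by (auto simp: S_def F_def)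
    then show "t \<in> (\<Union>s\<in>S. F s)" by blast
  next
    fix t assume "t \<in> (\<Union>s\<in>S. F s)"
    then show "t \<in> {t \<in> T_family m i. black_nodes t = n}"
      using shape T_family_shape[OF m, of t i] black_nodes_forget[of t] by (auto simp: F_def)
  qed
  moreover have "card (\<Union>s\<in>S. F s) = (\<Sum>s\<in>S. card (F s))"
    using finS card_labellings[of "int i"] by (intro card_UN_disjoint) (auto simp: F_def)
  moreover have "card (F s) = card (word_matchings (plant_word s) (i - 1))" if "s \<in> S" for s
  proof -
    have "int (card (F s)) = int (card (word_matchings (plant_word s) (i - 1)))"
      using card_labellings[of "int i" s] card_plant_matchings(1)[OF shape(1)[OF that] m i] by (simp add: F_def)
    then show ?thesis by simp
  qed
  moreover have "card codes = (\<Sum>s\<in>S. card (word_matchings (plant_word s) (i - 1)))"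
    unfolding codes_def using finS card_plant_matchings(2)[OF shape(1) m i] by (intro card_SigmaI) auto
  ultimately have card: "card {t \<in> T_family m i. black_nodes t = n} = card codes" by simp
  have finC: "finite codes"
    unfolding codes_def using finS card_plant_matchings(2)[OF shape(1) m i] by (intro finite_SigmaI) auto
  note equiv = equiv_iso_rel[of m i]
  have bij: "bij_betw cls codes {C \<in> Q_family m i. black_vertices C = n}"
    unfolding bij_betw_def
  proof
    show "inj_on cls codes"
    proof (rule inj_onI)
      fix x y assume xy: "x \<in> codes" "y \<in> codes" "cls x = cls y"
      obtain s z s' z' where x: "x = (s, z)" "y = (s', z')" by (cases x; cases y)
      have s: "planted_shape m s" "planted_shape m s'" and z: "z \<in> word_matchings (plant_word s) (i - 1)"
        "z' \<in> word_matchings (plant_word s') (i - 1)"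
        using xy(1,2) shape(1) by (auto simp: codes_def x)
      have "(plant_map s z, plant_map s' z') \<in> iso_rel m i"
        using xy(3) eq_equiv_class[OF _ equiv plant_map_in_Q(1)[OF s(2) m i z(2)]] by (simp add: cls_def x)
      then obtain f where "map_iso f (plant_map s z) (plant_map s' z')" by (auto simp: iso_rel_def)
      then show "x = y" using plant_map_inj[OF s m i z] by (simp add: x)
    qed
    show "cls ` codes = {C \<in> Q_family m i. black_vertices C = n}"
    proof (intro equalityI subsetI)
      fix Cl assume "Cl \<in> cls ` codes"
      then obtain s z where sz: "s \<in> S" "z \<in> word_matchings (plant_word s) (i - 1)" "Cl = iso_rel m i `` {plant_map s z}"
        by (auto simp: codes_def cls_def)
      note Q = plant_map_in_Q[OF shape(1)[OF sz(1)] m i sz(2)]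
      have "Cl \<in> Q_family m i" unfolding Q_family_def sz(3) by (rule quotientI[OF Q(1)])
      moreover have "plant_map s z \<in> Cl" unfolding sz(3) by (rule equiv_class_self[OF equiv Q(1)])
      ultimately show "Cl \<in> {C \<in> Q_family m i. black_vertices C = n}"
        using black_vertices_class Q(2) shape(2)[OF sz(1)] by auto
    next
      fix Cl assume "Cl \<in> {C \<in> Q_family m i. black_vertices C = n}"
      then have Cl: "Cl \<in> Q_family m i" "black_vertices Cl = n" by auto
      then obtain M where M: "M \<in> labelled_Q m i" "Cl = iso_rel m i `` {M}"
        unfolding Q_family_def by (auto elim: quotientE)
      have "M \<in> Cl" unfolding M(2) by (rule equiv_class_self[OF equiv M(1)])
      then have bn: "card (black M) = n" using black_vertices_class[OF Cl(1)] Cl(2) by simp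
      obtain s where s: "planted_shape m s" "black_nodes s = card (black M)"
        and ex: "\<And>u' ts'. distinct (u' # concat (map tour ts')) \<and> forest_shape ts' = s \<Longrightarrow>
          \<exists>p' e' f. (p', e') \<in> word_matchings (leaf_list u' ts') (i - 1) \<and> map_iso f M (build u' ts' p' e')"
        using labelled_Q_build[OF M(1) m i] by blast
      obtain p' e' f where pe: "(p', e') \<in> word_matchings (plant_word s) (i - 1)" "map_iso f M (plant_map s (p', e'))"
        using ex[of "fst (plant s)" "snd (plant s)"] plant[OF s(1)] by (auto simp: plant_word_def plant_map_def)
      have "s \<in> S" using in_S[OF s(1)] s(2) bn pe(1) by auto
      moreover have "(M, plant_map s (p', e')) \<in> iso_rel m i"
        using M(1) plant_map_in_Q(1)[OF s(1) m i pe(1)] pe(2) by (auto simp: iso_rel_def)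
      then have "Cl = cls (s, (p', e'))" unfolding M(2) cls_def using equiv_class_eq[OF equiv] by simp
      ultimately show "Cl \<in> cls ` codes" using pe(1) by (auto simp: codes_def)
    qed
  qed
  show ?thesis
    using card finC bij_betw_same_card[OF bij] bij_betw_finite[OF bij] by simp
qed

text \<open>Bijections between fibres of equal finite size are glued; the grading keeps the pieces
  apart.\<close>

lemma graded_bijection:
  assumes "\<And>n. finite {x \<in> A. f x = n}" "\<And>n. finite {y \<in> B. g y = n}"
    "\<And>n. card {x \<in> A. f x = n} = card {y \<in> B. g y = n}"
  shows "\<exists>\<Phi>. bij_betw \<Phi> A B \<and> (\<forall>x\<in>A. g (\<Phi> x) = f x)"
proof -
  have "\<exists>h. bij_betw h {x \<in> A. f x = n} {y \<in> B. g y = n}" for n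
    using assms by (intro finite_same_card_bij)
  then obtain h where h: "\<And>n. bij_betw (h n) {x \<in> A. f x = n} {y \<in> B. g y = n}" by metis
  define \<Phi> where "\<Phi> x = h (f x) x" for x
  have \<Phi>: "\<Phi> x \<in> B" "g (\<Phi> x) = f x" if "x \<in> A" for x
    using bij_betw_apply[OF h[of "f x"], of x] that by (auto simp: \<Phi>_def)
  have "inj_on \<Phi> A"
  proof (rule inj_onI)
    fix x y assume xy: "x \<in> A" "y \<in> A" "\<Phi> x = \<Phi> y"
    then have "f x = f y" using \<Phi>(2)[OF xy(1)] \<Phi>(2)[OF xy(2)] by simp
    then show "x = y" using bij_betw_imp_inj_on[OF h[of "f x"]] xy by (auto simp: \<Phi>_def inj_on_def)
  qed
  moreover have "B \<subseteq> \<Phi> ` A"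
  proof
    fix y assume "y \<in> B"
    then have "y \<in> h (g y) ` {x \<in> A. f x = g y}" using bij_betw_imp_surj_on[OF h[of "g y"]] by simp
    then obtain x where "x \<in> A" "f x = g y" "y = h (g y) x" by blast
    then show "y \<in> \<Phi> ` A" by (auto simp: \<Phi>_def intro!: image_eqI[of _ _ x])
  qed
  ultimately show ?thesis using \<Phi> by (intro exI[of _ \<Phi>]) (auto simp: bij_betw_def)
qed

theorem proposition4:
  fixes i m :: nat and r q :: "int \<Rightarrow> int fps"
  assumes "i \<ge> 1" and "m \<ge> 3"
    and "rq_system m r q"
  shows "(\<exists>\<Phi>. bij_betw \<Phi> (T_family m i) (Q_family m i) \<and>
               (\<forall>t\<in>T_family m i. black_vertices (\<Phi> t) = black_nodes t)) \<and>
         has_counting_series (T_family m i) black_nodes (q (int i)) \<and>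
         has_counting_series (Q_family m i) black_vertices (q (int i))"
proof -
  have T: "has_counting_series (T_family m i) black_nodes (q (int i))"
    by (rule has_counting_series_T_family[OF assms(2,1,3)])
  then have finT: "finite {t \<in> T_family m i. black_nodes t = n}" for n
    by (simp add: has_counting_series_def)
  note Q = card_Q_family[OF assms(2,1) finT]
  have "has_counting_series (Q_family m i) black_vertices (q (int i))"
    using T Q by (simp add: has_counting_series_def)
  moreover have "\<exists>\<Phi>. bij_betw \<Phi> (T_family m i) (Q_family m i) \<and>
      (\<forall>t\<in>T_family m i. black_vertices (\<Phi> t) = black_nodes t)"
    using finT Q by (intro graded_bijection) simp_all
  ultimately show ?thesis using T by blast
qed

end
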